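(* Let $\pi$ be a discrete group. If $\ln\det_\pi(A^*A)\ge0$ for all $A\in Wh(\pi)$, then the Fuglede–Kadison determinant is trivial on $Wh(\pi)$, i.e. $\ln\det_\pi(A^*A)=0$ for all $A\in Wh(\pi)$. In particular, if $\pi$ has semi-integral determinant, then $\pi$ has Whitehead-trivial determinant.
   Context: $\mathcal N\pi$ is the group von Neumann algebra, containing $\mathbb C\pi$ acting on $\ell^2(\pi)$ by left multiplication; $\operatorname{tr}_\pi(a)=(a\cdot1,1)_{\ell^2(\pi)}$ and $\operatorname{tr}_\pi((a_{ij}))=\sum_i\operatorname{tr}_\pi(a_{ii})$ for $(a_{ij})\in M(d\times d,\mathcal N\pi)$. Matrices act on $\ell^2(\pi)^d$ by left multiplication. For $\Delta\in M(d\times d,\mathcal N\pi)$ positive (semidefinite) self-adjoint, $F_\Delta(\lambda)=\operatorname{tr}_\pi\chi_{[0,\lambda]}(\Delta)$, and $\ln\det_\pi(\Delta)=\int_{0^+}^\infty\ln\lambda\,dF_\Delta(\lambda)$ if the integral converges, $-\infty$ otherwise (the regularized or Fuglede–Kadison determinant). Statements "for all $A\in Wh(\pi)$" mean: for every $d$ and every invertible $A\in Gl(d\times d,\mathbb Z\pi)$ ($\ln\det_\pi(\cdot^*\cdot)$ factors through the Whitehead group). $\pi$ has semi-integral determinant if $\ln\det_\pi(\Delta)\ge0$ for every $d$ and every positive self-adjoint $\Delta\in M(d\times d,\mathbb Z\pi)$; it has Whitehead-trivial determinant if $\ln\det_\pi(A^*A)=0$ for all $A\in Wh(\pi)$. 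*)

theory Defs
  imports
    "HOL-Analysis.Analysis"
    "HOL-Library.Poly_Mapping"
    "Jordan_Normal_Form.Matrix"
begin

text \<open>
  The discrete group is a type \<open>'g :: group_add\<close>; this class is not commutative, so
  \<open>g + h\<close>, \<open>- g\<close>, \<open>0\<close> stand for the product, the inverse and the unit of an arbitrary group.
  Its integral group ring is then \<open>'g \<Rightarrow>\<^sub>0 int\<close>, whose library multiplication is the convolution.
\<close>

type_synonym 'g group_ring = "'g \<Rightarrow>\<^sub>0 int"


section \<open>The Hilbert space of square-summable functions and its powers\<close>

definition ell2 :: "('g \<Rightarrow> complex) set" where
  "ell2 = {x. (\<lambda>g. (cmod (x g))\<^sup>2) summable_on UNIV}"

definition ell2_inner :: "('g \<Rightarrow> complex) \<Rightarrow> ('g \<Rightarrow> complex) \<Rightarrow> complex" where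
  "ell2_inner x y = (\<Sum>\<^sub>\<infinity>g. x g * cnj (y g))"

text \<open>
  The \<open>d\<close>-th power consists of families indexed by \<open>nat\<close> that vanish from index \<open>d\<close> on.
\<close>

type_synonym 'g ell2_family = "nat \<Rightarrow> 'g \<Rightarrow> complex"

type_synonym 'g ell2_op = "'g ell2_family \<Rightarrow> 'g ell2_family"

definition ell2_pow :: "nat \<Rightarrow> 'g ell2_family set" where
  "ell2_pow d = {u. (\<forall>i<d. u i \<in> ell2) \<and> (\<forall>i\<ge>d. u i = (\<lambda>_. 0))}"

definition pow_inner :: "nat \<Rightarrow> 'g ell2_family \<Rightarrow> 'g ell2_family \<Rightarrow> complex" where
  "pow_inner d u v = (\<Sum>i<d. ell2_inner (u i) (v i))"


section \<open>Operators\<close>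

text \<open>
  An everywhere defined symmetric map of a Hilbert space is automatically linear and bounded,
  so these properties are not listed.
\<close>

definition self_adjoint_op :: "nat \<Rightarrow> 'g ell2_op \<Rightarrow> bool" where
  "self_adjoint_op d T \<longleftrightarrow>
     (\<forall>u\<in>ell2_pow d. T u \<in> ell2_pow d) \<and>
     (\<forall>u\<in>ell2_pow d. \<forall>v\<in>ell2_pow d. pow_inner d (T u) v = pow_inner d u (T v))"

definition positive_self_adjoint_op :: "nat \<Rightarrow> 'g ell2_op \<Rightarrow> bool" where
  "positive_self_adjoint_op d T \<longleftrightarrow>
     self_adjoint_op d T \<and> (\<forall>u\<in>ell2_pow d. 0 \<le> Re (pow_inner d (T u) u))"

definition orthogonal_projection_op :: "nat \<Rightarrow> 'g ell2_op \<Rightarrow> bool" where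
  "orthogonal_projection_op d P \<longleftrightarrow>
     self_adjoint_op d P \<and> (\<forall>u\<in>ell2_pow d. P (P u) = P u)"


section \<open>Spectral projections\<close>

definition projection_valued_measure :: "nat \<Rightarrow> (real set \<Rightarrow> 'g ell2_op) \<Rightarrow> bool" where
  "projection_valued_measure d E \<longleftrightarrow>
     (\<forall>B\<in>sets borel. orthogonal_projection_op d (E B)) \<and>
     (\<forall>u\<in>ell2_pow d. E UNIV u = u) \<and>
     (\<forall>B\<in>sets borel. \<forall>C\<in>sets borel. \<forall>u\<in>ell2_pow d. E (B \<inter> C) u = E B (E C u)) \<and>
     (\<forall>B. range B \<subseteq> sets borel \<longrightarrow> disjoint_family B \<longrightarrow>
        (\<forall>u\<in>ell2_pow d. \<forall>v\<in>ell2_pow d.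
           (\<lambda>n::nat. pow_inner d (E (B n) u) v) sums pow_inner d (E (\<Union>n. B n) u) v))"

definition scalar_spectral_measure ::
  "nat \<Rightarrow> (real set \<Rightarrow> 'g ell2_op) \<Rightarrow> 'g ell2_family \<Rightarrow> real measure" where
  "scalar_spectral_measure d E u =
     measure_of UNIV (sets borel) (\<lambda>B. ennreal (Re (pow_inner d (E B u) u)))"

text \<open>
  \<open>E\<close> is the spectral measure of the bounded self-adjoint operator \<open>T\<close>: it has bounded support
  and \<open>T\<close> is the integral of \<open>t\<close> against \<open>E\<close>, in the weak sense.  Diagonal matrix coefficients
  suffice by polarization.
\<close>

definition is_spectral_measure :: "nat \<Rightarrow> 'g ell2_op \<Rightarrow> (real set \<Rightarrow> 'g ell2_op) \<Rightarrow> bool" where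
  "is_spectral_measure d T E \<longleftrightarrow>
     projection_valued_measure d E \<and>
     (\<exists>R. \<forall>u\<in>ell2_pow d. E {-R..R} u = u) \<and>
     (\<forall>u\<in>ell2_pow d.
        integrable (scalar_spectral_measure d E u) (\<lambda>t. t) \<and>
        pow_inner d (T u) u =
          complex_of_real (integral\<^sup>L (scalar_spectral_measure d E u) (\<lambda>t. t)))"

text \<open>
  The operator obtained from \<open>T\<close> by applying the characteristic function of the Borel set \<open>B\<close>.
  By the spectral theorem a spectral measure of a self-adjoint \<open>T\<close> exists, and its values on
  Borel sets are unique as maps on \<open>ell2_pow d\<close>; the choice operator only fixes irrelevant
  values elsewhere.
\<close>

definition spectral_projection :: "nat \<Rightarrow> 'g ell2_op \<Rightarrow> real set \<Rightarrow> 'g ell2_op" where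
  "spectral_projection d T B = (SOME E. is_spectral_measure d T E) B"


section \<open>Trace and Fuglede--Kadison determinant\<close>

definition ell2_unit :: "'g::group_add \<Rightarrow> complex" where
  "ell2_unit g = (if g = 0 then 1 else 0)"

definition vn_trace :: "(('g::group_add \<Rightarrow> complex) \<Rightarrow> 'g \<Rightarrow> complex) \<Rightarrow> complex" where
  "vn_trace a = ell2_inner (a ell2_unit) ell2_unit"

definition op_entry :: "'g ell2_op \<Rightarrow> nat \<Rightarrow> nat \<Rightarrow> ('g \<Rightarrow> complex) \<Rightarrow> 'g \<Rightarrow> complex" where
  "op_entry T i j x = T (\<lambda>k. if k = j then x else (\<lambda>_. 0)) i"

definition vn_matrix_trace :: "nat \<Rightarrow> ('g::group_add) ell2_op \<Rightarrow> complex" where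
  "vn_matrix_trace d T = (\<Sum>i<d. vn_trace (op_entry T i i))"

definition spectral_density :: "nat \<Rightarrow> ('g::group_add) ell2_op \<Rightarrow> real \<Rightarrow> real" where
  "spectral_density d T s = Re (vn_matrix_trace d (spectral_projection d T {0..s}))"

text \<open>
  \<open>interval_measure F\<close> is the Lebesgue--Stieltjes measure \<open>dF\<close>.  The spectral density is
  constant for large arguments, so the integral can only diverge at \<open>0\<close>, where \<open>ln\<close> is
  negative; hence convergence is the same as Lebesgue integrability.
\<close>

definition ln_det :: "nat \<Rightarrow> ('g::group_add) ell2_op \<Rightarrow> ereal" where
  "ln_det d T =
     (if set_integrable (interval_measure (spectral_density d T)) {0<..} ln
      then ereal (set_lebesgue_integral (interval_measure (spectral_density d T)) {0<..} ln)
      else - \<infinity>)"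


section \<open>Matrices over the integral group ring\<close>

definition group_ring_action ::
  "('g::group_add) group_ring \<Rightarrow> ('g \<Rightarrow> complex) \<Rightarrow> 'g \<Rightarrow> complex" where
  "group_ring_action a x g =
     (\<Sum>h\<in>Poly_Mapping.keys a. of_int (Poly_Mapping.lookup a h) * x (- h + g))"

definition matrix_op :: "('g::group_add) group_ring mat \<Rightarrow> 'g ell2_op" where
  "matrix_op A u i g =
     (if i < dim_row A then \<Sum>j<dim_col A. group_ring_action (A $$ (i, j)) (u j) g else 0)"

definition group_ring_star :: "('g::group_add) group_ring \<Rightarrow> 'g group_ring" where
  "group_ring_star a =
     (\<Sum>h\<in>Poly_Mapping.keys a. Poly_Mapping.single (- h) (Poly_Mapping.lookup a h))"

definition matrix_star :: "('g::group_add) group_ring mat \<Rightarrow> 'g group_ring mat" where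
  "matrix_star A = Matrix.mat (dim_col A) (dim_row A) (\<lambda>(i, j). group_ring_star (A $$ (j, i)))"

definition general_linear :: "nat \<Rightarrow> ('g::group_add) group_ring mat set" where
  "general_linear d = {A \<in> carrier_mat d d. invertible_mat A}"


section \<open>Properties of the group\<close>

definition semi_integral_determinant :: "'g::group_add itself \<Rightarrow> bool" where
  "semi_integral_determinant _ \<longleftrightarrow>
     (\<forall>d. \<forall>\<Delta>\<in>(carrier_mat d d :: 'g group_ring mat set).
        positive_self_adjoint_op d (matrix_op \<Delta>) \<longrightarrow> 0 \<le> ln_det d (matrix_op \<Delta>))"

text \<open>
  Elements of the Whitehead group are represented by invertible matrices of arbitrary size.
\<close>

definition whitehead_trivial_determinant :: "'g::group_add itself \<Rightarrow> bool" where
  "whitehead_trivial_determinant _ \<longleftrightarrow>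
     (\<forall>d. \<forall>A\<in>(general_linear d :: 'g group_ring mat set).
        ln_det d (matrix_op (matrix_star A * A)) = 0)"

end

theory Submission
  imports
    Defs
    "HOL-Probability.Helly_Selection"
    "HOL-Probability.Probability_Mass_Function"
begin

text \<open>
  For \<open>A\<close> in \<open>Gl(d, \<int>\<pi>)\<close> put \<open>C = (A\<^sup>*)\<^sup>-\<^sup>1\<close>.  This matrix is again invertible over \<open>\<int>\<pi>\<close>, and
  \<open>C\<^sup>* C = (A\<^sup>* A)\<^sup>-\<^sup>1\<close>.  The spectral measure of an inverse operator is the image of the spectral
  measure under \<open>t \<mapsto> 1/t\<close>, hence \<open>ln det (C\<^sup>* C) = - ln det (A\<^sup>* A)\<close>, and if both numbers are
  nonnegative, then both vanish.

  To know that the chosen spectral projections are the right ones, the spectral theorem for a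
  bounded positive operator \<open>T\<close> is needed.  After scaling to \<open>0 \<le> T \<le> 1\<close>, the Bernstein coefficients
  \<open>(n choose k) \<langle>T\<^sup>k (1 - T)\<^sup>n\<^sup>-\<^sup>k u, u\<rangle>\<close> are nonnegative, and Helly's theorem turns them into a measure
  \<open>\<mu>\<^sub>u\<close> on \<open>[0, 1]\<close> with \<open>\<integral> p d\<mu>\<^sub>u = \<langle>p(T) u, u\<rangle>\<close>.  Since polynomials are dense in \<open>L\<^sup>2(\<mu>\<^sub>u)\<close>, the
  spectral projection \<open>E(B) u\<close> can be defined as the limit of \<open>p\<^sub>n(T) u\<close> for polynomials \<open>p\<^sub>n\<close> that
  tend to the indicator function of \<open>B\<close>.  Two spectral measures \<open>E\<close> and \<open>F\<close> that commute are compared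
  on the ranges of \<open>E{..a} F{b..}\<close>, where the quadratic form of \<open>T\<close> would have to be both at most \<open>a\<close>
  and at least \<open>b\<close>.
\<close>

section \<open>Polynomials of a positive contraction\<close>

text \<open>\<open>spectral_projection\<close> is a \<open>SOME\<close> choice, so nothing about it
  can be used before a spectral measure is known to exist, and the choices made for an operator and
  for its inverse are unrelated until they are shown to commute. Commutation comes from uniqueness:
  a spectral measure agrees with the one built from polynomials in the operator, hence commutes with
  every bounded operator that commutes with the operator. The projections of
  \<open>A\<^sup>* A\<close> commute with it, therefore with its inverse, therefore with the
  projections of the inverse. The chosen projections are unspecified outside the \<open>d\<close>-th
  power, while completeness is a property of a whole type. All powers are therefore embedded in one
  Hilbert space over \<open>nat \<times> 'g\<close>, and resolutions are studied relative to a
  subspace \<open>V\<close>. The abstract part uses real inner products; the complex structure is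
  restored through commutation with multiplication by i. For invertible operators
  \<open>{..0}\<close> carries no spectral mass, which reconciles the intervals
  \<open>{0..s}\<close> of the spectral density with a distribution function.\<close>

definition poly_op :: "('a::real_vector \<Rightarrow> 'a) \<Rightarrow> real poly \<Rightarrow> 'a \<Rightarrow> 'a" where
  "poly_op T p = fold_coeffs (\<lambda>a f x. a *\<^sub>R x + T (f x)) p (\<lambda>_. 0)"

locale positive_contraction =
  fixes T :: "'a::{real_inner,banach} \<Rightarrow> 'a"
  assumes bounded_linear: "bounded_linear T"
    and symmetric: "inner (T x) y = inner x (T y)"
    and nonneg: "0 \<le> inner (T x) x"
    and le_one: "inner (T x) x \<le> inner x x"
begin

lemma T_simps [simp]: "T 0 = 0" "T (x + y) = T x + T y" "T (x - y) = T x - T y" "T (- x) = - T x"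
    "T (c *\<^sub>R x) = c *\<^sub>R T x"
  using bounded_linear
  by (simp_all add: linear_simps linear_0 linear_add linear_diff linear_neg linear_cmul bounded_linear.linear)

lemma poly_op_0 [simp]: "poly_op T 0 x = 0"
  by (simp add: poly_op_def)

lemma poly_op_pCons [simp]: "poly_op T (pCons a p) x = a *\<^sub>R x + T (poly_op T p x)"
  by (cases "p = 0 \<and> a = 0") (auto simp: poly_op_def)

lemma poly_op_add [simp]: "poly_op T (p + q) x = poly_op T p x + poly_op T q x"
  by (induction p q rule: poly_induct2) (simp_all add: algebra_simps)

lemma poly_op_smult [simp]: "poly_op T (Polynomial.smult c p) x = c *\<^sub>R poly_op T p x"
  by (induction p) (simp_all add: algebra_simps)

lemma poly_op_diff [simp]: "poly_op T (p - q) x = poly_op T p x - poly_op T q x"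
  using poly_op_add[of p "Polynomial.smult (-1) q" x] poly_op_smult[of "-1" q x] by simp

lemma poly_op_mult [simp]: "poly_op T (p * q) x = poly_op T p (poly_op T q x)"
  by (induction p) simp_all

lemma poly_op_1 [simp]: "poly_op T 1 x = x"
  by (simp add: one_pCons)

lemma poly_op_linear: "poly_op T p (x + y) = poly_op T p x + poly_op T p y"
    "poly_op T p (c *\<^sub>R x) = c *\<^sub>R poly_op T p x"
  by (induction p) (simp_all add: algebra_simps)

lemma poly_op_symmetric: "inner (poly_op T p x) y = inner x (poly_op T p y)"
proof (induction p arbitrary: x y)
  case (pCons a p)
  \<comment> \<open>Commutativity of the polynomial ring, read with \<open>[:0, 1:]\<close> as
    \<open>T\<close>, shows that \<open>p(T)\<close> and \<open>T\<close> commute.\<close>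
  have "poly_op T p (T y) = poly_op T (p * [:0, 1:]) y"
    by (subst poly_op_mult) simp
  also have "\<dots> = T (poly_op T p y)"
    by (subst mult.commute, subst poly_op_mult) simp
  finally show ?case
    using pCons by (simp add: inner_add_left inner_add_right symmetric)
qed simp

lemma norm_poly_op: "(norm (poly_op T p x))\<^sup>2 = inner (poly_op T (p * p) x) x"
  by (simp add: power2_norm_eq_inner poly_op_symmetric)

text \<open>No square root of \<open>T\<close> is at hand, so squares are split off instead: with
  half of the even part of the exponents collected in \<open>q\<close>, the form at \<open>u\<close>
  becomes the form of \<open>r(T)\<close> at \<open>q(T) u\<close>, where \<open>r\<close> has
  exponents 0 or 1, and four cases remain.\<close>

lemma poly_op_monomial_nonneg: "0 \<le> inner (poly_op T ([:0,1:] ^ k * [:1,-1:] ^ m) u) u"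
proof -
  define q :: "real poly" where "q = [:0,1:] ^ (k div 2) * [:1,-1:] ^ (m div 2)"
  define r :: "real poly" where "r = [:0,1:] ^ (k mod 2) * [:1,-1:] ^ (m mod 2)"
  define v where "v = poly_op T q u"
  have pow: "p ^ n = p ^ (n div 2) * p ^ (n mod 2) * p ^ (n div 2)" for p :: "real poly" and n
  proof -
    have "n = n div 2 + n mod 2 + n div 2" by presburger
    then show ?thesis by (metis power_add)
  qed
  have "[:0,1:] ^ k * [:1,-1:] ^ m = q * r * q"
    unfolding q_def r_def by (subst pow[of _ k], subst pow[of _ m]) (simp only: mult_ac)
  then have eq: "inner (poly_op T ([:0,1:] ^ k * [:1,-1:] ^ m) u) u = inner (poly_op T r v) v"
    by (simp add: v_def poly_op_symmetric)
  have one: "0 \<le> inner (poly_op T [:1,-1:] w) w" for w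
    using le_one[of w] by (simp add: inner_diff_left inner_add_left)
  \<comment> \<open>The one case of the four that is not immediate: x (1 - x) = x (1 - x) x + (1 -
    x) x (1 - x) displays the form of T (1 - T) at \<open>v\<close> as a form of 1 - T at T v plus a
    form of T at (1 - T) v.\<close>
  have "[:0,1:] * [:1,-1:] = ([:0,1:] * [:1,-1:] * [:0,1:] + [:1,-1:] * [:0,1:] * [:1,-1:] :: real poly)"
    by simp
  then have "inner (poly_op T ([:0,1:] * [:1,-1:]) v) v =
      inner (poly_op T ([:0,1:] * [:1,-1:] * [:0,1:]) v) v + inner (poly_op T ([:1,-1:] * [:0,1:] * [:1,-1:]) v) v"
    by (metis inner_add_left poly_op_add)
  also have "\<dots> = inner (poly_op T [:1,-1:] (T v)) (T v) + inner (T (poly_op T [:1,-1:] v)) (poly_op T [:1,-1:] v)"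
    by (simp add: symmetric inner_diff algebra_simps)
  also have "\<dots> \<ge> 0"
    using one nonneg by (intro add_nonneg_nonneg)
  finally have two: "0 \<le> inner (poly_op T ([:0,1:] * [:1,-1:]) v) v" .
  have "k mod 2 = 0 \<or> k mod 2 = 1" "m mod 2 = 0 \<or> m mod 2 = 1"
    by auto
  then show ?thesis
    unfolding eq r_def using one[of v] two nonneg[of v] by (elim disjE) simp_all
qed

end

text \<open>Choosing \<open>k\<close> among \<open>j\<close> chosen elements can be done in the
  other order, which leaves the Bernstein polynomials of degree \<open>n - k\<close>, whose sum is
  1. Up to k! this is the factorial moment of the binomial distribution.\<close>

lemma sum_binomial_Bernstein:
  "(\<Sum>j\<le>n. real (j choose k) * Bernstein n j x) = real (n choose k) * x ^ k"
proof (cases "k \<le> n")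
  case True
  have "(\<Sum>j\<le>n. real (j choose k) * Bernstein n j x) = (\<Sum>j\<in>{k..n}. real (j choose k) * Bernstein n j x)"
    by (rule sum.mono_neutral_right) auto
  also have "\<dots> = (\<Sum>i\<le>n - k. real ((i + k) choose k) * Bernstein n (i + k) x)"
    by (rule sum.reindex_bij_witness[of _ "\<lambda>i. i + k" "\<lambda>j. j - k"]) (use True in auto)
  also have "\<dots> = (\<Sum>i\<le>n - k. real (n choose k) * x ^ k * Bernstein (n - k) i x)"
  proof (rule sum.cong)
    fix i assume "i \<in> {..n - k}"
    then have i: "i + k \<le> n" using True by auto
    have "((i + k) choose k) * (n choose (i + k)) = (n choose k) * ((n - k) choose i)"
      using choose_mult[of k "i + k" n] i by (simp add: mult.commute)
    then have "real ((i + k) choose k) * real (n choose (i + k)) = real (n choose k) * real ((n - k) choose i)"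
      by (metis of_nat_mult)
    moreover have "n - (i + k) = n - k - i" by simp
    ultimately show "real ((i + k) choose k) * Bernstein n (i + k) x = real (n choose k) * x ^ k * Bernstein (n - k) i x"
      unfolding Bernstein_def power_add by (simp only: mult.assoc[symmetric]) (simp only: mult_ac)
  qed simp
  also have "\<dots> = real (n choose k) * x ^ k"
    by (simp add: sum_distrib_left[symmetric])
  finally show ?thesis .
next
  case False
  then show ?thesis by (auto simp: binomial_eq_0)
qed

text \<open>Both terms are products of \<open>k\<close> factors, and corresponding factors differ by
  at most \<open>k / (n - k)\<close>. The assumption \<open>2 * k < n\<close> keeps all factors in
  [-1, 1], also the negative ones that occur for \<open>j < k\<close>, so that the errors just add
  up.\<close>

lemma binomial_ratio_approx:
  assumes "j \<le> n" "2 * k < n"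
  shows "\<bar>real (j choose k) / real (n choose k) - (real j / real n) ^ k\<bar> \<le> real k * real k / real (n - k)"
proof -
  have n: "n > 0" "k < n" using assms by auto
  have 1: "real (m choose k) = (\<Prod>i<k. (real m - real i) / (real k - real i))" for m
    by (simp add: binomial_gbinomial gbinomial_altdef_of_nat atLeast0LessThan)
  have 2: "real (j choose k) / real (n choose k) = (\<Prod>i<k. (real j - real i) / (real n - real i))"
    unfolding 1 prod_dividef[symmetric] by (rule prod.cong) auto
  have "\<bar>(\<Prod>i<k. (real j - real i) / (real n - real i)) - (\<Prod>i<k. real j / real n)\<bar>
      \<le> (\<Sum>i<k. \<bar>(real j - real i) / (real n - real i) - real j / real n\<bar>)"
    using norm_prod_diff[of "{..<k}" "\<lambda>i. (real j - real i) / (real n - real i)" "\<lambda>i. real j / real n"] assms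
    by (auto simp: divide_simps)
  also have "\<dots> \<le> (\<Sum>i<k. real k / real (n - k))"
  proof (rule sum_mono)
    fix i assume "i \<in> {..<k}"
    then have i: "i < k" by simp
    have "(real j - real i) / (real n - real i) - real j / real n = - (real i * (real n - real j) / (real n * (real n - real i)))"
      using i n by (simp add: field_simps)
    then have "\<bar>(real j - real i) / (real n - real i) - real j / real n\<bar> = real i * ((real n - real j) / real n) / (real n - real i)"
      using i n assms by (simp add: abs_mult)
    also have "\<dots> \<le> real k * 1 / real (n - k)"
      using i n assms by (intro frac_le mult_mono) (auto simp: of_nat_diff divide_simps)
    finally show "\<bar>(real j - real i) / (real n - real i) - real j / real n\<bar> \<le> real k / real (n - k)" by simp
  qed
  finally show ?thesis
    unfolding 2 by simp
qed


section \<open>The Hausdorff moment problem\<close>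

text \<open>The weights \<open>L (b n j)\<close> at the points \<open>j / n\<close> form a
  probability measure on [0, 1]. Its factorial moments are given exactly by \<open>L\<close>, and
  after normalisation the ordinary moments differ from these by a term of order 1/n, so a weak limit
  has the moments prescribed by \<open>L\<close>.\<close>

lemma hausdorff_moment_problem:
  fixes L :: "real poly \<Rightarrow> real"
  assumes add: "\<And>p q. L (p + q) = L p + L q"
    and smult: "\<And>c p. L (Polynomial.smult c p) = c * L p"
    and nonneg: "\<And>k m. 0 \<le> L ([:0,1:] ^ k * [:1,-1:] ^ m)"
    and one: "L 1 = 1"
  shows "\<exists>M. real_distribution M \<and> (AE t in M. t \<in> {0..1}) \<and> (\<forall>p. (LINT t|M. poly p t) = L p)"
proof -
  have L0: "L 0 = 0"
    using smult[of 0 0] by simp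
  have L_sum: "L (\<Sum>i\<in>I. p i) = (\<Sum>i\<in>I. L (p i))" for I :: "nat set" and p
    by (induction I rule: infinite_finite_induct) (auto simp: add L0)
  define b :: "nat \<Rightarrow> nat \<Rightarrow> real poly"
    where "b n j = Polynomial.smult (real (n choose j)) ([:0,1:] ^ j * [:1,-1:] ^ (n - j))" for n j
  define w where "w n j = (if j \<le> n then L (b n j) else 0)" for n j
  have b: "poly (b n j) x = Bernstein n j x" for n j x
    by (simp add: b_def Bernstein_def)
  have w_nonneg: "0 \<le> w n j" for n j
    by (simp add: w_def b_def smult nonneg)
  have w_moment: "(\<Sum>j\<le>n. real (j choose k) * w n j) = real (n choose k) * L ([:0,1:] ^ k)" for n k
  proof -
    have "(\<Sum>j\<le>n. Polynomial.smult (real (j choose k)) (b n j)) = Polynomial.smult (real (n choose k)) ([:0,1:] ^ k)"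
      by (intro poly_ext) (simp add: poly_sum b sum_binomial_Bernstein)
    from arg_cong[OF this, of L] show ?thesis
      by (simp add: L_sum smult w_def)
  qed
  have w_sum: "(\<Sum>j\<le>n. w n j) = 1" for n
    using w_moment[of 0 n] by (simp add: one)
  have w_nn: "(\<integral>\<^sup>+j. ennreal (w n j) \<partial>count_space UNIV) = 1" for n
  proof -
    have "(\<integral>\<^sup>+j. ennreal (w n j) \<partial>count_space UNIV) = (\<Sum>j\<le>n. ennreal (w n j))"
      by (rule nn_integral_count_space') (auto simp: w_def)
    then show ?thesis
      by (simp add: w_nonneg w_sum)
  qed
  define P where "P n = embed_pmf (w n)" for n
  have pmf_P: "pmf (P n) j = w n j" for n j
    unfolding P_def by (rule pmf_embed_pmf) (auto simp: w_nonneg w_nn)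
  define \<mu> where "\<mu> n = distr (measure_pmf (P n)) borel (\<lambda>j. real j / real n)" for n
  have \<mu>: "real_distribution (\<mu> n)" for n
    unfolding \<mu>_def by (rule prob_space.real_distribution_distr) (auto intro: prob_space_measure_pmf)
  have int_\<mu>: "(LINT t|\<mu> n. f t) = (\<Sum>j\<le>n. f (real j / real n) * w n j)"
    if "f \<in> borel_measurable borel" for f :: "real \<Rightarrow> real" and n
  proof -
    have "(LINT t|\<mu> n. f t) = (LINT j|measure_pmf (P n). f (real j / real n))"
      unfolding \<mu>_def by (rule integral_distr) (use that in auto)
    also have "\<dots> = (\<Sum>j\<in>{..n}. f (real j / real n) * pmf (P n) j)"
      by (rule integral_measure_pmf_real) (auto simp: set_pmf_eq pmf_P w_def split: if_splits)
    finally show ?thesis by (simp add: pmf_P)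
  qed
  have in01: "real j / real n \<in> {0..1}" if "j \<le> n" for j n
    using that by (auto simp: divide_simps)
  have "tight \<mu>"
    unfolding tight_def
  proof (intro conjI allI impI \<mu>)
    fix e :: real assume e: "0 < e"
    \<comment> \<open>Tightness is phrased with half-open intervals; starting at -1 keeps a possible
      atom at 0.\<close>
    have "1 - e < measure (\<mu> n) {-1<..1}" for n
    proof -
      have "measure (\<mu> n) {-1<..1} = (LINT t|\<mu> n. indicator {-1<..1} t)"
        using \<mu>[of n] by (simp add: real_distribution.space_eq_univ)
      also have "\<dots> = (\<Sum>j\<le>n. indicator {-1<..1} (real j / real n) * w n j)"
        by (rule int_\<mu>) simp
      also have "\<dots> = (\<Sum>j\<le>n. w n j)"
      proof (rule sum.cong)
        fix j assume "j \<in> {..n}"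
        moreover have "{0..1} \<subseteq> {-1<..1::real}" by auto
        ultimately have "real j / real n \<in> {-1<..1}" using in01[of j n] by blast
        then show "indicator {-1<..1} (real j / real n) * w n j = w n j" by simp
      qed simp
      finally show ?thesis using e by (simp add: w_sum)
    qed
    then show "\<exists>a b. a < b \<and> (\<forall>n. 1 - e < measure (\<mu> n) {a<..b})"
      by (intro exI[of _ "-1"] exI[of _ 1]) auto
  qed
  then obtain r M where r: "strict_mono r" and M: "real_distribution M" and conv: "weak_conv_m (\<mu> \<circ> id \<circ> r) M"
    using tight_imp_convergent_subsubsequence[of \<mu> id] by (auto simp: strict_mono_def)
  interpret M: real_distribution M by (rule M)
  have limit: "(\<lambda>n. LINT t|\<mu> (r n). f t) \<longlonglongrightarrow> (LINT t|M. f t)"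
    if "\<And>x. isCont f x" "\<And>x. \<bar>f x\<bar> \<le> 1" for f :: "real \<Rightarrow> real"
    using weak_conv_imp_integral_bdd_continuous_conv[OF _ M conv, of f 1] that \<mu> by simp
  have ae: "AE t in M. t \<in> {0..1}"
  proof -
    \<comment> \<open>A bounded continuous function that vanishes exactly on [0, 1]: its integrals
      against the discrete measures are 0, hence so is its integral against
      \<open>M\<close>.\<close>
    define f :: "real \<Rightarrow> real" where "f t = min 1 (max 0 (max (-t) (t - 1)))" for t
    have cont: "isCont f x" for x
      unfolding f_def by (intro continuous_intros)
    have meas: "f \<in> borel_measurable borel"
      unfolding f_def by measurable
    have f01: "f t = 0" if "t \<in> {0..1}" for t
      using that by (auto simp: f_def)
    have "(LINT t|\<mu> n. f t) = 0" for n
      unfolding int_\<mu>[OF meas] by (rule sum.neutral) (use in01 f01 in auto)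
    moreover have "\<bar>f x\<bar> \<le> 1" for x
      by (auto simp: f_def)
    ultimately have "(LINT t|M. f t) = 0"
      using limit[OF cont] by (simp add: LIMSEQ_const_iff)
    moreover have "integrable M f"
      by (rule M.integrable_const_bound[of _ 1]) (use meas in \<open>auto simp: f_def\<close>)
    moreover have "0 \<le> f t" for t
      by (simp add: f_def)
    ultimately have "AE t in M. f t = 0"
      by (subst integral_nonneg_eq_0_iff_AE[symmetric]) auto
    then show ?thesis
      by eventually_elim (auto simp: f_def min_def max_def split: if_splits)
  qed
  have moment: "(LINT t|M. t ^ k) = L ([:0,1:] ^ k)" for k
  proof -
    \<comment> \<open>Weak convergence tests bounded functions, so the power is cut off outside
      [0, 1], where neither the discrete measures nor \<open>M\<close> have mass.\<close>
    define f :: "real \<Rightarrow> real" where "f t = (max 0 (min 1 t)) ^ k" for t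
    have cont: "isCont f x" for x
      unfolding f_def by (intro continuous_intros)
    have meas: "f \<in> borel_measurable borel"
      unfolding f_def by measurable
    have f01: "f t = t ^ k" if "t \<in> {0..1}" for t
      using that by (auto simp: f_def)
    have "\<bar>f x\<bar> \<le> 1" for x
      by (auto simp: f_def power_le_one)
    then have lim1: "(\<lambda>n. LINT t|\<mu> (r n). f t) \<longlonglongrightarrow> (LINT t|M. f t)"
      by (rule limit[OF cont])
    have "norm ((LINT t|\<mu> n. f t) - L ([:0,1:] ^ k)) \<le> real k * real k / real (n - k)" if n: "2 * k < n" for n
    proof -
      have "L ([:0,1:] ^ k) = (\<Sum>j\<le>n. real (j choose k) / real (n choose k) * w n j)"
        using w_moment[where k = k and n = n] n by (simp add: sum_divide_distrib[symmetric] field_simps)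
      then have "(LINT t|\<mu> n. f t) - L ([:0,1:] ^ k)
          = (\<Sum>j\<le>n. ((real j / real n) ^ k - real (j choose k) / real (n choose k)) * w n j)"
        unfolding int_\<mu>[OF meas] using in01 by (simp add: f01 sum_subtractf left_diff_distrib)
      also have "\<bar>\<dots>\<bar> \<le> (\<Sum>j\<le>n. real k * real k / real (n - k) * w n j)"
      proof (rule order_trans[OF sum_abs sum_mono])
        fix j assume "j \<in> {..n}"
        then have "\<bar>(real j / real n) ^ k - real (j choose k) / real (n choose k)\<bar> \<le> real k * real k / real (n - k)"
          using binomial_ratio_approx[of j n k] n by (simp add: abs_minus_commute)
        then show "\<bar>((real j / real n) ^ k - real (j choose k) / real (n choose k)) * w n j\<bar> \<le> real k * real k / real (n - k) * w n j"
          unfolding abs_mult abs_of_nonneg[OF w_nonneg] by (rule mult_right_mono) (rule w_nonneg)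
      qed
      also have "\<dots> = real k * real k / real (n - k)"
        by (simp only: sum_distrib_left[symmetric] w_sum mult_1_right)
      finally show ?thesis by simp
    qed
    then have "eventually (\<lambda>n. norm ((LINT t|\<mu> n. f t) - L ([:0,1:] ^ k)) \<le> real k * real k / real (n - k)) sequentially"
      by (intro eventually_sequentiallyI[of "2 * k + 1"]) auto
    moreover have "(\<lambda>n. real k * real k / real (n - k)) \<longlonglongrightarrow> 0"
      by (rule LIMSEQ_offset[of _ k]) (simp, intro tendsto_divide_0[OF tendsto_const] filterlim_at_top_imp_at_infinity filterlim_real_sequentially)
    ultimately have "(\<lambda>n. (LINT t|\<mu> n. f t) - L ([:0,1:] ^ k)) \<longlonglongrightarrow> 0"
      by (rule Lim_null_comparison)
    then have "(\<lambda>n. LINT t|\<mu> n. f t) \<longlonglongrightarrow> L ([:0,1:] ^ k)"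
      using LIM_zero_iff by blast
    then have "(\<lambda>n. LINT t|\<mu> (r n). f t) \<longlonglongrightarrow> L ([:0,1:] ^ k)"
      using LIMSEQ_subseq_LIMSEQ[OF _ r] by (auto simp: o_def)
    with lim1 have "(LINT t|M. f t) = L ([:0,1:] ^ k)"
      by (rule LIMSEQ_unique)
    moreover have "(LINT t|M. f t) = (LINT t|M. t ^ k)"
      by (rule integral_cong_AE) (use meas ae f01 in auto)
    ultimately show ?thesis by simp
  qed
  have int_pow: "integrable M (\<lambda>t. t ^ k)" for k
  proof (rule M.integrable_const_bound[of _ 1])
    show "AE x in M. norm (x ^ k) \<le> 1"
      using ae by eventually_elim (auto simp: power_abs power_le_one)
  qed auto
  have "(LINT t|M. poly p t) = L p" for p
  proof -
    have "(LINT t|M. poly p t) = (LINT t|M. (\<Sum>i\<le>degree p. coeff p i * t ^ i))"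
      by (simp add: poly_altdef)
    also have "\<dots> = (\<Sum>i\<le>degree p. coeff p i * L ([:0,1:] ^ i))"
      using int_pow by (subst Bochner_Integration.integral_sum) (auto simp: moment)
    also have "\<dots> = L (\<Sum>i\<le>degree p. Polynomial.smult (coeff p i) ([:0,1:] ^ i))"
      by (simp add: L_sum smult)
    also have "(\<Sum>i\<le>degree p. Polynomial.smult (coeff p i) ([:0,1:] ^ i)) = p"
      by (intro poly_ext) (simp add: poly_sum poly_altdef[of p])
    finally show ?thesis .
  qed
  then show ?thesis using M ae by blast
qed


section \<open>Density of the polynomials\<close>

lemma finite_measure_integrable_unit:
  fixes f :: "real \<Rightarrow> real"
  assumes "finite_measure M" "sets M = sets borel" "AE t in M. t \<in> {0..1}"
    and "f \<in> borel_measurable borel" "\<And>t. t \<in> {0..1} \<Longrightarrow> \<bar>f t\<bar> \<le> K"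
  shows "integrable M f"
proof -
  interpret finite_measure M by fact
  show ?thesis
  proof (rule integrable_const_bound[of _ K])
    show "AE t in M. norm (f t) \<le> K"
      using assms(3) by eventually_elim (auto simp: assms(5))
  qed (use assms measurable_cong_sets in blast)
qed

lemma poly_bounded_unit: "\<exists>K. \<forall>t\<in>{0..1::real}. \<bar>poly p t\<bar> \<le> K"
proof -
  have "bounded (poly p ` {0..1::real})"
    by (intro compact_imp_bounded compact_continuous_image continuous_intros) auto
  then show ?thesis
    by (auto simp: bounded_iff)
qed

lemma borel_measurable_poly [measurable]: "poly (p :: real poly) \<in> borel_measurable borel"
  by (intro borel_measurable_continuous_onI continuous_intros)

lemma finite_measure_integrable_poly_diff_square:
  fixes f :: "real \<Rightarrow> real"
  assumes M: "finite_measure M" "sets M = sets borel" "AE t in M. t \<in> {0..1}"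
    and f: "f \<in> borel_measurable borel" "\<And>t. \<bar>f t\<bar> \<le> 1"
  shows "integrable M (\<lambda>t. (poly p t - f t)\<^sup>2)"
proof -
  obtain K where K: "\<forall>t\<in>{0..1}. \<bar>poly p t\<bar> \<le> K" using poly_bounded_unit by blast
  show ?thesis
  proof (rule finite_measure_integrable_unit[OF M])
    show "(\<lambda>t. (poly p t - f t)\<^sup>2) \<in> borel_measurable borel"
      using f(1) by measurable
    fix t :: real assume "t \<in> {0..1}"
    then have "\<bar>poly p t - f t\<bar> \<le> K + 1"
      using K f(2)[of t] by (smt (verit))
    then have "\<bar>poly p t - f t\<bar>\<^sup>2 \<le> (K + 1)\<^sup>2"
      by (rule power_mono) simp
    then show "\<bar>(poly p t - f t)\<^sup>2\<bar> \<le> (K + 1)\<^sup>2"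
      by simp
  qed
qed

lemma square_sum_le: "(a + b)\<^sup>2 \<le> 2 * a\<^sup>2 + 2 * (b::real)\<^sup>2"
  using sum_squares_bound[of a b] by (simp add: power2_sum)

text \<open>The sets that can be approximated to every precision, for all measures of the family at
  once, form a Dynkin system containing the half-lines \<open>{..a}\<close>. A family of measures is
  treated because limits along one sequence of polynomials will be compared on several
  vectors.\<close>

lemma polynomials_dense_L2:
  fixes M :: "'i \<Rightarrow> real measure"
  assumes I: "finite I"
    and fin: "\<And>i. i \<in> I \<Longrightarrow> finite_measure (M i)"
    and sets: "\<And>i. i \<in> I \<Longrightarrow> sets (M i) = sets borel"
    and unit: "\<And>i. i \<in> I \<Longrightarrow> AE t in M i. t \<in> {0..1}"
    and B: "B \<in> sets borel" and e: "0 < e"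
  shows "\<exists>p. \<forall>i\<in>I. (LINT t|M i. (poly p t - indicator B t)\<^sup>2) < e"
proof -
  have space: "space (M i) = UNIV" if "i \<in> I" for i
    using sets_eq_imp_space_eq[OF sets[OF that]] by simp
  have integrable: "integrable (M i) (\<lambda>t. (poly p t - indicator A t)\<^sup>2)"
    if "i \<in> I" "A \<in> sets borel" for i p and A :: "real set"
    using that by (intro finite_measure_integrable_poly_diff_square fin sets unit) (auto simp: indicator_def)
  have "Int_stable (range (\<lambda>a::real. {..a}))"
    by (auto simp: Int_stable_def)
  moreover have "range (\<lambda>a::real. {..a}) \<subseteq> Pow UNIV"
    by simp
  moreover have "B \<in> sigma_sets UNIV (range (\<lambda>a::real. {..a}))"
    using B by (subst (asm) borel_eq_atMost) simp
  ultimately have "\<forall>e>0. \<exists>p. \<forall>i\<in>I. (LINT t|M i. (poly p t - indicator B t)\<^sup>2) < e"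
  proof (induction rule: sigma_sets_induct_disjoint)
    case (basic A)
    then obtain a where A: "A = {..a}" by auto
    show ?case
    proof (intro allI impI)
      fix e :: real assume e: "0 < e"
      \<comment> \<open>For positive \<open>n\<close> a ramp that is 1 up to \<open>a\<close> and 0
        from \<open>a + 1 / n\<close> on: continuous, so that the Weierstrass theorem applies, and
        pointwise convergent to the indicator.\<close>
      define f where "f n t = max 0 (min 1 (1 - real n * (t - a)))" for n t
      have [measurable]: "f n \<in> borel_measurable borel" for n
        unfolding f_def by measurable
      have cont: "continuous_on {0..1} (f n)" for n
        unfolding f_def by (intro continuous_intros)
      have f01: "0 \<le> f n t" "f n t \<le> 1" for n t
        by (auto simp: f_def)
      have "(\<lambda>n. LINT t|M i. (f n t - indicator A t)\<^sup>2) \<longlonglongrightarrow> (LINT t|M i. 0)" if i: "i \<in> I" for i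
      proof (rule integral_dominated_convergence[where w = "\<lambda>_. 1"])
        show "AE t in M i. (\<lambda>n. (f n t - indicator A t)\<^sup>2) \<longlonglongrightarrow> 0"
        proof (rule AE_I2)
          fix t
          have "eventually (\<lambda>n. f n t = indicator A t) sequentially"
          proof (cases "t \<le> a")
            case True
            then have "real n * (t - a) \<le> 0" for n
              by (simp add: mult_nonneg_nonpos)
            then have "f n t = 1" for n
              unfolding f_def by (simp add: min_absorb1)
            then show ?thesis using True by (simp add: A)
          next
            case False
            then obtain N :: nat where N: "1 / (t - a) < real N"
              using reals_Archimedean2 by blast
            have "f n t = 0" if "N \<le> n" for n
            proof -
              have "1 / (t - a) \<le> real n" using N that by simp
              then have "1 \<le> real n * (t - a)" using False by (simp add: divide_simps)
              then show ?thesis by (simp add: f_def)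
            qed
            then show ?thesis using False by (auto simp: A eventually_sequentially)
          qed
          then have "eventually (\<lambda>n. (f n t - indicator A t)\<^sup>2 = 0) sequentially"
            by eventually_elim simp
          then show "(\<lambda>n. (f n t - indicator A t)\<^sup>2) \<longlonglongrightarrow> 0"
            by (rule tendsto_eventually)
        qed
        show "AE t in M i. norm ((f n t - indicator A t)\<^sup>2) \<le> 1" for n
        proof (rule AE_I2)
          fix t
          have "\<bar>f n t - indicator A t\<bar> \<le> 1"
            using f01[of n t] by (auto simp: indicator_def)
          then show "norm ((f n t - indicator A t)\<^sup>2) \<le> 1"
            by (simp add: abs_square_le_1)
        qed
        show "integrable (M i) (\<lambda>_. 1)"
          using fin[OF i] by (simp add: finite_measure.integrable_const)
        show "(\<lambda>t. (f n t - indicator A t)\<^sup>2) \<in> borel_measurable (M i)" for n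
          unfolding A measurable_cong_sets[OF sets[OF i] refl] by measurable
      qed simp
      then have "\<forall>i\<in>I. eventually (\<lambda>n. (LINT t|M i. (f n t - indicator A t)\<^sup>2) < e / 4) sequentially"
        using e by (auto intro!: order_tendstoD(2)[where y = 0])
      then have "eventually (\<lambda>n. \<forall>i\<in>I. (LINT t|M i. (f n t - indicator A t)\<^sup>2) < e / 4) sequentially"
        by (rule eventually_ball_finite[OF I])
      then obtain n where n: "\<forall>i\<in>I. (LINT t|M i. (f n t - indicator A t)\<^sup>2) < e / 4"
        by (auto simp: eventually_sequentially)
      define C where "C = (\<Sum>i\<in>I. measure (M i) UNIV)"
      have C: "measure (M i) UNIV \<le> C" if "i \<in> I" for i
        unfolding C_def by (rule member_le_sum) (use that I in auto)
      have C0: "0 \<le> C"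
        unfolding C_def by (simp add: sum_nonneg)
      \<comment> \<open>Chosen so that \<open>2 * \<delta>\<^sup>2 * (C + 1)\<close> is
        \<open>e / 2\<close>; \<open>C + 1\<close> exceeds every total mass and stays positive when
        \<open>C = 0\<close>.\<close>
      define \<delta> where "\<delta> = sqrt (e / (4 * (C + 1)))"
      have \<delta>: "0 < \<delta>" "\<delta>\<^sup>2 = e / (4 * (C + 1))"
        using e C0 by (auto simp: \<delta>_def)
      obtain N where N: "\<forall>m x. N \<le> m \<and> x \<in> {0..1} \<longrightarrow> \<bar>f n x - (\<Sum>k\<le>m. f n (k/m) * Bernstein m k x)\<bar> < \<delta>"
        using Bernstein_Weierstrass[OF cont \<delta>(1)] by blast
      define p where "p = (\<Sum>k\<le>N. Polynomial.smult (f n (k/N) * real (N choose k)) ([:0,1:] ^ k * [:1,-1:] ^ (N - k)))"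
      have p: "poly p x = (\<Sum>k\<le>N. f n (k/N) * Bernstein N k x)" for x
        by (simp add: p_def poly_sum Bernstein_def mult_ac)
      have close: "\<bar>poly p x - f n x\<bar> \<le> \<delta>" if "x \<in> {0..1}" for x
        using N[rule_format, of N x] that unfolding p by (simp add: abs_minus_commute)
      have "(LINT t|M i. (poly p t - indicator A t)\<^sup>2) < e" if i: "i \<in> I" for i
      proof -
        interpret finite_measure "M i" by (rule fin[OF i])
        have int: "integrable (M i) (\<lambda>t. (f n t - indicator A t)\<^sup>2)"
        proof (rule finite_measure_integrable_unit[OF fin sets unit, of _ _ 1])
          fix t :: real
          have "\<bar>f n t - indicator A t\<bar> \<le> 1"
            using f01[of n t] by (auto simp: indicator_def)
          then show "\<bar>(f n t - indicator A t)\<^sup>2\<bar> \<le> 1"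
            by (simp add: abs_square_le_1)
        qed (use i in \<open>auto simp: A\<close>)
        have "(LINT t|M i. (poly p t - indicator A t)\<^sup>2) \<le> (LINT t|M i. 2 * \<delta>\<^sup>2 + 2 * (f n t - indicator A t)\<^sup>2)"
        proof (rule integral_mono_AE)
          show "AE t in M i. (poly p t - indicator A t)\<^sup>2 \<le> 2 * \<delta>\<^sup>2 + 2 * (f n t - indicator A t)\<^sup>2"
            using unit[OF i]
          proof eventually_elim
            fix t :: real assume "t \<in> {0..1}"
            then have "(poly p t - f n t)\<^sup>2 \<le> \<delta>\<^sup>2"
              using close[of t] \<delta>(1) by (simp add: abs_le_square_iff[symmetric])
            then show "(poly p t - indicator A t)\<^sup>2 \<le> 2 * \<delta>\<^sup>2 + 2 * (f n t - indicator A t)\<^sup>2"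
              using square_sum_le[of "poly p t - f n t" "f n t - indicator A t"] by simp
          qed
        qed (use i int integrable A in \<open>auto intro!: Bochner_Integration.integrable_add\<close>)
        also have "\<dots> = 2 * \<delta>\<^sup>2 * measure (M i) UNIV + 2 * (LINT t|M i. (f n t - indicator A t)\<^sup>2)"
          using int by (subst Bochner_Integration.integral_add) (auto simp: space[OF i])
        also have "\<dots> < 2 * \<delta>\<^sup>2 * (C + 1) + 2 * (e / 4)"
          using n i C[OF i] \<delta>(1) by (intro add_le_less_mono mult_left_mono mult_strict_left_mono) auto
        also have "\<dots> = e"
          unfolding \<delta>(2) using C0 by (simp add: field_simps)
        finally show ?thesis .
      qed
      then show "\<exists>p. \<forall>i\<in>I. (LINT t|M i. (poly p t - indicator A t)\<^sup>2) < e"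
        by blast
    qed
  next
    case empty
    show ?case by (auto intro!: exI[of _ 0])
  next
    case (compl A)
    show ?case
    proof (intro allI impI)
      fix e :: real assume "0 < e"
      then obtain p where p: "\<forall>i\<in>I. (LINT t|M i. (poly p t - indicator A t)\<^sup>2) < e"
        using compl by blast
      have "(poly (1 - p) t - indicator (UNIV - A) t)\<^sup>2 = (poly p t - indicator A t)\<^sup>2" for t
        by (auto simp: indicator_def power2_commute)
      then show "\<exists>p. \<forall>i\<in>I. (LINT t|M i. (poly p t - indicator (UNIV - A) t)\<^sup>2) < e"
        using p by (intro exI[of _ "1 - p"]) simp
    qed
  next
    case (union A)
    have A: "A n \<in> sets borel" for n
      using union(2) by (subst borel_eq_atMost) auto
    show ?case
    proof (intro allI impI)
      fix e :: real assume e: "0 < e"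
      \<comment> \<open>What the first \<open>N\<close> sets leave of the union; its mass tends to 0
        for each of the finitely many measures.\<close>
      define R where "R N = (\<Union>n. A n) - (\<Union>n<N. A n)" for N :: nat
      have R: "R N \<in> sets borel" for N
        unfolding R_def using A by auto
      have "(\<lambda>N. measure (M i) (R N)) \<longlonglongrightarrow> 0" if i: "i \<in> I" for i
      proof -
        interpret finite_measure "M i" by (rule fin[OF i])
        have A': "range A \<subseteq> sets (M i)" using A sets[OF i] by auto
        have "(\<lambda>N. measure (M i) (\<Union>n. A n) - (\<Sum>n<N. measure (M i) (A n))) \<longlonglongrightarrow> measure (M i) (\<Union>n. A n) - measure (M i) (\<Union>n. A n)"
          using finite_measure_UNION[OF A' union(1)] by (intro tendsto_intros) (simp add: sums_def)
        moreover have "measure (M i) (R N) = measure (M i) (\<Union>n. A n) - (\<Sum>n<N. measure (M i) (A n))" for N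
        proof -
          have "measure (M i) (\<Union>n<N. A n) = (\<Sum>n<N. measure (M i) (A n))"
            by (rule finite_measure_finite_Union)
              (use A' union(1) in \<open>auto intro: disjoint_family_on_mono\<close>)
          then show ?thesis
            unfolding R_def using A' by (subst finite_measure_Diff) auto
        qed
        ultimately show ?thesis by simp
      qed
      then have "\<forall>i\<in>I. eventually (\<lambda>N. measure (M i) (R N) < e / 4) sequentially"
        using e by (auto intro!: order_tendstoD(2)[where y = 0])
      then have "eventually (\<lambda>N. \<forall>i\<in>I. measure (M i) (R N) < e / 4) sequentially"
        by (rule eventually_ball_finite[OF I])
      then obtain N where N: "\<forall>i\<in>I. measure (M i) (R N) < e / 4"
        by (auto simp: eventually_sequentially)
      \<comment> \<open>Squaring a sum of \<open>N\<close> errors costs a factor \<open>N\<close>,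
        and adding \<open>N\<close> integrals another one; with this bound the product is at most
        \<open>e / 4\<close>.\<close>
      define \<delta> where "\<delta> = e / (4 * (real N + 1)\<^sup>2)"
      have \<delta>: "0 < \<delta>" using e by (simp add: \<delta>_def)
      then have "\<forall>n. \<exists>p. \<forall>i\<in>I. (LINT t|M i. (poly p t - indicator (A n) t)\<^sup>2) < \<delta>"
        using union(3) by blast
      then obtain p where p: "\<And>n. \<forall>i\<in>I. (LINT t|M i. (poly (p n) t - indicator (A n) t)\<^sup>2) < \<delta>"
        by metis
      define q where "q = (\<Sum>n<N. p n)"
      have ind: "(indicator (\<Union>n. A n) t :: real) = (\<Sum>n<N. indicator (A n) t) + indicator (R N) t" for t
      proof -
        have "(\<Sum>n<N. indicator (A n) t :: real) = indicator (\<Union>n<N. A n) t"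
          using union(1) by (subst indicator_UN_disjoint) (auto intro: disjoint_family_on_mono)
        then show ?thesis by (auto simp: R_def indicator_def)
      qed
      have "(LINT t|M i. (poly q t - indicator (\<Union>n. A n) t)\<^sup>2) < e" if i: "i \<in> I" for i
      proof -
        interpret finite_measure "M i" by (rule fin[OF i])
        have intR: "integrable (M i) (\<lambda>t. indicator (R N) t :: real)"
          using R sets[OF i] by (intro integrable_real_indicator) (auto simp: emeasure_finite less_top[symmetric])
        have intS: "integrable (M i) (\<lambda>t. 2 * (real N * (\<Sum>n<N. (poly (p n) t - indicator (A n) t)\<^sup>2)))"
          using integrable[OF i A] by auto
        have "(LINT t|M i. (poly q t - indicator (\<Union>n. A n) t)\<^sup>2) \<le>
          (LINT t|M i. 2 * (real N * (\<Sum>n<N. (poly (p n) t - indicator (A n) t)\<^sup>2)) + 2 * indicator (R N) t)"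
        proof (rule integral_mono)
          fix t
          have "poly q t - indicator (\<Union>n. A n) t = (\<Sum>n<N. poly (p n) t - indicator (A n) t) + - indicator (R N) t"
            by (simp add: ind q_def poly_sum sum_subtractf)
          then have "(poly q t - indicator (\<Union>n. A n) t)\<^sup>2 \<le>
              2 * (\<Sum>n<N. poly (p n) t - indicator (A n) t)\<^sup>2 + 2 * (- indicator (R N) t)\<^sup>2"
            by (simp only: square_sum_le)
          moreover have "(\<Sum>n<N. poly (p n) t - indicator (A n) t)\<^sup>2 \<le> real N * (\<Sum>n<N. (poly (p n) t - indicator (A n) t)\<^sup>2)"
            using sum_squared_le_sum_of_squares[where I = "{..<N}" and f = "\<lambda>n. poly (p n) t - indicator (A n) t"]
          by (simp add: mult.commute)
          moreover have "(- indicator (R N) t)\<^sup>2 = (indicator (R N) t :: real)"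
            by (simp add: indicator_def)
          ultimately show "(poly q t - indicator (\<Union>n. A n) t)\<^sup>2 \<le> 2 * (real N * (\<Sum>n<N. (poly (p n) t - indicator (A n) t)\<^sup>2)) + 2 * indicator (R N) t"
            by linarith
        qed (use intR intS integrable[OF i] A in auto)
        also have "\<dots> = 2 * (real N * (\<Sum>n<N. (LINT t|M i. (poly (p n) t - indicator (A n) t)\<^sup>2))) + 2 * measure (M i) (R N)"
          using intR intS integrable[OF i A] R sets[OF i] by (subst Bochner_Integration.integral_add) (auto simp: Bochner_Integration.integral_sum)
        also have "\<dots> < 2 * (real N * (\<Sum>n<N. \<delta>)) + 2 * (e / 4)"
          using p i N by (intro add_le_less_mono mult_left_mono sum_mono mult_strict_left_mono) (auto intro: less_imp_le)
        also have "\<dots> \<le> e"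
        proof -
          have "real N * real N \<le> (real N + 1)\<^sup>2" by (simp add: power2_eq_square algebra_simps)
          then have "\<delta> * (real N * real N) \<le> \<delta> * (real N + 1)\<^sup>2" using \<delta> by simp
          also have "\<dots> = e / 4" by (simp add: \<delta>_def)
          finally show ?thesis by (simp add: mult_ac)
        qed
        finally show ?thesis .
      qed
      then show "\<exists>p. \<forall>i\<in>I. (LINT t|M i. (poly p t - indicator (\<Union>n. A n) t)\<^sup>2) < e"
        by blast
    qed
  qed
  then show ?thesis using e by blast
qed


section \<open>The spectral measure of a positive contraction\<close>

text \<open>The inequality \<open>\<bar>f\<bar> \<le> d + f\<^sup>2 / d\<close> does the work of
  Cauchy-Schwarz: \<open>d\<close> is fixed small compared with the total mass, and the integral of
  the second summand tends to 0.\<close>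

lemma L2_limit_imp_L1_limit:
  fixes f :: "nat \<Rightarrow> real \<Rightarrow> real"
  assumes M: "finite_measure M" and f: "\<And>n. integrable M (\<lambda>t. (f n t)\<^sup>2)" "\<And>n. f n \<in> borel_measurable M"
    and lim: "(\<lambda>n. LINT t|M. (f n t)\<^sup>2) \<longlonglongrightarrow> 0"
  shows "(\<lambda>n. LINT t|M. \<bar>f n t\<bar>) \<longlonglongrightarrow> 0"
proof -
  interpret finite_measure M by fact
  have le: "\<bar>f n t\<bar> \<le> d + (f n t)\<^sup>2 / d" if "0 < d" for n t d
  proof (cases "\<bar>f n t\<bar> \<le> d")
    case False
    then have "\<bar>f n t\<bar> * d \<le> \<bar>f n t\<bar> * \<bar>f n t\<bar>"
      by (intro mult_left_mono) auto
    then have "\<bar>f n t\<bar> \<le> (f n t)\<^sup>2 / d"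
      using that by (simp add: pos_le_divide_eq power2_eq_square)
    then show ?thesis using that by linarith
  qed (use that in \<open>auto intro: add_increasing2\<close>)
  have int: "integrable M (\<lambda>t. \<bar>f n t\<bar>)" for n
  proof (rule Bochner_Integration.integrable_bound[where f = "\<lambda>t. 1 + (f n t)\<^sup>2"])
    show "AE t in M. norm \<bar>f n t\<bar> \<le> norm (1 + (f n t)\<^sup>2)"
      using le[of 1 n] by auto
  qed (use f in auto)
  show ?thesis
  proof (rule LIMSEQ_I)
    fix e :: real assume e: "0 < e"
    define d where "d = e / (2 * (measure M (space M) + 1))"
    have d: "0 < d" "d * measure M (space M) < e / 2"
      using e by (auto simp: d_def divide_simps add_nonneg_pos intro!: add_nonneg_pos)
    have "eventually (\<lambda>n. (LINT t|M. (f n t)\<^sup>2) < d * (e / 2)) sequentially"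
      using lim d e by (intro order_tendstoD(2)[where y = 0]) auto
    then obtain N where N: "\<And>n. N \<le> n \<Longrightarrow> (LINT t|M. (f n t)\<^sup>2) < d * (e / 2)"
      by (auto simp: eventually_sequentially)
    have "norm ((LINT t|M. \<bar>f n t\<bar>) - 0) < e" if "N \<le> n" for n
    proof -
      have "(LINT t|M. \<bar>f n t\<bar>) \<le> (LINT t|M. d + (f n t)\<^sup>2 / d)"
        by (rule integral_mono) (use int f le d in auto)
      also have "\<dots> = d * measure M (space M) + (LINT t|M. (f n t)\<^sup>2) / d"
        using f by (subst Bochner_Integration.integral_add) auto
      also have "\<dots> < e / 2 + e / 2"
        using d N[OF that] by (intro add_strict_mono) (auto simp: pos_divide_less_eq mult.commute)
      finally show ?thesis by simp
    qed
    then show "\<exists>no. \<forall>n\<ge>no. norm ((LINT t|M. \<bar>f n t\<bar>) - 0) < e" by blast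
  qed
qed

context positive_contraction
begin

text \<open>The functional \<open><p(T) u, u> / <u, u>\<close> meets the conditions of the moment
  problem, and the probability measure obtained is rescaled by \<open>inner u u\<close>. The zero
  vector cannot be normalised and gets the null measure.\<close>

lemma moment_measure_exists:
  "\<exists>M. finite_measure M \<and> sets M = sets borel \<and> (AE t in M. t \<in> {0..1}) \<and>
     (\<forall>p. (LINT t|M. poly p t) = inner (poly_op T p u) u)"
proof (cases "u = 0")
  case True
  have "poly_op T p 0 = 0" for p
    using poly_op_linear(2)[of p 0 0] by simp
  moreover have "AE t in null_measure borel. P t" for P :: "real \<Rightarrow> bool"
    by (rule AE_I[of _ _ UNIV]) auto
  ultimately show ?thesis
    using True by (intro exI[of _ "null_measure borel"]) (auto intro!: finite_measureI)
next
  case False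
  define c where "c = inner u u"
  have c: "0 < c"
    using False by (simp add: c_def)
  obtain N where N: "real_distribution N" "AE t in N. t \<in> {0..1}"
      and moment: "\<And>p. (LINT t|N. poly p t) = inner (poly_op T p u) u / c"
    using hausdorff_moment_problem[of "\<lambda>p. inner (poly_op T p u) u / c"] c poly_op_monomial_nonneg[of _ _ u]
    by (auto simp: inner_add_left add_divide_distrib c_def)
  interpret N: real_distribution N by fact
  have sets_N [measurable_cong]: "sets N = sets borel"
    by simp
  define M where "M = density N (\<lambda>_. ennreal c)"
  have "finite_measure M"
    by (rule finite_measureI)
      (simp add: M_def emeasure_density N.emeasure_space_1[simplified] ennreal_mult_eq_top_iff)
  moreover have "AE t in M. t \<in> {0..1}"
    unfolding M_def using N(2) by (subst AE_density) auto
  moreover have "(LINT t|M. poly p t) = inner (poly_op T p u) u" for p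
    unfolding M_def using c by (subst integral_density) (auto simp: moment)
  moreover have "sets M = sets borel"
    by (simp add: M_def)
  ultimately show ?thesis by blast
qed

definition moment_measure :: "'a \<Rightarrow> real measure" where
  "moment_measure u = (SOME M. finite_measure M \<and> sets M = sets borel \<and> (AE t in M. t \<in> {0..1}) \<and>
     (\<forall>p. (LINT t|M. poly p t) = inner (poly_op T p u) u))"

lemma
  shows finite_moment_measure: "finite_measure (moment_measure u)"
    and sets_moment_measure [measurable_cong]: "sets (moment_measure u) = sets borel"
    and AE_moment_measure: "AE t in moment_measure u. t \<in> {0..1}"
    and integral_moment_measure: "(LINT t|moment_measure u. poly p t) = inner (poly_op T p u) u"
  using someI_ex[OF moment_measure_exists[of u]] unfolding moment_measure_def[symmetric] by blast+

lemma integrable_moment_measure: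
  assumes "f \<in> borel_measurable borel" "\<And>t. \<bar>f t\<bar> \<le> 1"
  shows "integrable (moment_measure u) (\<lambda>t. (poly p t - f t)\<^sup>2)"
  using assms
  by (intro finite_measure_integrable_poly_diff_square finite_moment_measure sets_moment_measure AE_moment_measure)

lemma integrable_moment_measure_poly: "integrable (moment_measure u) (poly p)"
  using poly_bounded_unit[of p]
  by (auto intro!: finite_measure_integrable_unit finite_moment_measure sets_moment_measure AE_moment_measure)

text \<open>This is convergence in L2 of the moment measure. By \<open>norm_poly_op\<close> and
  \<open>integral_moment_measure\<close>, sending \<open>p\<close> to \<open>p(T) u\<close>
  preserves that norm, so approximation of functions becomes convergence of vectors.\<close>

definition approximates :: "(nat \<Rightarrow> real poly) \<Rightarrow> real set \<Rightarrow> 'a \<Rightarrow> bool" where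
  "approximates p B u \<longleftrightarrow> (\<lambda>n. LINT t|moment_measure u. (poly (p n) t - indicator B t)\<^sup>2) \<longlonglongrightarrow> 0"

text \<open>One sequence serves all vectors of \<open>U\<close>, so that additivity and symmetry
  pass from polynomials of \<open>T\<close> to the limits.\<close>

lemma approximates_exists:
  assumes "finite U" "B \<in> sets borel"
  obtains p where "\<And>u. u \<in> U \<Longrightarrow> approximates p B u"
proof -
  have "\<forall>n. \<exists>p. \<forall>u\<in>U. (LINT t|moment_measure u. (poly p t - indicator B t)\<^sup>2) < 1 / real (Suc n)"
    using assms
    by (auto intro!: polynomials_dense_L2 finite_moment_measure sets_moment_measure AE_moment_measure)
  then obtain p where p: "\<And>n u. u \<in> U \<Longrightarrow> (LINT t|moment_measure u. (poly (p n) t - indicator B t)\<^sup>2) < 1 / real (Suc n)"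
    by metis
  have "approximates p B u" if "u \<in> U" for u
    unfolding approximates_def
  proof (rule tendsto_sandwich[of "\<lambda>_. 0" _ _ "\<lambda>n. 1 / real (Suc n)"])
    show "(\<lambda>n. 1 / real (Suc n)) \<longlonglongrightarrow> 0"
      using LIMSEQ_inverse_real_of_nat by (simp add: inverse_eq_divide)
    show "eventually (\<lambda>n. (LINT t|moment_measure u. (poly (p n) t - indicator B t)\<^sup>2) \<le> 1 / real (Suc n)) sequentially"
      by (intro always_eventually allI less_imp_le p that)
  qed auto
  then show ?thesis by (rule that)
qed

lemma norm_poly_op_diff_le:
  assumes "B \<in> sets borel"
  shows "(norm (poly_op T p u - poly_op T q u))\<^sup>2 \<le>
    2 * (LINT t|moment_measure u. (poly p t - indicator B t)\<^sup>2) + 2 * (LINT t|moment_measure u. (poly q t - indicator B t)\<^sup>2)"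
proof -
  have int: "integrable (moment_measure u) (\<lambda>t. (poly r t - indicator B t)\<^sup>2)" for r
    using assms by (intro integrable_moment_measure) (auto simp: indicator_def)
  have "(norm (poly_op T p u - poly_op T q u))\<^sup>2 = (LINT t|moment_measure u. (poly p t - poly q t)\<^sup>2)"
    using norm_poly_op[of "p - q" u] integral_moment_measure[of u "(p - q) * (p - q)"]
    by (simp add: power2_eq_square)
  also have "\<dots> \<le> (LINT t|moment_measure u. 2 * (poly p t - indicator B t)\<^sup>2 + 2 * (poly q t - indicator B t)\<^sup>2)"
  proof (rule integral_mono)
    have "poly ((p - q) ^ 2) = (\<lambda>t. (poly p t - poly q t)\<^sup>2)"
      by (auto simp: fun_eq_iff)
    then show "integrable (moment_measure u) (\<lambda>t. (poly p t - poly q t)\<^sup>2)"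
      using integrable_moment_measure_poly[of u "(p - q) ^ 2"] by simp
    show "(poly p t - poly q t)\<^sup>2 \<le> 2 * (poly p t - indicator B t)\<^sup>2 + 2 * (poly q t - indicator B t)\<^sup>2" for t
      using square_sum_le[of "poly p t - indicator B t" "indicator B t - poly q t"]
      by (simp add: power2_commute[of "indicator B t"])
  qed (use int in auto)
  also have "\<dots> = 2 * (LINT t|moment_measure u. (poly p t - indicator B t)\<^sup>2) + 2 * (LINT t|moment_measure u. (poly q t - indicator B t)\<^sup>2)"
    using int by (subst Bochner_Integration.integral_add) auto
  finally show ?thesis .
qed

lemma approximates_convergent:
  assumes "approximates p B u" "B \<in> sets borel"
  shows "convergent (\<lambda>n. poly_op T (p n) u)"
proof (rule Cauchy_convergent, rule CauchyI)
  fix e :: real assume e: "0 < e"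
  then have "eventually (\<lambda>n. (LINT t|moment_measure u. (poly (p n) t - indicator B t)\<^sup>2) < e\<^sup>2 / 4) sequentially"
    using assms(1) unfolding approximates_def by (intro order_tendstoD(2)[where y = 0]) auto
  then obtain N where N: "\<And>n. N \<le> n \<Longrightarrow> (LINT t|moment_measure u. (poly (p n) t - indicator B t)\<^sup>2) < e\<^sup>2 / 4"
    by (auto simp: eventually_sequentially)
  have "norm (poly_op T (p m) u - poly_op T (p n) u) < e" if "N \<le> m" "N \<le> n" for m n
  proof -
    have "(norm (poly_op T (p m) u - poly_op T (p n) u))\<^sup>2 < e\<^sup>2"
      using norm_poly_op_diff_le[OF assms(2), of "p m" u "p n"] N[OF that(1)] N[OF that(2)] by linarith
    then show ?thesis using e by (auto dest: power2_less_imp_less)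
  qed
  then show "\<exists>M. \<forall>m\<ge>M. \<forall>n\<ge>M. norm (poly_op T (p m) u - poly_op T (p n) u) < e"
    by blast
qed

text \<open>By \<open>approximates_LIMSEQ\<close> every approximating sequence has the same limit,
  so for Borel sets the choice made here is immaterial.\<close>

definition E :: "real set \<Rightarrow> 'a \<Rightarrow> 'a" where
  "E B u = lim (\<lambda>n. poly_op T ((SOME p. approximates p B u) n) u)"

lemma approximates_LIMSEQ:
  assumes p: "approximates p B u" and B: "B \<in> sets borel"
  shows "(\<lambda>n. poly_op T (p n) u) \<longlonglongrightarrow> E B u"
proof -
  define q where "q = (SOME p. approximates p B u)"
  have q: "approximates q B u"
    unfolding q_def by (rule someI[of "\<lambda>p. approximates p B u", OF p])
  have qlim: "(\<lambda>n. poly_op T (q n) u) \<longlonglongrightarrow> E B u"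
    unfolding E_def q_def[symmetric] using approximates_convergent[OF q B] by (simp add: convergent_LIMSEQ_iff)
  have "(\<lambda>n. (norm (poly_op T (p n) u - poly_op T (q n) u))\<^sup>2) \<longlonglongrightarrow> 0"
  proof (rule tendsto_sandwich[of "\<lambda>_. 0"])
    show "(\<lambda>n. 2 * (LINT t|moment_measure u. (poly (p n) t - indicator B t)\<^sup>2) + 2 * (LINT t|moment_measure u. (poly (q n) t - indicator B t)\<^sup>2)) \<longlonglongrightarrow> 0"
      using tendsto_add[OF tendsto_mult_left[of _ 0 _ 2] tendsto_mult_left[of _ 0 _ 2]] p q
      unfolding approximates_def by fastforce
  qed (use norm_poly_op_diff_le[OF B] in \<open>auto intro!: always_eventually\<close>)
  then have "(\<lambda>n. poly_op T (p n) u - poly_op T (q n) u) \<longlonglongrightarrow> 0"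
    by (simp add: tendsto_norm_zero_iff)
  from tendsto_add[OF this qlim] show ?thesis by simp
qed

lemma E_add:
  assumes B: "B \<in> sets borel"
  shows "E B (u + v) = E B u + E B v"
proof -
  obtain p where p: "\<And>w. w \<in> {u, v, u + v} \<Longrightarrow> approximates p B w"
    using approximates_exists[of "{u, v, u + v}" B] B by auto
  have "(\<lambda>n. poly_op T (p n) (u + v)) \<longlonglongrightarrow> E B u + E B v"
    unfolding poly_op_linear using p B by (intro tendsto_add approximates_LIMSEQ) auto
  then show ?thesis
    using approximates_LIMSEQ[OF p B, of "u + v"] LIMSEQ_unique by blast
qed

lemma E_symmetric:
  assumes B: "B \<in> sets borel"
  shows "inner (E B u) v = inner u (E B v)"
proof -
  obtain p where p: "\<And>w. w \<in> {u, v} \<Longrightarrow> approximates p B w"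
    using approximates_exists[of "{u, v}" B] B by auto
  have "(\<lambda>n. inner (poly_op T (p n) u) v) \<longlonglongrightarrow> inner (E B u) v"
    using p B by (intro tendsto_inner tendsto_const approximates_LIMSEQ) auto
  moreover have "(\<lambda>n. inner u (poly_op T (p n) v)) \<longlonglongrightarrow> inner u (E B v)"
    using p B by (intro tendsto_inner tendsto_const approximates_LIMSEQ) auto
  ultimately show ?thesis
    unfolding poly_op_symmetric using LIMSEQ_unique by blast
qed

section \<open>Invariant subspaces and operators commuting with the projections\<close>

lemma poly_op_invariant:
  assumes "subspace V" "\<And>v. v \<in> V \<Longrightarrow> T v \<in> V" "u \<in> V"
  shows "poly_op T p u \<in> V"
  by (induction p) (auto simp: assms subspace_0 subspace_add subspace_scale)

lemma E_invariant:
  assumes "closed V" "subspace V" "\<And>v. v \<in> V \<Longrightarrow> T v \<in> V" "u \<in> V" "B \<in> sets borel"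
  shows "E B u \<in> V"
proof -
  obtain p where p: "approximates p B u"
    using approximates_exists[of "{u}" B] assms by auto
  show ?thesis
    by (rule closed_sequentially[OF assms(1) _ approximates_LIMSEQ[OF p assms(5)]])
      (rule poly_op_invariant[OF assms(2,3,4)])
qed

text \<open>An operator that commutes with \<open>T\<close> commutes with polynomials of
  \<open>T\<close> and, being bounded, with their limits. The conditions on \<open>X\<close> concern
  \<open>V\<close> alone, because \<open>X\<close> will also be a spectral projection obtained by
  choice, whose values elsewhere are unknown.\<close>

lemma E_commute:
  assumes V: "closed V" "subspace V" "\<And>v. v \<in> V \<Longrightarrow> T v \<in> V"
    and X: "\<And>v. v \<in> V \<Longrightarrow> X v \<in> V" "\<And>v w. v \<in> V \<Longrightarrow> w \<in> V \<Longrightarrow> X (v + w) = X v + X w"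
      "\<And>c v. v \<in> V \<Longrightarrow> X (c *\<^sub>R v) = c *\<^sub>R X v" "\<And>v. v \<in> V \<Longrightarrow> norm (X v) \<le> K * norm v"
      "\<And>v. v \<in> V \<Longrightarrow> X (T v) = T (X v)"
    and u: "u \<in> V" and B: "B \<in> sets borel"
  shows "X (E B u) = E B (X u)"
proof -
  obtain p where p: "\<And>w. w \<in> {u, X u} \<Longrightarrow> approximates p B w"
    using approximates_exists[of "{u, X u}" B] B by auto
  have X0: "X 0 = 0"
    using X(3)[of u 0] u by simp
  have pu: "poly_op T q u \<in> V" for q
    by (rule poly_op_invariant[OF V(2,3) u])
  have Eu: "E B u \<in> V"
    by (rule E_invariant[OF V u B])
  have X_poly: "X (poly_op T q u) = poly_op T q (X u)" for q
    by (induction q) (use X0 pu u V in \<open>auto simp: X subspace_scale\<close>)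
  have lim: "(\<lambda>n. K * norm (poly_op T (p n) u - E B u)) \<longlonglongrightarrow> 0"
    using approximates_LIMSEQ[OF p B, of u] by (auto intro!: tendsto_mult_right_zero tendsto_norm_zero simp: LIM_zero_iff)
  have le: "norm (poly_op T (p n) (X u) - X (E B u)) \<le> K * norm (poly_op T (p n) u - E B u)" for n
  proof -
    \<comment> \<open>\<open>X\<close> is known to be additive and homogeneous on \<open>V\<close>,
      so the difference is written with the scalar -1.\<close>
    have "X (poly_op T (p n) u + (-1) *\<^sub>R E B u) = X (poly_op T (p n) u) + X ((-1) *\<^sub>R E B u)"
      by (intro X pu subspace_scale V Eu)
    then have "poly_op T (p n) (X u) - X (E B u) = X (poly_op T (p n) u - E B u)"
      using X(3)[OF Eu, of "-1"] by (simp add: X_poly)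
    then show ?thesis
      using X(4)[of "poly_op T (p n) u - E B u"] subspace_diff[OF V(2) pu Eu] by simp
  qed
  have "(\<lambda>n. poly_op T (p n) (X u) - X (E B u)) \<longlonglongrightarrow> 0"
    by (rule Lim_null_comparison[OF always_eventually lim]) (rule allI, rule le)
  then have "(\<lambda>n. poly_op T (p n) (X u)) \<longlonglongrightarrow> X (E B u)"
    using LIM_zero_iff by blast
  then show ?thesis
    using approximates_LIMSEQ[OF p B, of "X u"] LIMSEQ_unique by blast
qed

lemma moment_measure_UNIV: "measure (moment_measure u) UNIV = inner u u"
  using integral_moment_measure[of u 1] sets_eq_imp_space_eq[OF sets_moment_measure, of u] by simp

text \<open>With \<open>a\<close> and \<open>b\<close> the errors of the two approximations, the
  product polynomial differs from the indicator of \<open>B \<inter> C\<close> by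
  \<open>a b + a 1_C + 1_B b\<close>. The first summand is dominated by squares, the others by
  absolute values, so L2 convergence of the errors suffices.\<close>

lemma approximates_integral:
  assumes p: "approximates p B u" and q: "approximates q C u" and B: "B \<in> sets borel" and C: "C \<in> sets borel"
  shows "(\<lambda>n. LINT t|moment_measure u. poly (p n * q n) t) \<longlonglongrightarrow> measure (moment_measure u) (B \<inter> C)"
proof -
  interpret finite_measure "moment_measure u" by (rule finite_moment_measure)
  let ?M = "moment_measure u"
  define a b where "a n t = poly (p n) t - indicator B t" and "b n t = poly (q n) t - indicator C t" for n t
  have meas: "a n \<in> borel_measurable ?M" "b n \<in> borel_measurable ?M" for n
    unfolding a_def b_def using B C by measurable
  have int2: "integrable ?M (\<lambda>t. (a n t)\<^sup>2)" "integrable ?M (\<lambda>t. (b n t)\<^sup>2)" for n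
    unfolding a_def b_def using B C by (auto intro!: integrable_moment_measure simp: indicator_def)
  have int1: "integrable ?M (\<lambda>t. \<bar>f t\<bar>)"
    if "integrable ?M (\<lambda>t. (f t)\<^sup>2)" "f \<in> borel_measurable ?M" for f :: "real \<Rightarrow> real"
  proof (rule Bochner_Integration.integrable_bound[where f = "\<lambda>t. 1 + (f t)\<^sup>2"])
    show "AE t in ?M. norm \<bar>f t\<bar> \<le> norm (1 + (f t)\<^sup>2)"
    proof (rule AE_I2)
      fix t
      have "0 \<le> (\<bar>f t\<bar> - 1)\<^sup>2" by simp
      then have "\<bar>f t\<bar> \<le> 1 + (f t)\<^sup>2"
        by (simp add: power2_diff)
      then show "norm \<bar>f t\<bar> \<le> norm (1 + (f t)\<^sup>2)" by simp
    qed
  qed (use that in auto)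
  have lim2: "(\<lambda>n. LINT t|?M. (a n t)\<^sup>2) \<longlonglongrightarrow> 0" "(\<lambda>n. LINT t|?M. (b n t)\<^sup>2) \<longlonglongrightarrow> 0"
    using p q unfolding approximates_def a_def b_def by auto
  have lim1: "(\<lambda>n. LINT t|?M. \<bar>a n t\<bar>) \<longlonglongrightarrow> 0" "(\<lambda>n. LINT t|?M. \<bar>b n t\<bar>) \<longlonglongrightarrow> 0"
    by (intro L2_limit_imp_L1_limit finite_moment_measure int2 meas lim2)+
  have bound: "\<bar>poly (p n * q n) t - indicator (B \<inter> C) t\<bar> \<le> (a n t)\<^sup>2 + (b n t)\<^sup>2 + \<bar>a n t\<bar> + \<bar>b n t\<bar>" for n t
  proof -
    have eq: "poly (p n * q n) t - indicator (B \<inter> C) t = a n t * b n t + a n t * indicator C t + indicator B t * b n t"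
      by (simp add: a_def b_def indicator_inter_arith algebra_simps)
    have ab: "\<bar>a n t * b n t\<bar> \<le> (a n t)\<^sup>2 + (b n t)\<^sup>2"
    proof -
      have "1 * \<bar>a n t * b n t\<bar> \<le> 2 * \<bar>a n t * b n t\<bar>"
        by (rule mult_right_mono) auto
      also have "\<dots> \<le> (a n t)\<^sup>2 + (b n t)\<^sup>2"
        using sum_squares_bound[of "\<bar>a n t\<bar>" "\<bar>b n t\<bar>"] by (simp add: mult.assoc abs_mult)
      finally show ?thesis by simp
    qed
    have "\<bar>a n t * indicator C t\<bar> \<le> \<bar>a n t\<bar>" "\<bar>indicator B t * b n t\<bar> \<le> \<bar>b n t\<bar>"
      by (auto simp: indicator_def)
    from add_mono[OF add_mono[OF ab this(1)] this(2)] show ?thesis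
      unfolding eq by (rule order_trans[OF order_trans[OF abs_triangle_ineq add_right_mono[OF abs_triangle_ineq]]])
  qed
  have BC: "integrable ?M (indicator (B \<inter> C) :: real \<Rightarrow> real)"
    using B C sets_moment_measure by (intro integrable_real_indicator) (auto simp: emeasure_finite less_top[symmetric])
  have le: "norm ((LINT t|?M. poly (p n * q n) t) - measure ?M (B \<inter> C)) \<le>
      (LINT t|?M. (a n t)\<^sup>2) + (LINT t|?M. (b n t)\<^sup>2) + (LINT t|?M. \<bar>a n t\<bar>) + (LINT t|?M. \<bar>b n t\<bar>)" for n
  proof -
    have eq: "(LINT t|?M. poly (p n * q n) t) - measure ?M (B \<inter> C) = (LINT t|?M. poly (p n * q n) t - indicator (B \<inter> C) t)"
    proof -
      have "(LINT t|?M. indicator (B \<inter> C) t) = measure ?M (B \<inter> C)"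
        by (simp add: sets_eq_imp_space_eq[OF sets_moment_measure])
      then show ?thesis
        by (simp only: Bochner_Integration.integral_diff[OF integrable_moment_measure_poly BC])
    qed
    have "norm ((LINT t|?M. poly (p n * q n) t) - measure ?M (B \<inter> C)) \<le> (LINT t|?M. (a n t)\<^sup>2 + (b n t)\<^sup>2 + \<bar>a n t\<bar> + \<bar>b n t\<bar>)"
    proof (subst eq, rule Bochner_Integration.integral_norm_bound_integral)
      show "integrable ?M (\<lambda>t. poly (p n * q n) t - indicator (B \<inter> C) t)"
        by (rule Bochner_Integration.integrable_diff[OF integrable_moment_measure_poly BC])
      show "integrable ?M (\<lambda>t. (a n t)\<^sup>2 + (b n t)\<^sup>2 + \<bar>a n t\<bar> + \<bar>b n t\<bar>)"
        by (rule Bochner_Integration.integrable_add[OF Bochner_Integration.integrable_add[OF Bochner_Integration.integrable_add]])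
          (rule int1 int2 meas)+
    qed (unfold real_norm_def, rule bound)
    also have "\<dots> = (LINT t|?M. (a n t)\<^sup>2) + (LINT t|?M. (b n t)\<^sup>2) + (LINT t|?M. \<bar>a n t\<bar>) + (LINT t|?M. \<bar>b n t\<bar>)"
      using int1 int2 meas by simp
    finally show ?thesis .
  qed
  have lim: "(\<lambda>n. (LINT t|?M. (a n t)\<^sup>2) + (LINT t|?M. (b n t)\<^sup>2) + (LINT t|?M. \<bar>a n t\<bar>) + (LINT t|?M. \<bar>b n t\<bar>)) \<longlonglongrightarrow> 0"
    using tendsto_add[OF tendsto_add[OF tendsto_add[OF lim2] lim1(1)] lim1(2)] by simp
  have "(\<lambda>n. (LINT t|?M. poly (p n * q n) t) - measure ?M (B \<inter> C)) \<longlonglongrightarrow> 0"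
    by (rule Lim_null_comparison[OF always_eventually lim]) (rule allI, rule le)
  then show ?thesis
    using LIM_zero_iff by blast
qed

lemma E_UNIV: "E UNIV u = u"
proof -
  have "approximates (\<lambda>_. 1) UNIV u"
    by (simp add: approximates_def)
  from approximates_LIMSEQ[OF this] show ?thesis
    by (simp add: LIMSEQ_const_iff)
qed

text \<open>By symmetry the left side is the limit of \<open><q(T) u, p(T) u>\<close>, the integral
  of a product of polynomials.\<close>

lemma E_E_quadratic:
  assumes B: "B \<in> sets borel" and C: "C \<in> sets borel"
  shows "inner (E B (E C u)) u = measure (moment_measure u) (B \<inter> C)"
proof -
  obtain p where p: "approximates p B u"
    using approximates_exists[of "{u}" B] B by auto
  obtain q where q: "approximates q C u"
    using approximates_exists[of "{u}" C] C by auto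
  have "(\<lambda>n. inner (poly_op T (q n) u) (poly_op T (p n) u)) \<longlonglongrightarrow> inner (E C u) (E B u)"
    using p q B C by (intro tendsto_inner approximates_LIMSEQ)
  moreover have "inner (poly_op T (q n) u) (poly_op T (p n) u) = (LINT t|moment_measure u. poly (p n * q n) t)" for n
    by (simp only: integral_moment_measure poly_op_mult poly_op_symmetric)
  ultimately show ?thesis
    using approximates_integral[OF p q B C] LIMSEQ_unique E_symmetric[OF B] by auto
qed

lemma E_quadratic: "B \<in> sets borel \<Longrightarrow> inner (E B u) u = measure (moment_measure u) B"
  using E_E_quadratic[of B UNIV u] by (simp add: E_UNIV)

lemma norm_E_le:
  assumes "B \<in> sets borel"
  shows "norm (E B u) \<le> norm u"
proof -
  interpret finite_measure "moment_measure u" by (rule finite_moment_measure)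
  have "(norm (E B u))\<^sup>2 = measure (moment_measure u) B"
    using E_E_quadratic[OF assms assms, of u] E_symmetric[OF assms] by (simp add: power2_norm_eq_inner)
  also have "\<dots> \<le> measure (moment_measure u) UNIV"
    by (rule finite_measure_mono) (auto simp: sets_moment_measure)
  also have "\<dots> = (norm u)\<^sup>2"
    by (simp add: moment_measure_UNIV power2_norm_eq_inner)
  finally show ?thesis by (simp add: power2_le_iff_abs_le)
qed

text \<open>Scalars, \<open>T\<close> and the projections themselves are bounded and commute with
  \<open>T\<close>: this lemma and the next two are instances of \<open>E_commute\<close> on the
  whole space.\<close>

lemma E_scaleR:
  assumes "B \<in> sets borel"
  shows "E B (c *\<^sub>R u) = c *\<^sub>R E B u"
  using E_commute[of UNIV "\<lambda>v. c *\<^sub>R v" "\<bar>c\<bar>" u B] assms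
  by (simp add: scaleR_add_right mult.commute)

lemma E_T: "B \<in> sets borel \<Longrightarrow> T (E B u) = E B (T u)"
  using E_commute[of UNIV T "onorm T" u B] onorm[OF bounded_linear] by simp

lemma E_E_commute: "B \<in> sets borel \<Longrightarrow> C \<in> sets borel \<Longrightarrow> E B (E C u) = E C (E B u)"
  using E_commute[of UNIV "E B" 1 u C] by (simp add: E_add E_scaleR norm_E_le E_T[symmetric])

text \<open>Both sides have the same quadratic form, and a symmetric operator with zero form
  vanishes. The commutation of \<open>E B\<close> and \<open>E C\<close> makes their product
  symmetric.\<close>

lemma E_Int:
  assumes B: "B \<in> sets borel" and C: "C \<in> sets borel"
  shows "E (B \<inter> C) u = E B (E C u)"
proof -
  define S where "S u = E B (E C u) - E (B \<inter> C) u" for u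
  have BC: "B \<inter> C \<in> sets borel" using B C by auto
  have S_add: "S (u + v) = S u + S v" for u v
    by (simp add: S_def E_add B C BC)
  have S_zero: "inner (S u) u = 0" for u
    by (simp add: S_def inner_diff_left E_E_quadratic E_quadratic B C BC)
  have S_symmetric: "inner (S u) v = inner u (S v)" for u v
    using E_E_commute[OF B C] by (simp add: S_def inner_diff_left inner_diff_right E_symmetric B C BC)
  have "inner (S u) v = 0" for u v
    using S_zero[of "u + v"] S_zero[of u] S_zero[of v] S_symmetric[of v u]
    by (simp add: S_add inner_add_left inner_add_right inner_commute)
  from this[of u "S u"] show ?thesis
    by (simp add: S_def)
qed

end


section \<open>Uniqueness of spectral measures and inverse operators\<close>

text \<open>The real counterpart of \<open>scalar_spectral_measure\<close>, for projections of an
  abstract inner product space.\<close>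

definition form_measure :: "(real set \<Rightarrow> 'a::real_inner \<Rightarrow> 'a) \<Rightarrow> 'a \<Rightarrow> real measure" where
  "form_measure E u = measure_of UNIV (sets borel) (\<lambda>B. ennreal (inner (E B u) u))"

text \<open>Expanding the form at \<open>u + v\<close> leaves twice \<open><S u, v>\<close>, because
  \<open>S\<close> is symmetric. The expansion rests on additivity of \<open>S\<close> inside inner
  products with vectors of \<open>V\<close>, which symmetry supplies as well.\<close>

lemma symmetric_zero_form:
  assumes V: "subspace V"
    and S: "\<And>u. u \<in> V \<Longrightarrow> S u \<in> V"
      "\<And>u v. u \<in> V \<Longrightarrow> v \<in> V \<Longrightarrow> inner (S u) v = inner u (S v)"
      "\<And>u. u \<in> V \<Longrightarrow> inner (S u) u = 0"
    and u: "u \<in> V"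
  shows "S u = 0"
proof -
  have add: "inner (S (x + y)) v = inner (S x) v + inner (S y) v" if "x \<in> V" "y \<in> V" "v \<in> V" for x y v
    using that by (simp add: S(2) subspace_add[OF V] inner_add_left)
  have "inner (S u) v = 0" if v: "v \<in> V" for v
  proof -
    have "inner (S u) v = inner (S v) u"
      using S(2)[OF u v] by (simp add: inner_commute)
    moreover have "inner (S (u + v)) (u + v) = 0"
      using S(3) subspace_add[OF V u v] .
    ultimately show ?thesis
      using u v S(3)[OF u] S(3)[OF v] subspace_add[OF V u v] by (simp add: add inner_add_right)
  qed
  from this[OF S(1)[OF u]] show ?thesis by simp
qed

text \<open>Spectral measures seen through real quadratic forms on a subspace \<open>V\<close>:
  projections picked by choice are constrained only there. Linearity, the norm bound for the
  projections and their commutation with \<open>T\<close> are derived below.\<close>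

locale spectral_resolution =
  fixes V :: "'a::real_inner set" and T :: "'a \<Rightarrow> 'a" and E :: "real set \<Rightarrow> 'a \<Rightarrow> 'a"
  assumes subspace: "subspace V"
    and T_closed: "u \<in> V \<Longrightarrow> T u \<in> V"
    and T_symmetric: "u \<in> V \<Longrightarrow> v \<in> V \<Longrightarrow> inner (T u) v = inner u (T v)"
    and E_closed: "B \<in> sets borel \<Longrightarrow> u \<in> V \<Longrightarrow> E B u \<in> V"
    and E_symmetric: "B \<in> sets borel \<Longrightarrow> u \<in> V \<Longrightarrow> v \<in> V \<Longrightarrow> inner (E B u) v = inner u (E B v)"
    and E_UNIV: "u \<in> V \<Longrightarrow> E UNIV u = u"
    and E_Int: "B \<in> sets borel \<Longrightarrow> C \<in> sets borel \<Longrightarrow> u \<in> V \<Longrightarrow> E (B \<inter> C) u = E B (E C u)"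
    and E_sums: "range D \<subseteq> sets borel \<Longrightarrow> disjoint_family D \<Longrightarrow> u \<in> V \<Longrightarrow>
      (\<lambda>n::nat. inner (E (D n) u) u) sums inner (E (\<Union>n. D n) u) u"
    and T_integrable: "u \<in> V \<Longrightarrow> integrable (form_measure E u) (\<lambda>t. t)"
    and T_integral: "u \<in> V \<Longrightarrow> inner (T u) u = (LINT t|form_measure E u. t)"
begin

text \<open>Linearity is forced by symmetry: the defect lies in \<open>V\<close> and is orthogonal
  to \<open>V\<close>. The same argument serves \<open>E_add\<close>, \<open>T_scaleR\<close> and
  \<open>E_scaleR\<close>.\<close>

lemma T_add: "u \<in> V \<Longrightarrow> v \<in> V \<Longrightarrow> T (u + v) = T u + T v"
proof -
  assume u: "u \<in> V" and v: "v \<in> V"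
  have "inner (T (u + v) - (T u + T v)) w = 0" if "w \<in> V" for w
    using u v that subspace_add[OF subspace u v]
    by (simp add: inner_diff_left inner_add_left T_symmetric)
  from this[of "T (u + v) - (T u + T v)"] show ?thesis
    using u v by (simp add: T_closed subspace_add[OF subspace] subspace_diff[OF subspace])
qed

lemma E_add: "B \<in> sets borel \<Longrightarrow> u \<in> V \<Longrightarrow> v \<in> V \<Longrightarrow> E B (u + v) = E B u + E B v"
proof -
  assume B: "B \<in> sets borel" and u: "u \<in> V" and v: "v \<in> V"
  have "inner (E B (u + v) - (E B u + E B v)) w = 0" if "w \<in> V" for w
    using B u v that subspace_add[OF subspace u v]
    by (simp add: inner_diff_left inner_add_left E_symmetric)
  from this[of "E B (u + v) - (E B u + E B v)"] show ?thesis
    using B u v by (simp add: E_closed subspace_add[OF subspace] subspace_diff[OF subspace])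
qed

lemma T_scaleR: "u \<in> V \<Longrightarrow> T (c *\<^sub>R u) = c *\<^sub>R T u"
proof -
  assume u: "u \<in> V"
  have "inner (T (c *\<^sub>R u) - c *\<^sub>R T u) w = 0" if "w \<in> V" for w
    using u that subspace_scale[OF subspace u]
    by (simp add: inner_diff_left T_symmetric)
  from this[of "T (c *\<^sub>R u) - c *\<^sub>R T u"] show ?thesis
    using u by (simp add: T_closed subspace_scale[OF subspace] subspace_diff[OF subspace])
qed

lemma E_idem: "B \<in> sets borel \<Longrightarrow> u \<in> V \<Longrightarrow> E B (E B u) = E B u"
  using E_Int[of B B u] by simp

lemma E_norm: "B \<in> sets borel \<Longrightarrow> u \<in> V \<Longrightarrow> inner (E B u) u = inner (E B u) (E B u)"
  using E_symmetric[of B "E B u" u] by (simp add: E_closed E_idem)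

lemma E_norm_le:
  assumes B: "B \<in> sets borel" and u: "u \<in> V"
  shows "norm (E B u) \<le> norm u"
proof -
  have "norm (E B u) * norm (E B u) \<le> norm (E B u) * norm u"
    using E_norm[OF assms] norm_cauchy_schwarz[of "E B u" u]
    by (simp add: power2_norm_eq_inner[symmetric] power2_eq_square)
  then show ?thesis
    by (cases "E B u = 0") auto
qed

lemma E_scaleR: "B \<in> sets borel \<Longrightarrow> u \<in> V \<Longrightarrow> E B (c *\<^sub>R u) = c *\<^sub>R E B u"
proof -
  assume B: "B \<in> sets borel" and u: "u \<in> V"
  have "inner (E B (c *\<^sub>R u) - c *\<^sub>R E B u) w = 0" if "w \<in> V" for w
    using B u that subspace_scale[OF subspace u]
    by (simp add: inner_diff_left E_symmetric)
  from this[of "E B (c *\<^sub>R u) - c *\<^sub>R E B u"] show ?thesis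
    using B u by (simp add: E_closed subspace_scale[OF subspace] subspace_diff[OF subspace])
qed

lemma E_eq_0_iff: "B \<in> sets borel \<Longrightarrow> u \<in> V \<Longrightarrow> E B u = 0 \<longleftrightarrow> inner (E B u) u = 0"
  by (simp add: E_norm)

text \<open>The empty set is a disjoint union of copies of itself, and a constant series converges
  only if its terms vanish.\<close>

lemma E_empty: "u \<in> V \<Longrightarrow> E {} u = 0"
proof -
  assume u: "u \<in> V"
  have "(\<lambda>n::nat. inner (E {} u) u) sums inner (E (\<Union>n::nat. {}) u) u"
    by (rule E_sums) (auto simp: u disjoint_family_on_def)
  then have "summable (\<lambda>n::nat. inner (E {} u) u)"
    by (rule sums_summable)
  then show ?thesis
    using u by (simp add: E_eq_0_iff summable_const_iff)
qed

section \<open>The scalar measures of a resolution\<close>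

lemma sets_form_measure [simp, measurable_cong]: "sets (form_measure E u) = sets borel"
  unfolding form_measure_def using sets.sigma_sets_eq[of "borel :: real measure"] by simp

lemma space_form_measure [simp]: "space (form_measure E u) = UNIV"
  unfolding form_measure_def by (simp add: space_measure_of_conv)

lemma emeasure_form_measure:
  assumes u: "u \<in> V" and B: "B \<in> sets borel"
  shows "emeasure (form_measure E u) B = ennreal (inner (E B u) u)"
proof (rule emeasure_measure_of[OF form_measure_def])
  show "countably_additive (sets (form_measure E u)) (\<lambda>B. ennreal (inner (E B u) u))"
  proof (rule countably_additiveI)
    fix D :: "nat \<Rightarrow> real set"
    assume D: "range D \<subseteq> sets (form_measure E u)" "disjoint_family D"
    then have "D n \<in> sets borel" for n by auto
    then have "0 \<le> inner (E (D n) u) u" for n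
      by (simp add: E_norm u)
    then show "suminf (\<lambda>i. ennreal (inner (E (D i) u) u)) = ennreal (inner (E (\<Union>i. D i) u) u)"
      using D u by (intro suminf_ennreal_eq E_sums) auto
  qed
  show "positive (sets (form_measure E u)) (\<lambda>B. ennreal (inner (E B u) u))"
    by (simp add: positive_def E_empty u)
qed (use B in auto)

lemma finite_form_measure: "u \<in> V \<Longrightarrow> finite_measure (form_measure E u)"
  by (rule finite_measureI) (simp add: emeasure_form_measure)

lemma measure_form_measure:
  "u \<in> V \<Longrightarrow> B \<in> sets borel \<Longrightarrow> measure (form_measure E u) B = inner (E B u) u"
  by (simp add: Sigma_Algebra.measure_def emeasure_form_measure E_norm)

lemma finite_borel_form_measure: "u \<in> V \<Longrightarrow> finite_borel_measure (form_measure E u)"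
  using finite_form_measure by (simp add: finite_borel_measure_def finite_borel_measure_axioms_def)

text \<open>Additivity is given for diagonal terms, so the measures yield equality of quadratic
  forms, and \<open>symmetric_zero_form\<close> lifts it to the operators.\<close>

lemma E_compl:
  assumes B: "B \<in> sets borel" and u: "u \<in> V"
  shows "E (- B) u = u - E B u"
proof -
  have B': "- B \<in> sets borel"
    using B by (metis borel_comp)
  define S where "S v = E (- B) v - (v - E B v)" for v
  have "S u = 0"
  proof (rule symmetric_zero_form[OF subspace _ _ _ u])
    show "S v \<in> V" if "v \<in> V" for v
      unfolding S_def using that B B' by (intro subspace_diff[OF subspace] E_closed)
    show "inner (S v) w = inner v (S w)" if "v \<in> V" "w \<in> V" for v w
      unfolding S_def using that B B' by (simp add: inner_diff_left inner_diff_right E_symmetric)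
    show "inner (S v) v = 0" if v: "v \<in> V" for v
    proof -
      interpret finite_measure "form_measure E v" by (rule finite_form_measure[OF v])
      have "measure (form_measure E v) (UNIV - B) = measure (form_measure E v) UNIV - measure (form_measure E v) B"
        using finite_measure_compl[of B] B by simp
      then show ?thesis
        using v B B' by (simp add: S_def inner_diff_left measure_form_measure E_UNIV Compl_eq_Diff_UNIV)
    qed
  qed
  then show ?thesis by (simp add: S_def)
qed

text \<open>Compressing \<open>E B\<close> by \<open>E C\<close> gives
  \<open>E (C \<inter> B)\<close>, so passing from \<open>u\<close> to \<open>E C u\<close>
  restricts the measure to \<open>C\<close>.\<close>

lemma form_measure_E:
  assumes u: "u \<in> V" and C: "C \<in> sets borel"
  shows "form_measure E (E C u) = density (form_measure E u) (indicator C)"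
proof (rule measure_eqI)
  fix B assume "B \<in> sets (form_measure E (E C u))"
  then have B: "B \<in> sets borel" by simp
  have "inner (E B (E C u)) (E C u) = inner (E (C \<inter> (B \<inter> C)) u) u"
    using u B C by (simp add: E_Int E_symmetric E_closed)
  moreover have "C \<inter> (B \<inter> C) = C \<inter> B" by auto
  ultimately have "inner (E B (E C u)) (E C u) = inner (E (C \<inter> B) u) u" by simp
  moreover have "emeasure (density (form_measure E u) (indicator C)) B = emeasure (form_measure E u) (C \<inter> B)"
    using B C by (subst emeasure_density) (auto simp: indicator_inter_arith[symmetric] intro!: borel_measurable_indicator)
  ultimately show "emeasure (form_measure E (E C u)) B = emeasure (density (form_measure E u) (indicator C)) B"
    using u B C by (simp add: emeasure_form_measure E_closed)
qed simp

lemma T_E_integral: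
  assumes u: "u \<in> V" and C: "C \<in> sets borel"
  shows "inner (T (E C u)) (E C u) = (LINT t|form_measure E u. indicator C t * t)"
proof -
  have "density (form_measure E u) (indicator C) = density (form_measure E u) (\<lambda>t. ennreal (indicator C t))"
    by (intro arg_cong[of _ _ "density _"]) (auto simp: fun_eq_iff indicator_def)
  then show ?thesis
    using u C by (simp add: T_integral E_closed form_measure_E integral_density)
qed

lemma integrable_indicator_T:
  assumes "u \<in> V" "C \<in> sets borel"
  shows "integrable (form_measure E u) (\<lambda>t. indicator C t * t)"
  using integrable_mult_indicator[of C, OF _ T_integrable[OF assms(1)]] assms by simp

lemma T_lower_bound:
  assumes u: "u \<in> V" and C: "C \<in> sets borel" "C \<subseteq> {b..}" and eq: "E C u = u"
  shows "b * inner u u \<le> inner (T u) u"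
proof -
  interpret finite_measure "form_measure E u" by (rule finite_form_measure[OF u])
  have int: "integrable (form_measure E u) (indicator C :: real \<Rightarrow> real)"
    using C by (intro integrable_real_indicator) (auto simp: emeasure_finite less_top[symmetric])
  have "b * inner u u = b * measure (form_measure E u) C"
    using u C eq by (simp add: measure_form_measure)
  also have "\<dots> = (LINT t|form_measure E u. b * indicator C t)"
    using C by simp
  also have "\<dots> \<le> (LINT t|form_measure E u. indicator C t * t)"
    by (rule integral_mono[OF Bochner_Integration.integrable_mult_right[OF int] integrable_indicator_T[OF u C(1)]])
      (use C(2) in \<open>auto simp: indicator_def\<close>)
  also have "\<dots> = inner (T u) u"
    using T_E_integral[OF u C(1)] eq by simp
  finally show ?thesis .
qed

lemma T_upper_bound:
  assumes u: "u \<in> V" and C: "C \<in> sets borel" "C \<subseteq> {..b}" and eq: "E C u = u"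
  shows "inner (T u) u \<le> b * inner u u"
proof -
  interpret finite_measure "form_measure E u" by (rule finite_form_measure[OF u])
  have int: "integrable (form_measure E u) (indicator C :: real \<Rightarrow> real)"
    using C by (intro integrable_real_indicator) (auto simp: emeasure_finite less_top[symmetric])
  have "inner (T u) u = (LINT t|form_measure E u. indicator C t * t)"
    using T_E_integral[OF u C(1)] eq by simp
  also have "\<dots> \<le> (LINT t|form_measure E u. b * indicator C t)"
    by (rule integral_mono[OF integrable_indicator_T[OF u C(1)] Bochner_Integration.integrable_mult_right[OF int]])
      (use C(2) in \<open>auto simp: indicator_def\<close>)
  also have "\<dots> = b * measure (form_measure E u) C"
    using C by simp
  also have "\<dots> = b * inner u u"
    using u C eq by (simp add: measure_form_measure)
  finally show ?thesis .
qed

text \<open>Only the diagonal form of \<open>T\<close> is known to be an integral. At the sum of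
  \<open>x = E C u\<close> and \<open>y = E (- C) v\<close> this integral splits over
  \<open>C\<close> and \<open>- C\<close> into the forms at \<open>x\<close> and at
  \<open>y\<close>; hence the cross terms vanish.\<close>

lemma T_orthogonal:
  assumes u: "u \<in> V" and v: "v \<in> V" and C: "C \<in> sets borel"
  shows "inner (T (E C u)) (E (- C) v) = 0"
proof -
  have C': "- C \<in> sets borel"
    using C by (metis borel_comp)
  define x where "x = E C u"
  define y where "y = E (- C) v"
  have x: "x \<in> V" and y: "y \<in> V"
    by (simp_all add: x_def y_def u v C C' E_closed)
  have z: "x + y \<in> V"
    using subspace_add[OF subspace x y] .
  have "E C y = 0" "E (- C) x = 0"
    unfolding x_def y_def using u v C C' E_Int[of C "- C" v] E_Int[of "- C" C u] by (simp_all add: E_empty)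
  then have Ez: "E C (x + y) = x" "E (- C) (x + y) = y"
    using x y C C' u v by (simp_all add: E_add) (simp_all add: x_def y_def E_idem)
  have "inner (T (x + y)) (x + y) = (LINT t|form_measure E (x + y). indicator C t * t + indicator (- C) t * t)"
    unfolding T_integral[OF z] by (rule Bochner_Integration.integral_cong) (auto simp: indicator_def)
  also have "\<dots> = inner (T x) x + inner (T y) y"
    using T_E_integral[OF z C] T_E_integral[OF z C'] integrable_indicator_T[OF z] C C'
    by (subst Bochner_Integration.integral_add) (auto simp: Ez)
  finally have "inner (T x) y + inner (T y) x = 0"
    using x y by (simp add: T_add inner_add_left inner_add_right)
  then show ?thesis
    using T_symmetric[OF x y] by (simp add: inner_commute x_def y_def)
qed

lemma E_T_E:
  assumes u: "u \<in> V" and C: "C \<in> sets borel"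
  shows "E (- C) (T (E C u)) = 0"
proof -
  have C': "- C \<in> sets borel"
    using C by (metis borel_comp)
  have "inner (E (- C) (T (E C u))) v = 0" if "v \<in> V" for v
    using T_orthogonal[OF u that C] that u C C' by (simp add: E_symmetric E_closed T_closed)
  from this[of "E (- C) (T (E C u))"] show ?thesis
    using u C C' by (simp add: E_closed T_closed)
qed

text \<open>By orthogonality \<open>T\<close> maps the ranges of \<open>E C\<close> and
  \<open>E (- C)\<close> into themselves; \<open>u\<close> is split along these ranges.\<close>

lemma T_E_commute:
  assumes u: "u \<in> V" and C: "C \<in> sets borel"
  shows "T (E C u) = E C (T u)"
proof -
  have C': "- C \<in> sets borel"
    using C by (metis borel_comp)
  have "T (E C u) = E C (T (E C u))"
    using E_T_E[OF u C] u C by (simp add: E_compl E_closed T_closed)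
  moreover have "E C (T (E (- C) u)) = 0"
    using E_T_E[OF u C'] by simp
  moreover have "u = E C u + E (- C) u"
    using u C by (simp add: E_compl)
  then have "E C (T u) = E C (T (E C u)) + E C (T (E (- C) u))"
    using u C C' by (metis E_add E_closed T_add T_closed)
  ultimately show ?thesis by simp
qed

text \<open>A set with \<open>E C u = 0\<close> is a null set for the measure of \<open>u\<close>,
  and countable unions of null sets are null.\<close>

lemma E_UN_eq_0:
  assumes u: "u \<in> V" and C: "\<And>n::nat. C n \<in> sets borel" "\<And>n. E (C n) u = 0"
  shows "E (\<Union>n. C n) u = 0"
proof -
  have "(\<Union>n. C n) \<in> null_sets (form_measure E u)"
    using u C by (intro null_sets_UN) (auto simp: null_sets_def emeasure_form_measure)
  then have "ennreal (inner (E (\<Union>n. C n) u) u) = 0"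
    using u C by (subst emeasure_form_measure[symmetric]) auto
  then show ?thesis
    using u C by (subst E_eq_0_iff) (auto simp: E_norm)
qed

end

text \<open>The estimates for pairs of closed half-lines need a strict inequality between the
  endpoints; this union and its mirror image carry them over to open half-lines with the help of
  \<open>E_UN_eq_0\<close>.\<close>

lemma greaterThan_eq_UN: "{a<..} = (\<Union>n::nat. {a + 1 / real (Suc n)..})"
proof -
  have 1: "\<exists>n::nat. a + 1 / real (Suc n) \<le> t" if at: "a < t" for t
  proof -
    obtain n where "inverse (real (Suc n)) < t - a"
      using reals_Archimedean[of "t - a"] at by auto
    then show ?thesis
      by (intro exI[of _ n]) (simp add: inverse_eq_divide algebra_simps)
  qed
  have 2: "a < t" if "a + 1 / real (Suc n) \<le> t" for t n
    using that by (rule less_le_trans[rotated]) simp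
  show ?thesis
    using 1 2 by (auto simp del: of_nat_Suc)
qed

lemma lessThan_eq_UN: "{..<a::real} = (\<Union>n::nat. {..a - 1 / real (Suc n)})"
proof -
  have 1: "\<exists>n::nat. t \<le> a - 1 / real (Suc n)" if ta: "t < a" for t
  proof -
    obtain n where "inverse (real (Suc n)) < a - t"
      using reals_Archimedean[of "a - t"] ta by auto
    then show ?thesis
      by (intro exI[of _ n]) (simp add: inverse_eq_divide algebra_simps)
  qed
  have 2: "t < a" if "t \<le> a - 1 / real (Suc n)" for t n
    using that by (rule le_less_trans) simp
  show ?thesis
    using 1 2 by (auto simp del: of_nat_Suc)
qed

text \<open>Used with \<open>S = T\<close> for uniqueness and with \<open>S\<close> inverse to
  \<open>T\<close> for the determinant.\<close>

locale commuting_resolutions =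
  R: spectral_resolution V T E + R': spectral_resolution V S F
  for V :: "'a::real_inner set" and T S :: "'a \<Rightarrow> 'a" and E F :: "real set \<Rightarrow> 'a \<Rightarrow> 'a" +
  assumes commute: "B \<in> sets borel \<Longrightarrow> C \<in> sets borel \<Longrightarrow> u \<in> V \<Longrightarrow> E B (F C u) = F C (E B u)"
begin

text \<open>The product of commuting projections projects onto the intersection of their ranges, so
  \<open>E B (F C u)\<close> is a test vector to which the bounds for both operators apply.\<close>

lemma joint_range:
  assumes u: "u \<in> V" and B: "B \<in> sets borel" and C: "C \<in> sets borel"
  shows "E B (F C u) \<in> V" "E B (E B (F C u)) = E B (F C u)" "F C (E B (F C u)) = E B (F C u)"
  using assms by (auto simp: R.E_closed R'.E_closed R.E_idem) (simp add: commute[symmetric] R'.E_closed R'.E_idem)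

end

lemma spectral_resolution_unique_aux:
  assumes "commuting_resolutions V T T E F" and u: "u \<in> V"
  shows "F {..a} (E {..a} u) = E {..a} u"
proof -
  interpret commuting_resolutions V T T E F by fact
  have v: "E {..a} u \<in> V"
    using u by (simp add: R.E_closed)
  have zero: "F {b..} (E {..a} u) = 0" if "a < b" for b
  proof -
    define w where "w = E {..a} (F {b..} u)"
    have w: "w \<in> V" "E {..a} w = w" "F {b..} w = w"
      using joint_range[OF u, of "{..a}" "{b..}"] by (auto simp: w_def)
    have "b * inner w w \<le> a * inner w w"
      using R'.T_lower_bound[OF w(1) _ _ w(3), of b] R.T_upper_bound[OF w(1) _ _ w(2), of a] by auto
    then have "(b - a) * inner w w \<le> 0"
      by (simp add: left_diff_distrib)
    then have "w = 0"
      using that inner_ge_zero[of w] by (auto simp: mult_le_0_iff)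
    then show ?thesis
      using commute[of "{..a}" "{b..}" u] u by (simp add: w_def)
  qed
  have "F {a<..} (E {..a} u) = 0"
    unfolding greaterThan_eq_UN by (rule R'.E_UN_eq_0[OF v]) (auto intro!: zero simp del: of_nat_Suc)
  moreover have "- {..a} = {a<..}" by auto
  ultimately show ?thesis
    using R'.E_compl[of "{..a}", OF _ v] by simp
qed

text \<open>Equality on the half-lines \<open>{..a}\<close> is equality of distribution functions,
  hence of all scalar measures, hence of the symmetric operators.\<close>

lemma spectral_resolution_unique:
  assumes "commuting_resolutions V T T E F" and u: "u \<in> V" and B: "B \<in> sets borel"
  shows "E B u = F B u"
proof -
  interpret commuting_resolutions V T T E F by fact
  have comm': "commuting_resolutions V T T F E"
    by unfold_locales (simp add: commute)
  \<comment> \<open>Each of the two projections fixes the range of the other; as they commute, they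
    coincide.\<close>
  have atMost: "E {..a} v = F {..a} v" if "v \<in> V" for v a
    using spectral_resolution_unique_aux[OF assms(1) that, of a] spectral_resolution_unique_aux[OF comm' that, of a]
      commute[of "{..a}" "{..a}" v] that by simp
  have meas: "form_measure E v = form_measure F v" if v: "v \<in> V" for v
    using v by (intro cdf_unique' R.finite_borel_form_measure R'.finite_borel_form_measure)
      (auto simp: fun_eq_iff cdf_def R.measure_form_measure R'.measure_form_measure atMost)
  have "E B u - F B u = 0"
  proof (rule symmetric_zero_form[OF R.subspace _ _ _ u])
    show "E B v - F B v \<in> V" if "v \<in> V" for v
      using that B by (simp add: subspace_diff[OF R.subspace] R.E_closed R'.E_closed)
    show "inner (E B v - F B v) w = inner v (E B w - F B w)" if "v \<in> V" "w \<in> V" for v w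
      using that B by (simp add: inner_diff_left inner_diff_right R.E_symmetric R'.E_symmetric)
    show "inner (E B v - F B v) v = 0" if v: "v \<in> V" for v
      using R.measure_form_measure[OF v B] R'.measure_form_measure[OF v B] meas[OF v] by (simp add: inner_diff_left)
  qed
  then show ?thesis by simp
qed

section \<open>The projections of an operator and of its inverse\<close>

locale inverse_resolutions = commuting_resolutions V T S E F
  for V :: "'a::real_inner set" and T S :: "'a \<Rightarrow> 'a" and E F :: "real set \<Rightarrow> 'a \<Rightarrow> 'a" +
  assumes TS: "u \<in> V \<Longrightarrow> T (S u) = u" and ST: "u \<in> V \<Longrightarrow> S (T u) = u"
    and T_nonneg: "u \<in> V \<Longrightarrow> 0 \<le> inner (T u) u"
begin

text \<open>On a vector \<open>w\<close> in both ranges the form of \<open>T\<close> is at most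
  \<open>a\<close> and that of the inverse at most \<open>s\<close>, whereas Cauchy-Schwarz for the
  form of \<open>T\<close> at \<open>w\<close> and \<open>S w\<close> demands
  \<open>a * s \<ge> 1\<close> unless \<open>w = 0\<close>.\<close>

lemma E_small_F_small:
  assumes u: "u \<in> V" and a: "0 < a" and s: "a * s < 1"
  shows "F {..s} (E {..a} u) = 0"
proof -
  define w where "w = E {..a} (F {..s} u)"
  have w: "w \<in> V" "E {..a} w = w" "F {..s} w = w"
    using joint_range[OF u, of "{..a}" "{..s}"] by (auto simp: w_def)
  have Sw: "S w \<in> V" using w by (simp add: R'.T_closed)
  \<comment> \<open>Positivity of \<open>T\<close> at this vector is the required instance of
    Cauchy-Schwarz.\<close>
  have "0 \<le> inner (T (w - a *\<^sub>R S w)) (w - a *\<^sub>R S w)"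
    using w Sw by (intro T_nonneg subspace_diff[OF R.subspace] subspace_scale[OF R.subspace])
  also have "\<dots> = inner (T w) w - 2 * a * inner w w + a * a * inner (S w) w"
  proof -
    have "T (w + (- a) *\<^sub>R S w) = T w + (- a) *\<^sub>R w"
      using w Sw by (simp only: R.T_add R.T_scaleR subspace_scale[OF R.subspace] TS)
    then have "T (w - a *\<^sub>R S w) = T w - a *\<^sub>R w"
      by (simp only: scaleR_minus_left add_uminus_conv_diff)
    moreover have "inner (T w) (S w) = inner w w"
      using R.T_symmetric[OF w(1) Sw] TS[OF w(1)] by simp
    ultimately show ?thesis
      by (simp only:) (simp add: inner_diff_left inner_diff_right inner_commute algebra_simps)
  qed
  also have "\<dots> \<le> a * inner w w - 2 * a * inner w w + a * a * (s * inner w w)"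
    using R.T_upper_bound[OF w(1) _ _ w(2), of a] R'.T_upper_bound[OF w(1) _ _ w(3), of s] a
    by (intro add_mono diff_mono mult_left_mono) auto
  also have "\<dots> = (a * (a * s - 1)) * inner w w"
    by (simp add: algebra_simps)
  finally have "0 \<le> (a * (a * s - 1)) * inner w w" .
  moreover have "a * (a * s - 1) < 0"
    using a s by (simp add: mult_pos_neg)
  ultimately have "\<not> 0 < inner w w"
    using mult_neg_pos[of "a * (a * s - 1)" "inner w w"] by linarith
  then have "w = 0"
    by (simp add: inner_gt_zero_iff)
  then show ?thesis
    using commute[of "{..a}" "{..s}" u] u by (simp add: w_def)
qed

text \<open>The bound for \<open>T\<close> is applied at \<open>S w\<close>, where it reads
  \<open>b |S w|^2 \<le> <S w, w>\<close>. Nonnegativity of \<open>|b S w - w|^2\<close> then gives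
  \<open>b <S w, w> \<le> |w|^2\<close>, against the lower bound \<open>s\<close> for the form of
  \<open>S\<close> at \<open>w\<close>.\<close>

lemma E_large_F_large:
  assumes u: "u \<in> V" and b: "0 < b" and s: "1 < b * s"
  shows "E {b..} (F {s..} u) = 0"
proof -
  define w where "w = E {b..} (F {s..} u)"
  have w: "w \<in> V" "E {b..} w = w" "F {s..} w = w"
    using joint_range[OF u, of "{b..}" "{s..}"] by (auto simp: w_def)
  have Sw: "S w \<in> V" using w by (simp add: R'.T_closed)
  \<comment> \<open>\<open>E {b..}\<close> commutes with \<open>T\<close>, hence with its inverse,
    so that \<open>S w\<close> is fixed like \<open>w\<close>.\<close>
  have "E {b..} (S w) = S (T (E {b..} (S w)))"
    using Sw by (simp add: ST R.E_closed)
  also have "\<dots> = S w"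
    using Sw w by (simp add: R.T_E_commute TS)
  finally have 1: "b * inner (S w) (S w) \<le> inner (S w) w"
    using R.T_lower_bound[OF Sw, of "{b..}" b] w by (simp add: TS inner_commute)
  have 2: "s * inner w w \<le> inner (S w) w"
    using R'.T_lower_bound[OF w(1) _ _ w(3), of s] by simp
  have "0 \<le> inner (b *\<^sub>R S w - w) (b *\<^sub>R S w - w)"
    by simp
  also have "\<dots> = b * (b * inner (S w) (S w)) - 2 * b * inner (S w) w + inner w w"
    by (simp add: inner_diff_left inner_diff_right inner_commute algebra_simps)
  also have "\<dots> \<le> b * inner (S w) w - 2 * b * inner (S w) w + inner w w"
    using 1 b by simp
  finally have "b * inner (S w) w \<le> inner w w" by simp
  moreover have "b * (s * inner w w) \<le> b * inner (S w) w"
    using 2 b by simp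
  ultimately have "(b * s - 1) * inner w w \<le> 0"
    by (simp add: algebra_simps)
  then have "\<not> 0 < inner w w"
    using s mult_pos_pos[of "b * s - 1" "inner w w"] by linarith
  then have "w = 0"
    by (simp add: inner_gt_zero_iff)
  then show ?thesis
    by (simp add: w_def)
qed

lemma F_lessThan_E_atMost:
  assumes u: "u \<in> V" and a: "0 < a"
  shows "F {..<1 / a} (E {..a} u) = 0"
  unfolding lessThan_eq_UN
proof (rule R'.E_UN_eq_0)
  show "F {..1 / a - 1 / real (Suc n)} (E {..a} u) = 0" for n
    using a by (intro E_small_F_small[OF u a]) (simp add: right_diff_distrib del: of_nat_Suc)
qed (use u in \<open>auto simp: R.E_closed\<close>)

lemma E_greaterThan_F_atLeast:
  assumes u: "u \<in> V" and a: "0 < a"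
  shows "E {a<..} (F {1 / a..} u) = 0"
  unfolding greaterThan_eq_UN
proof (rule R.E_UN_eq_0)
  show "E {a + 1 / real (Suc n)..} (F {1 / a..} u) = 0" for n
    using a by (intro E_large_F_large[OF u]) (simp_all add: distrib_right add_pos_pos del: of_nat_Suc)
qed (use u in \<open>auto simp: R'.E_closed\<close>)

text \<open>\<open>F {..<1 / a}\<close> vanishes on the range of \<open>E {..a}\<close>, and
  \<open>E {a<..}\<close> on the range of \<open>F {1 / a..}\<close>; so each of the two projections
  equals their product.\<close>

lemma E_greaterThan:
  assumes u: "u \<in> V" and a: "0 < a"
  shows "E {a<..} u = F {..<1 / a} u"
proof -
  have compl: "- {..a} = {a<..}" "- {1 / a..} = {..<1 / a}" by auto
  have 1: "F {..<1 / a} u = F {..<1 / a} (E {a<..} u)"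
  proof -
    have "u = E {..a} u + E {a<..} u"
      using R.E_compl[of "{..a}" u] u by (simp add: compl)
    then have "F {..<1 / a} u = F {..<1 / a} (E {..a} u) + F {..<1 / a} (E {a<..} u)"
      using u by (metis R'.E_add R.E_closed atMost_borel greaterThan_borel lessThan_borel)
    then show ?thesis
      using F_lessThan_E_atMost[OF assms] by simp
  qed
  have 2: "E {a<..} u = E {a<..} (F {..<1 / a} u)"
  proof -
    have "u = F {1 / a..} u + F {..<1 / a} u"
      using R'.E_compl[of "{1 / a..}" u] u by (simp add: compl)
    then have "E {a<..} u = E {a<..} (F {1 / a..} u) + E {a<..} (F {..<1 / a} u)"
      using u by (metis R.E_add R'.E_closed atLeast_borel greaterThan_borel lessThan_borel)
    then show ?thesis
      using E_greaterThan_F_atLeast[OF assms] by simp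
  qed
  show ?thesis
    by (rule trans[OF 2 trans[OF commute 1[symmetric]]]) (use u in auto)
qed

text \<open>The range of \<open>E {..0}\<close> lies in that of \<open>E {..1 / Suc n}\<close> and
  is killed by \<open>F {..<Suc n}\<close> for every \<open>n\<close>; these half-lines exhaust the
  real line.\<close>

lemma E_nonpos:
  assumes u: "u \<in> V"
  shows "E {..0} u = 0"
proof -
  define v where "v = E {..0} u"
  have v: "v \<in> V" using u by (simp add: v_def R.E_closed)
  have "F {..<real (Suc n)} v = 0" for n
  proof -
    define a where "a = 1 / real (Suc n)"
    have a: "0 < a" "1 / a = real (Suc n)" by (simp_all add: a_def)
    then have "{..a} \<inter> {..0} = {..0}" by auto
    then have "E {..a} v = v"
      using R.E_Int[of "{..a}" "{..0}" u] u by (simp add: v_def)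
    then show ?thesis
      using F_lessThan_E_atMost[OF v a(1)] by (simp add: a(2) del: of_nat_Suc)
  qed
  then have "F (\<Union>n. {..<real (Suc n)}) v = 0"
    by (intro R'.E_UN_eq_0[OF v]) auto
  moreover have "(\<Union>n. {..<real (Suc n)}) = UNIV"
  proof -
    have "\<exists>n. t < real (Suc n)" for t
      using reals_Archimedean2[of t] by (meson lessI of_nat_less_iff order.strict_trans)
    then show ?thesis by (auto simp del: of_nat_Suc)
  qed
  ultimately show ?thesis
    using R'.E_UNIV[OF v] by (simp add: v_def)
qed

end


section \<open>Bounded positive operators\<close>

definition invariant_subspace :: "('a::real_normed_vector \<Rightarrow> 'a) \<Rightarrow> 'a set \<Rightarrow> bool" where
  "invariant_subspace T V \<longleftrightarrow> closed V \<and> subspace V \<and> (\<forall>v\<in>V. T v \<in> V)"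

definition bounded_commutant :: "('a::real_normed_vector \<Rightarrow> 'a) \<Rightarrow> 'a set \<Rightarrow> ('a \<Rightarrow> 'a) set" where
  "bounded_commutant T V = {X. (\<forall>v\<in>V. X v \<in> V \<and> X (T v) = T (X v)) \<and>
     (\<forall>v\<in>V. \<forall>w\<in>V. X (v + w) = X v + X w) \<and> (\<forall>c. \<forall>v\<in>V. X (c *\<^sub>R v) = c *\<^sub>R X v) \<and>
     (\<exists>K. \<forall>v\<in>V. norm (X v) \<le> K * norm v)}"

text \<open>Beyond being a resolution, the projections preserve closed invariant subspaces and
  commute with the bounded commutant there. This allows restricting them to
  \<open>supported d\<close>, making them complex linear, and comparing them with another
  resolution.\<close>

lemma spectral_resolution_exists:
  fixes T :: "'a::{real_inner,banach} \<Rightarrow> 'a"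
  assumes bounded: "bounded_linear T"
    and sym: "\<And>x y. inner (T x) y = inner x (T y)"
    and pos: "\<And>x. 0 \<le> inner (T x) x"
  shows "\<exists>E R. spectral_resolution UNIV T E \<and> (\<forall>u. E {-R..R} u = u) \<and>
    (\<forall>V. \<forall>B\<in>sets borel. \<forall>u\<in>V. invariant_subspace T V \<longrightarrow>
       E B u \<in> V \<and> (\<forall>X\<in>bounded_commutant T V. X (E B u) = E B (X u)))"
proof -
  \<comment> \<open>The summand 1 keeps the scaling factor positive when
    \<open>T = 0\<close>.\<close>
  define R where "R = onorm T + 1"
  have R: "0 < R"
    using onorm_pos_le[OF bounded] by (simp add: R_def)
  define T1 where "T1 x = (1 / R) *\<^sub>R T x" for x
  interpret T: bounded_linear T by (rule bounded)
  interpret positive_contraction T1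
  proof (rule positive_contraction.intro)
    show "bounded_linear T1"
      unfolding T1_def by (rule bounded_linear_const_scaleR[OF bounded])
    show "inner (T1 x) y = inner x (T1 y)" for x y
      by (simp add: T1_def sym)
    show "0 \<le> inner (T1 x) x" for x
      using R by (simp add: T1_def pos)
    show "inner (T1 x) x \<le> inner x x" for x
    proof -
      have "inner (T x) x \<le> norm (T x) * norm x"
        by (rule norm_cauchy_schwarz)
      also have "\<dots> \<le> (R * norm x) * norm x"
        using onorm[OF bounded, of x] by (intro mult_right_mono) (auto simp: R_def distrib_right intro: add_increasing2)
      also have "\<dots> = R * inner x x"
        by (simp add: power2_norm_eq_inner[symmetric] power2_eq_square)
      finally show ?thesis
        using R by (simp add: T1_def divide_le_eq mult.commute)
    qed
  qed
  have T: "T x = R *\<^sub>R T1 x" for x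
    using R by (simp add: T1_def)
  \<comment> \<open>The spectral measure of \<open>R\<close> times \<open>T1\<close> is the image of
    that of \<open>T1\<close> under multiplication by \<open>R\<close>.\<close>
  define F where "F B = E ((\<lambda>t. R * t) -` B)" for B
  have vimage: "(\<lambda>t. R * t) -` B \<in> sets borel" if "B \<in> sets borel" for B
    using measurable_sets[of "\<lambda>t. R * t" borel borel B] that by simp
  have quadratic: "inner (F B u) u = measure (moment_measure u) ((\<lambda>t. R * t) -` B)" if "B \<in> sets borel" for B u
    unfolding F_def by (rule E_quadratic[OF vimage[OF that]])
  have form: "form_measure F u = distr (moment_measure u) borel (\<lambda>t. R * t)" for u
  proof -
    interpret finite_measure "moment_measure u" by (rule finite_moment_measure)
    have "form_measure F u = measure_of UNIV (sets borel) (emeasure (distr (moment_measure u) borel (\<lambda>t. R * t)))"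
      unfolding form_measure_def
    proof (rule measure_of_eq)
      fix B :: "real set" assume "B \<in> sigma_sets UNIV (sets borel)"
      then have B: "B \<in> sets borel"
        using sets.sigma_sets_eq[of "borel :: real measure"] by simp
      then show "ennreal (inner (F B u) u) = emeasure (distr (moment_measure u) borel (\<lambda>t. R * t)) B"
        by (subst emeasure_distr) (auto simp: quadratic emeasure_eq_measure sets_eq_imp_space_eq[OF sets_moment_measure])
    qed simp
    also have "\<dots> = distr (moment_measure u) borel (\<lambda>t. R * t)"
      using measure_of_of_measure[of "distr (moment_measure u) borel (\<lambda>t. R * t)"] by simp
    finally show ?thesis .
  qed
  have res: "spectral_resolution UNIV T F"
  proof
    show "inner (T u) v = inner u (T v)" for u v
      by (rule sym)
    show "inner (F B u) v = inner u (F B v)" if "B \<in> sets borel" for B u v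
      unfolding F_def by (rule E_symmetric[OF vimage[OF that]])
    show "F UNIV u = u" for u
      by (simp add: F_def E_UNIV)
    show "F (B \<inter> C) u = F B (F C u)" if "B \<in> sets borel" "C \<in> sets borel" for B C u
      by (simp add: F_def vimage_Int E_Int vimage that)
    show "(\<lambda>n. inner (F (D n) u) u) sums inner (F (\<Union>n. D n) u) u"
      if D: "range D \<subseteq> sets borel" "disjoint_family D" for D :: "nat \<Rightarrow> real set" and u
    proof -
      interpret finite_measure "moment_measure u" by (rule finite_moment_measure)
      have meas: "D n \<in> sets borel" for n using D by auto
      have "(\<lambda>n. measure (moment_measure u) ((\<lambda>t. R * t) -` D n)) sums measure (moment_measure u) (\<Union>n. (\<lambda>t. R * t) -` D n)"
        using D(2) meas by (intro finite_measure_UNION) (auto simp: sets_moment_measure vimage disjoint_family_on_def)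
      then show ?thesis
        using meas by (simp add: quadratic vimage_UN)
    qed
    show "integrable (form_measure F u) (\<lambda>t. t)" for u
    proof -
      have "poly [:0, R:] = (\<lambda>t. R * t)" by (auto simp: fun_eq_iff)
      then have "integrable (moment_measure u) (\<lambda>t. R * t)"
        using integrable_moment_measure_poly[of u "[:0, R:]"] by simp
      then show ?thesis
        unfolding form by (subst integrable_distr_eq) auto
    qed
    show "inner (T u) u = (LINT t|form_measure F u. t)" for u
    proof -
      have "(LINT t|form_measure F u. t) = (LINT t|moment_measure u. R * t)"
        unfolding form by (subst integral_distr) auto
      also have "(\<lambda>t. R * t) = poly [:0, R:]" by (auto simp: fun_eq_iff)
      also have "(LINT t|moment_measure u. poly [:0, R:] t) = inner (T u) u"
        unfolding integral_moment_measure by (simp add: T)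
      finally show ?thesis by simp
    qed
  qed auto
  have support: "F {-R..R} u = u" for u
  proof -
    interpret F: spectral_resolution UNIV T F by (rule res)
    interpret finite_measure "moment_measure u" by (rule finite_moment_measure)
    have "AE t in moment_measure u. \<not> R * t \<notin> {-R..R}"
      using AE_moment_measure[of u]
    proof eventually_elim
      fix t :: real assume t: "t \<in> {0..1}"
      then have "0 \<le> R * t"
        using R by simp
      moreover have "R * t \<le> R"
        using t R by (simp add: mult_le_cancel_left1)
      ultimately show "\<not> R * t \<notin> {-R..R}"
        using R by simp
    qed
    then have "emeasure (moment_measure u) {t \<in> space (moment_measure u). R * t \<notin> {-R..R}} = 0"
      by (rule emeasure_eq_0_AE)
    moreover have "{t \<in> space (moment_measure u). R * t \<notin> {-R..R}} = (\<lambda>t. R * t) -` (- {-R..R})"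
      by (auto simp: sets_eq_imp_space_eq[OF sets_moment_measure])
    ultimately have "measure (moment_measure u) ((\<lambda>t. R * t) -` (- {-R..R})) = 0"
      by (simp only: Sigma_Algebra.measure_def enn2real_0)
    then have "F (- {-R..R}) u = 0"
      by (subst F.E_eq_0_iff) (simp_all only: quadratic borel_comp atLeastAtMost_borel UNIV_I)
    then show ?thesis
      using F.E_compl[of "{-R..R}" u] by simp
  qed
  have T1_V: "T1 v \<in> V" if "subspace V" "T v \<in> V" for V v
    using that by (simp add: T1_def subspace_scale)
  have "F B u \<in> V" if "invariant_subspace T V" "u \<in> V" "B \<in> sets borel" for V u B
    using that unfolding F_def invariant_subspace_def by (intro E_invariant vimage T1_V) auto
  moreover have "X (F B u) = F B (X u)"
    if V: "invariant_subspace T V" and X: "X \<in> bounded_commutant T V" and u: "u \<in> V" and B: "B \<in> sets borel"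
    for V X u B
  proof -
    obtain K where "\<forall>v\<in>V. norm (X v) \<le> K * norm v"
      using X unfolding bounded_commutant_def by blast
    then have K: "norm (X v) \<le> K * norm v" if "v \<in> V" for v
      using that by blast
    show ?thesis
      unfolding F_def
    proof (rule E_commute[OF _ _ _ _ _ _ K _ u vimage[OF B]])
      show "T1 v \<in> V" if "v \<in> V" for v
        using that V by (auto simp: invariant_subspace_def intro: T1_V)
      show "X (T1 v) = T1 (X v)" if "v \<in> V" for v
        using that V X by (simp add: T1_def bounded_commutant_def invariant_subspace_def)
    qed (use V X in \<open>auto simp: bounded_commutant_def invariant_subspace_def\<close>)
  qed
  ultimately show ?thesis
    using res support by blast
qed

text \<open>The projections of \<open>F\<close> commute with \<open>T\<close>, hence with the
  resolution \<open>E\<close> built from polynomials of \<open>T\<close>. Uniqueness identifies the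
  two on \<open>V\<close>, and \<open>F\<close> inherits the commutation with \<open>X\<close> from
  \<open>E\<close>.\<close>

lemma spectral_resolution_commute:
  fixes T :: "'a::{real_inner,banach} \<Rightarrow> 'a"
  assumes bounded: "bounded_linear T"
    and symmetric: "\<And>x y. inner (T x) y = inner x (T y)"
    and nonneg: "\<And>x. 0 \<le> inner (T x) x"
    and F: "spectral_resolution V T F" and V: "closed V"
    and X: "X \<in> bounded_commutant T V" and u: "u \<in> V" and B: "B \<in> sets borel"
  shows "X (F B u) = F B (X u)"
proof -
  interpret F: spectral_resolution V T F by (rule F)
  have V': "invariant_subspace T V"
    using V F.subspace F.T_closed by (simp add: invariant_subspace_def)
  from spectral_resolution_exists[OF bounded symmetric nonneg]
  obtain E R where ER: "spectral_resolution UNIV T E \<and> (\<forall>u. E {-R..R} u = u) \<and>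
    (\<forall>V. \<forall>B\<in>sets borel. \<forall>u\<in>V. invariant_subspace T V \<longrightarrow>
       E B u \<in> V \<and> (\<forall>X\<in>bounded_commutant T V. X (E B u) = E B (X u)))"
    by (elim exE) (rule that)
  note * = ER[THEN conjunct2, THEN conjunct2, rule_format]
  have invariant: "E C v \<in> V" if "v \<in> V" "C \<in> sets borel" for C v
    using *[OF that(2,1) V'] by simp
  have commute: "Y (E C v) = E C (Y v)" if "Y \<in> bounded_commutant T V" "v \<in> V" "C \<in> sets borel" for Y C v
    using *[OF that(3,2) V'] that(1) by simp
  interpret E: spectral_resolution UNIV T E by (rule ER[THEN conjunct1])
  have F_commutant: "F C \<in> bounded_commutant T V" if "C \<in> sets borel" for C
    using that unfolding bounded_commutant_def
    by (auto simp: F.E_closed F.E_add F.E_scaleR F.T_E_commute intro!: exI[of _ 1] F.E_norm_le)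
  have "commuting_resolutions V T T E F"
  proof
    show "E B u \<in> V" if "B \<in> sets borel" "u \<in> V" for B u
      using invariant that by blast
    show "E B (F C u) = F C (E B u)" if "B \<in> sets borel" "C \<in> sets borel" "u \<in> V" for B C u
      using commute[OF F_commutant[OF that(2)] that(3,1)] by simp
    show "inner (E B u) v = inner u (E B v)" if "B \<in> sets borel" for B u v
      using that by (intro E.E_symmetric) auto
    show "(\<lambda>n. inner (E (D n) u) u) sums inner (E (\<Union>n. D n) u) u"
      if "range D \<subseteq> sets borel" "disjoint_family D" for D :: "nat \<Rightarrow> real set" and u
      using that by (intro E.E_sums) auto
  qed (simp_all only: UNIV_I E.E_UNIV E.E_Int E.T_integrable E.T_integral[symmetric] F.subspace F.T_closed F.T_symmetric)
  then have eq: "E C v = F C v" if "v \<in> V" "C \<in> sets borel" for C v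
    using spectral_resolution_unique that by blast
  have "X u \<in> V"
    using X u by (simp add: bounded_commutant_def)
  then show ?thesis
    using commute[OF X u B] u B by (simp add: eq)
qed


section \<open>Square-summable families as a Hilbert space\<close>

definition square_summable :: "('i \<Rightarrow> complex) \<Rightarrow> bool" where
  "square_summable x \<longleftrightarrow> (\<lambda>i. (cmod (x i))\<^sup>2) summable_on UNIV"

lemma square_summable_0: "square_summable (\<lambda>_. 0)"
  by (simp add: square_summable_def)

lemma square_summable_scale:
  assumes "square_summable x"
  shows "square_summable (\<lambda>i. c * x i)"
  using summable_on_cmult_right[OF assms[unfolded square_summable_def], of "(cmod c)\<^sup>2"]
  by (simp add: square_summable_def norm_mult power_mult_distrib)

lemma cmod_add_square_le: "(cmod (a + b))\<^sup>2 \<le> 2 * (cmod a)\<^sup>2 + 2 * (cmod b)\<^sup>2"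
  by (rule order_trans[OF power_mono[OF norm_triangle_ineq norm_ge_zero] square_sum_le])

lemma square_summable_add:
  assumes "square_summable x" "square_summable y"
  shows "square_summable (\<lambda>i. x i + y i)"
  unfolding square_summable_def
proof (rule summable_on_comparison_test)
  show "(\<lambda>i. 2 * (cmod (x i))\<^sup>2 + 2 * (cmod (y i))\<^sup>2) summable_on UNIV"
    using assms by (intro summable_on_add summable_on_cmult_right) (auto simp: square_summable_def)
qed (auto intro: cmod_add_square_le)

lemma square_summable_mult:
  assumes "square_summable x" "square_summable y"
  shows "(\<lambda>i. x i * cnj (y i)) summable_on UNIV"
proof (rule abs_summable_summable, rule summable_on_comparison_test)
  show "(\<lambda>i. (cmod (x i))\<^sup>2 + (cmod (y i))\<^sup>2) summable_on UNIV"
    using assms by (intro summable_on_add) (auto simp: square_summable_def)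
  show "norm (x i * cnj (y i)) \<le> (cmod (x i))\<^sup>2 + (cmod (y i))\<^sup>2" for i
  proof -
    have "1 * (cmod (x i) * cmod (y i)) \<le> 2 * (cmod (x i) * cmod (y i))"
      by (rule mult_right_mono) auto
    also have "\<dots> \<le> (cmod (x i))\<^sup>2 + (cmod (y i))\<^sup>2"
      using sum_squares_bound[of "cmod (x i)" "cmod (y i)"] by (simp add: mult.assoc)
    finally show ?thesis by (simp add: norm_mult)
  qed
qed auto

text \<open>Completeness is a type class and the exponent \<open>d\<close> cannot be part of a type.
  With the index type \<open>nat \<times> 'g\<close> a single Hilbert space accommodates all
  powers.\<close>

typedef 'i l2 = "{x :: 'i \<Rightarrow> complex. square_summable x}"
  morphisms coord Abs_l2
  by (rule exI[of _ "\<lambda>_. 0"]) (simp add: square_summable_0)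

lemma square_summable_coord [simp]: "square_summable (coord x)"
  using coord[of x] by simp

lemma coord_Abs_l2 [simp]: "square_summable x \<Longrightarrow> coord (Abs_l2 x) = x"
  by (simp add: Abs_l2_inverse)

lemma l2_eqI: "(\<And>i. coord x i = coord y i) \<Longrightarrow> x = y"
  by (simp add: coord_inject[symmetric] fun_eq_iff)

instantiation l2 :: (type) real_vector
begin

definition "0 = Abs_l2 (\<lambda>_. 0)"
definition "x + y = Abs_l2 (\<lambda>i. coord x i + coord y i)"
definition "- x = Abs_l2 (\<lambda>i. - coord x i)"
definition "x - y = Abs_l2 (\<lambda>i. coord x i + - coord y i)" for x y :: "'a l2"
definition "c *\<^sub>R x = Abs_l2 (\<lambda>i. complex_of_real c * coord x i)"

lemma coord_0 [simp]: "coord 0 i = 0"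
  by (simp add: zero_l2_def square_summable_0)

lemma coord_add [simp]: "coord (x + y) i = coord x i + coord y i"
  by (simp add: plus_l2_def square_summable_add)

lemma square_summable_uminus: "square_summable x \<Longrightarrow> square_summable (\<lambda>i. - x i)"
  using square_summable_scale[of x "-1"] by simp

lemma coord_uminus [simp]: "coord (- x) i = - coord x i"
  by (simp add: uminus_l2_def square_summable_uminus)

lemma coord_diff [simp]: "coord (x - y) i = coord x i - coord y i"
  using square_summable_add[of "coord x" "\<lambda>i. - coord y i"]
  by (simp add: minus_l2_def square_summable_uminus)

lemma coord_scaleR [simp]: "coord (c *\<^sub>R x) i = c *\<^sub>R coord x i"
  by (simp add: scaleR_l2_def square_summable_scale scaleR_conv_of_real)

instance
  by standard (auto intro!: l2_eqI simp: algebra_simps scaleR_add_left)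

end

lemma coord_sum: "coord (\<Sum>k\<in>K. x k) i = (\<Sum>k\<in>K. coord (x k) i)"
  by (induction K rule: infinite_finite_induct) auto

definition l2_inner :: "'i l2 \<Rightarrow> 'i l2 \<Rightarrow> complex" where
  "l2_inner x y = (\<Sum>\<^sub>\<infinity>i. coord x i * cnj (coord y i))"

lemma l2_inner_summable: "(\<lambda>i. coord x i * cnj (coord y i)) summable_on UNIV"
  by (rule square_summable_mult) simp_all

lemma l2_inner_cnj: "cnj (l2_inner x y) = l2_inner y x"
  unfolding l2_inner_def infsum_cnj[symmetric] by (simp add: mult.commute)

lemma l2_inner_add: "l2_inner (x + y) z = l2_inner x z + l2_inner y z"
  unfolding l2_inner_def by (simp add: infsum_add[symmetric] l2_inner_summable distrib_right)

lemma l2_inner_scaleR: "l2_inner (c *\<^sub>R x) y = c *\<^sub>R l2_inner x y"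
  unfolding l2_inner_def scaleR_conv_of_real coord_scaleR mult.assoc
  by (rule infsum_cmult_right) (rule l2_inner_summable)

lemma l2_inner_self: "l2_inner x x = complex_of_real (\<Sum>\<^sub>\<infinity>i. (cmod (coord x i))\<^sup>2)"
proof -
  have "l2_inner x x = (\<Sum>\<^sub>\<infinity>i. complex_of_real ((cmod (coord x i))\<^sup>2))"
    unfolding l2_inner_def by (simp only: complex_norm_square)
  also have "\<dots> = complex_of_real (\<Sum>\<^sub>\<infinity>i. (cmod (coord x i))\<^sup>2)"
    by (rule infsumI[OF has_sum_of_real[OF has_sum_infsum]])
      (use square_summable_coord[of x] in \<open>simp add: square_summable_def\<close>)
  finally show ?thesis .
qed

instantiation l2 :: (type) real_inner
begin

definition "inner x y = Re (l2_inner x y)"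
definition "norm x = sqrt (inner x x)" for x :: "'a l2"
definition "sgn x = x /\<^sub>R norm x" for x :: "'a l2"
definition "dist x y = norm (x - y)" for x :: "'a l2"
definition "(uniformity :: ('a l2 \<times> 'a l2) filter) = (INF e\<in>{0<..}. principal {(x, y). dist x y < e})"
definition "open (U :: 'a l2 set) \<longleftrightarrow> (\<forall>x\<in>U. eventually (\<lambda>(x', y). x' = x \<longrightarrow> y \<in> U) uniformity)"

instance
proof
  fix x y z :: "'a l2" and r :: real
  show "inner x y = inner y x"
    unfolding inner_l2_def l2_inner_cnj[of x y, symmetric] by simp
  show "inner (x + y) z = inner x z + inner y z"
    by (simp add: inner_l2_def l2_inner_add)
  show "inner (r *\<^sub>R x) y = r * inner x y"
    by (simp add: inner_l2_def l2_inner_scaleR)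
  show "0 \<le> inner x x"
    by (simp add: inner_l2_def l2_inner_self infsum_nonneg)
  show "inner x x = 0 \<longleftrightarrow> x = 0"
  proof
    assume "inner x x = 0"
    then have "(\<Sum>\<^sub>\<infinity>i. (cmod (coord x i))\<^sup>2) \<le> 0"
      by (simp add: inner_l2_def l2_inner_self)
    then have "(cmod (coord x i))\<^sup>2 = 0" for i
      by (rule nonneg_infsum_le_0D) (use square_summable_coord[of x] in \<open>auto simp: square_summable_def\<close>)
    then show "x = 0"
      by (intro l2_eqI) simp
  qed (simp add: inner_l2_def l2_inner_def)
qed (simp_all add: norm_l2_def sgn_l2_def dist_l2_def uniformity_l2_def open_l2_def)

end

lemma norm_l2_square: "(norm x)\<^sup>2 = (\<Sum>\<^sub>\<infinity>i. (cmod (coord x i))\<^sup>2)"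
  by (simp add: power2_norm_eq_inner inner_l2_def l2_inner_self)

lemma sum_coord_le_norm:
  assumes "finite F"
  shows "(\<Sum>i\<in>F. (cmod (coord x i))\<^sup>2) \<le> (norm x)\<^sup>2"
  unfolding norm_l2_square
  by (rule finite_sum_le_infsum) (use assms square_summable_coord[of x] in \<open>auto simp: square_summable_def\<close>)

lemma cmod_coord_le_norm: "cmod (coord x i) \<le> norm x"
  using sum_coord_le_norm[of "{i}" x] by (simp add: power2_le_iff_abs_le)

lemma norm_l2_le:
  assumes "0 \<le> c" "\<And>F. finite F \<Longrightarrow> (\<Sum>i\<in>F. (cmod (coord x i))\<^sup>2) \<le> c\<^sup>2"
  shows "norm x \<le> c"
proof -
  have "(norm x)\<^sup>2 \<le> c\<^sup>2"
    unfolding norm_l2_square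
    by (rule infsum_le_finite_sums) (use assms square_summable_coord[of x] in \<open>auto simp: square_summable_def\<close>)
  then show ?thesis
    using assms(1) by (simp add: power2_le_iff_abs_le)
qed

lemma bounded_linear_coord: "bounded_linear (\<lambda>x. coord x i)"
  by (rule bounded_linear_intro[of _ 1]) (simp_all add: cmod_coord_le_norm)

text \<open>The limit is formed coordinatewise; Cauchy bounds pass to it on finite sets of
  coordinates, and such finite sums control the norm.\<close>

instance l2 :: (type) banach
proof
  fix X :: "nat \<Rightarrow> 'a l2"
  assume X: "Cauchy X"
  have "Cauchy (\<lambda>n. coord (X n) i)" for i
    by (rule bounded_linear.Cauchy[OF bounded_linear_coord X])
  then have "\<exists>l. (\<lambda>n. coord (X n) i) \<longlonglongrightarrow> l" for i
    by (simp add: Cauchy_convergent_iff convergent_def)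
  then obtain l where l: "\<And>i. (\<lambda>n. coord (X n) i) \<longlonglongrightarrow> l i"
    by metis
  have bound: "(\<Sum>i\<in>F. (cmod (coord (X n) i - l i))\<^sup>2) \<le> e\<^sup>2"
    if N: "\<forall>m\<ge>N. norm (X n - X m) < e" and F: "finite F" for N n e F
  proof (rule tendsto_upperbound)
    show "(\<lambda>m. \<Sum>i\<in>F. (cmod (coord (X n) i - coord (X m) i))\<^sup>2) \<longlonglongrightarrow> (\<Sum>i\<in>F. (cmod (coord (X n) i - l i))\<^sup>2)"
      by (intro tendsto_intros l)
    show "eventually (\<lambda>m. (\<Sum>i\<in>F. (cmod (coord (X n) i - coord (X m) i))\<^sup>2) \<le> e\<^sup>2) sequentially"
    proof (rule eventually_sequentiallyI[of N])
      fix m assume "N \<le> m"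
      then have "(norm (X n - X m))\<^sup>2 \<le> e\<^sup>2"
        using N by (intro power_mono) (auto intro: less_imp_le)
      then show "(\<Sum>i\<in>F. (cmod (coord (X n) i - coord (X m) i))\<^sup>2) \<le> e\<^sup>2"
        using sum_coord_le_norm[OF F, of "X n - X m"] by simp
    qed
  qed simp
  have Cauchy: "\<exists>N. \<forall>n\<ge>N. \<forall>m\<ge>N. norm (X n - X m) < e" if "0 < e" for e
    using X that by (auto simp: Cauchy_iff)
  obtain N where N: "\<forall>n\<ge>N. \<forall>m\<ge>N. norm (X n - X m) < 1"
    using Cauchy[of 1] by auto
  have "square_summable (\<lambda>i. coord (X N) i - l i)"
    unfolding square_summable_def
  proof (rule nonneg_bdd_above_summable_on)
    show "bdd_above (sum (\<lambda>i. (cmod (coord (X N) i - l i))\<^sup>2) ` {F. F \<subseteq> UNIV \<and> finite F})"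
      using bound[of N N 1] N by (intro bdd_aboveI[of _ "1\<^sup>2"]) auto
  qed simp
  \<comment> \<open>\<open>l\<close> is recovered as \<open>X N\<close> minus the square-summable
    error.\<close>
  then have "square_summable (\<lambda>i. coord (X N) i + - (coord (X N) i - l i))"
    by (intro square_summable_add square_summable_uminus) auto
  then have l_summable: "square_summable l" by simp
  have "X \<longlonglongrightarrow> Abs_l2 l"
  proof (rule LIMSEQ_I)
    fix e :: real assume e: "0 < e"
    obtain N where N: "\<forall>n\<ge>N. \<forall>m\<ge>N. norm (X n - X m) < e / 2"
      using Cauchy[of "e / 2"] e by auto
    have "norm (X n - Abs_l2 l) < e" if "N \<le> n" for n
    proof -
      have "norm (X n - Abs_l2 l) \<le> e / 2"
        using bound[of N n "e / 2"] N that e by (intro norm_l2_le) (auto simp: l_summable)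
      then show ?thesis using e by simp
    qed
    then show "\<exists>no. \<forall>n\<ge>no. norm (X n - Abs_l2 l) < e"
      by blast
  qed
  then show "convergent X"
    by (rule convergentI)
qed

text \<open>\<open>l2\<close> is an instance of a real inner product space; multiplication by i is
  an operator on it, and complex linearity becomes commutation with this operator.\<close>

definition imaginary :: "'i l2 \<Rightarrow> 'i l2" where
  "imaginary x = Abs_l2 (\<lambda>i. \<i> * coord x i)"

lemma coord_imaginary [simp]: "coord (imaginary x) i = \<i> * coord x i"
  by (simp add: imaginary_def square_summable_scale)

lemma l2_inner_eq_Complex: "l2_inner x y = Complex (inner x y) (inner x (imaginary y))"
proof -
  have "l2_inner x (imaginary y) = - \<i> * l2_inner x y"
    unfolding l2_inner_def
    by (subst infsum_cmult_right[symmetric]) (auto simp: l2_inner_summable mult_ac)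
  then show ?thesis
    by (simp add: inner_l2_def complex_eq_iff)
qed

lemma norm_imaginary [simp]: "norm (imaginary x) = norm x"
proof -
  have "(norm (imaginary x))\<^sup>2 = (norm x)\<^sup>2"
    by (simp add: norm_l2_square norm_mult)
  then show ?thesis by simp
qed

text \<open>For a partial injection \<open>f\<close> this is a partial isometry whose adjoint
  belongs to the inverse partial injection; \<open>None\<close> marks coordinates set to zero.
  Translations placed in one matrix entry are of this kind.\<close>

definition reindex :: "('j \<Rightarrow> 'i option) \<Rightarrow> 'i l2 \<Rightarrow> 'j l2" where
  "reindex f x = Abs_l2 (\<lambda>j. case f j of None \<Rightarrow> 0 | Some i \<Rightarrow> coord x i)"

lemma reindex_finite_sum_le:
  assumes inj: "\<And>j k i. f j = Some i \<Longrightarrow> f k = Some i \<Longrightarrow> j = k" and F: "finite F"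
  shows "(\<Sum>j\<in>F. (cmod (case f j of None \<Rightarrow> 0 | Some i \<Rightarrow> coord x i))\<^sup>2) \<le> (norm x)\<^sup>2"
proof -
  define G where "G = {j \<in> F. f j \<noteq> None}"
  have "(\<Sum>j\<in>F. (cmod (case f j of None \<Rightarrow> 0 | Some i \<Rightarrow> coord x i))\<^sup>2) = (\<Sum>j\<in>G. (cmod (coord x (the (f j))))\<^sup>2)"
    unfolding G_def using F by (intro sum.mono_neutral_cong_right) (auto split: option.splits)
  also have "\<dots> = (\<Sum>i\<in>(\<lambda>j. the (f j)) ` G. (cmod (coord x i))\<^sup>2)"
    by (subst sum.reindex) (use inj in \<open>auto simp: inj_on_def G_def\<close>)
  also have "\<dots> \<le> (norm x)\<^sup>2"
    by (rule sum_coord_le_norm) (use F in \<open>simp add: G_def\<close>)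
  finally show ?thesis .
qed

lemma coord_reindex:
  assumes "\<And>j k i. f j = Some i \<Longrightarrow> f k = Some i \<Longrightarrow> j = k"
  shows "coord (reindex f x) j = (case f j of None \<Rightarrow> 0 | Some i \<Rightarrow> coord x i)"
proof -
  have "square_summable (\<lambda>j. case f j of None \<Rightarrow> 0 | Some i \<Rightarrow> coord x i)"
    unfolding square_summable_def
    by (rule nonneg_bdd_above_summable_on)
      (use reindex_finite_sum_le[OF assms, where x = x] in \<open>auto intro!: bdd_aboveI[of _ "(norm x)\<^sup>2"]\<close>)
  then show ?thesis by (simp add: reindex_def)
qed

lemma bounded_linear_reindex:
  assumes inj: "\<And>j k i. f j = Some i \<Longrightarrow> f k = Some i \<Longrightarrow> j = k"
  shows "bounded_linear (reindex f)"
proof (rule bounded_linear_intro[of _ 1])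
  show "norm (reindex f x) \<le> norm x * 1" for x
    using reindex_finite_sum_le[OF inj, where x = x] by (intro norm_l2_le) (auto simp: coord_reindex[OF inj])
qed (auto intro!: l2_eqI simp: coord_reindex[OF inj] split: option.splits)

lemma reindex_adjoint:
  assumes inverse: "\<And>i j. f j = Some i \<longleftrightarrow> g i = Some j"
  shows "l2_inner (reindex f x) y = l2_inner x (reindex g y)"
proof -
  have f: "\<And>j k i. f j = Some i \<Longrightarrow> f k = Some i \<Longrightarrow> j = k"
    and g: "\<And>j k i. g j = Some i \<Longrightarrow> g k = Some i \<Longrightarrow> j = k"
    using inverse by (metis option.sel)+
  have "l2_inner (reindex f x) y = (\<Sum>\<^sub>\<infinity>j\<in>{j. f j \<noteq> None}. coord x (the (f j)) * cnj (coord y j))"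
    unfolding l2_inner_def by (rule infsum_cong_neutral) (auto simp: coord_reindex[OF f] split: option.splits)
  also have "\<dots> = (\<Sum>\<^sub>\<infinity>j\<in>{j. f j \<noteq> None}. coord x (the (f j)) * cnj (coord y (the (g (the (f j))))))"
  proof (rule infsum_cong)
    fix j assume "j \<in> {j. f j \<noteq> None}"
    then have "g (the (f j)) = Some j"
      using inverse[of j "the (f j)"] by simp
    then show "coord x (the (f j)) * cnj (coord y j) = coord x (the (f j)) * cnj (coord y (the (g (the (f j)))))"
      by simp
  qed
  also have "\<dots> = (\<Sum>\<^sub>\<infinity>i\<in>{i. g i \<noteq> None}. coord x i * cnj (coord y (the (g i))))"
  proof (rule infsum_reindex_bij_betw, rule bij_betwI[where g = "\<lambda>i. the (g i)"])
    have 1: "g (the (f j)) = Some j" if "f j \<noteq> None" for j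
      using that inverse[of j "the (f j)"] by simp
    have 2: "f (the (g i)) = Some i" if "g i \<noteq> None" for i
      using that inverse[of "the (g i)" i] by simp
    show "(\<lambda>j. the (f j)) \<in> {j. f j \<noteq> None} \<rightarrow> {i. g i \<noteq> None}"
      "(\<lambda>i. the (g i)) \<in> {i. g i \<noteq> None} \<rightarrow> {j. f j \<noteq> None}"
      using 1 2 by simp_all
    show "the (g (the (f j))) = j" if "j \<in> {j. f j \<noteq> None}" for j
      using 1 that by simp
    show "the (f (the (g i))) = i" if "i \<in> {i. g i \<noteq> None}" for i
      using 2 that by simp
  qed
  also have "\<dots> = l2_inner x (reindex g y)"
    unfolding l2_inner_def by (rule infsum_cong_neutral) (auto simp: coord_reindex[OF g] split: option.splits)
  finally show ?thesis .
qed


section \<open>Matrices over the group ring as bounded operators\<close>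

text \<open>Links \<open>pow_inner\<close>, a finite sum of row sums, to the unordered sum over all
  pairs in \<open>l2_inner\<close>.\<close>

lemma has_sum_finite_support:
  fixes f :: "nat \<times> 'g \<Rightarrow> 'b::{topological_comm_monoid_add,t2_space}"
  assumes "\<And>i. i < d \<Longrightarrow> (\<lambda>g. f (i, g)) summable_on UNIV" "\<And>i g. d \<le> i \<Longrightarrow> f (i, g) = 0"
  shows "(f has_sum (\<Sum>i<d. \<Sum>\<^sub>\<infinity>g. f (i, g))) UNIV"
proof -
  have "(f has_sum (\<Sum>i<n. \<Sum>\<^sub>\<infinity>g. f (i, g))) ({..<n} \<times> UNIV)" if "n \<le> d" for n
    using that
  proof (induction n)
    case (Suc n)
    have "((f \<circ> Pair n) has_sum (\<Sum>\<^sub>\<infinity>g. f (n, g))) UNIV"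
      unfolding o_def using assms(1)[of n] Suc by (intro has_sum_infsum) simp
    then have "(f has_sum (\<Sum>\<^sub>\<infinity>g. f (n, g))) (Pair n ` UNIV)"
      by (subst has_sum_reindex) (auto simp: inj_on_def)
    then have "(f has_sum ((\<Sum>i<n. \<Sum>\<^sub>\<infinity>g. f (i, g)) + (\<Sum>\<^sub>\<infinity>g. f (n, g)))) ({..<n} \<times> UNIV \<union> Pair n ` UNIV)"
      using Suc by (intro has_sum_Un_disjoint) auto
    moreover have "{..<n} \<times> UNIV \<union> Pair n ` UNIV = {..<Suc n} \<times> (UNIV :: 'g set)"
      by (auto simp: less_Suc_eq)
    ultimately show ?case by simp
  qed simp
  from this[of d] have "(f has_sum (\<Sum>i<d. \<Sum>\<^sub>\<infinity>g. f (i, g))) ({..<d} \<times> UNIV)"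
    by simp
  also have "?this \<longleftrightarrow> ?thesis"
  proof (rule has_sum_cong_neutral)
    show "f p = 0" if "p \<in> UNIV - {..<d} \<times> UNIV" for p
      using that assms(2)[of "fst p" "snd p"] by (auto simp: mem_Times_iff)
  qed auto
  finally show ?thesis .
qed

section \<open>Families as vectors of a single Hilbert space\<close>

definition embed :: "'g ell2_family \<Rightarrow> (nat \<times> 'g) l2" where
  "embed u = Abs_l2 (\<lambda>(i, g). u i g)"

definition family :: "(nat \<times> 'g) l2 \<Rightarrow> 'g ell2_family" where
  "family x = (\<lambda>i g. coord x (i, g))"

definition supported :: "nat \<Rightarrow> (nat \<times> 'g) l2 set" where
  "supported d = {x. \<forall>i\<ge>d. \<forall>g. coord x (i, g) = 0}"

lemma ell2_iff_square_summable: "x \<in> ell2 \<longleftrightarrow> square_summable x"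
  by (simp add: ell2_def square_summable_def)

lemma square_summable_family:
  assumes "u \<in> ell2_pow d"
  shows "square_summable (\<lambda>(i, g). u i g)"
  unfolding square_summable_def
  by (rule has_sum_imp_summable, rule has_sum_finite_support[of d])
    (use assms in \<open>auto simp: ell2_pow_def ell2_def\<close>)

lemma coord_embed [simp]: "u \<in> ell2_pow d \<Longrightarrow> coord (embed u) (i, g) = u i g"
  using square_summable_family[of u d] by (simp add: embed_def)

lemma family_embed: "u \<in> ell2_pow d \<Longrightarrow> family (embed u) = u"
  by (simp add: family_def)

lemma embed_family: "embed (family x) = x"
  by (simp add: embed_def family_def coord_inverse)

lemma embed_supported: "u \<in> ell2_pow d \<Longrightarrow> embed u \<in> supported d"
  by (auto simp: supported_def ell2_pow_def)

lemma family_ell2_pow: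
  assumes "x \<in> supported d"
  shows "family x \<in> ell2_pow d"
proof -
  have "square_summable (family x i)" for i
  proof -
    have "(\<lambda>p. (cmod (coord x p))\<^sup>2) summable_on (Pair i ` UNIV)"
      using square_summable_coord[of x] unfolding square_summable_def
      by (rule summable_on_subset_banach) simp
    then show ?thesis
      by (subst (asm) summable_on_reindex) (auto simp: inj_on_def square_summable_def family_def o_def)
  qed
  then show ?thesis
    using assms by (auto simp: ell2_pow_def supported_def family_def ell2_iff_square_summable fun_eq_iff)
qed

lemma pow_inner_embed:
  assumes u: "u \<in> ell2_pow d" and v: "v \<in> ell2_pow d"
  shows "pow_inner d u v = l2_inner (embed u) (embed v)"
proof -
  have "((\<lambda>(i, g). u i g * cnj (v i g)) has_sum (\<Sum>i<d. \<Sum>\<^sub>\<infinity>g. (\<lambda>(i, g). u i g * cnj (v i g)) (i, g))) UNIV"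
    by (rule has_sum_finite_support)
      (use u v in \<open>auto simp: ell2_pow_def ell2_iff_square_summable intro!: square_summable_mult\<close>)
  then have "(\<Sum>\<^sub>\<infinity>(i, g). u i g * cnj (v i g)) = pow_inner d u v"
    by (simp add: pow_inner_def ell2_inner_def infsumI)
  moreover have "l2_inner (embed u) (embed v) = (\<Sum>\<^sub>\<infinity>(i, g). u i g * cnj (v i g))"
    unfolding l2_inner_def by (rule infsum_cong) (use u v in auto)
  ultimately show ?thesis by simp
qed

lemma subspace_supported: "subspace (supported d)"
  by (rule subspaceI) (auto simp: supported_def)

lemma closed_supported: "closed (supported d :: (nat \<times> 'g) l2 set)"
proof -
  have "supported d = (\<Inter>i\<in>{d..}. \<Inter>g::'g. {x. coord x (i, g) = 0})"
    by (auto simp: supported_def)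
  moreover have "closed {x. coord x p = 0}" for p :: "nat \<times> 'g"
    by (intro closed_Collect_eq continuous_intros linear_continuous_on bounded_linear_coord)
  ultimately show ?thesis
    by (simp add: closed_INT)
qed

lemma imaginary_linear: "imaginary (x + y) = imaginary x + imaginary y"
    "imaginary (c *\<^sub>R x) = c *\<^sub>R imaginary x"
  by (auto intro!: l2_eqI simp: distrib_left)

lemma inner_imaginary: "inner x (imaginary y) = - inner (imaginary x) y"
proof -
  have "l2_inner x (imaginary y) = - l2_inner (imaginary x) y"
    unfolding l2_inner_def by (subst infsum_uminus[symmetric]) (simp add: mult_ac)
  then show ?thesis by (simp add: inner_l2_def)
qed

text \<open>The matrix with the group element \<open>h\<close> in position \<open>(i, j)\<close> and
  zeros elsewhere, acting by left translation.\<close>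

definition matrix_unit_op :: "nat \<Rightarrow> nat \<Rightarrow> 'g::group_add \<Rightarrow> (nat \<times> 'g) l2 \<Rightarrow> (nat \<times> 'g) l2" where
  "matrix_unit_op i j h = reindex (\<lambda>(k, g). if k = i then Some (j, - h + g) else None)"

lemma coord_matrix_unit_op:
  "coord (matrix_unit_op i j h x) (k, g) = (if k = i then coord x (j, - h + g) else 0)"
  unfolding matrix_unit_op_def by (subst coord_reindex) (auto split: if_splits)

lemma bounded_linear_matrix_unit_op: "bounded_linear (matrix_unit_op i j h)"
  unfolding matrix_unit_op_def by (rule bounded_linear_reindex) (auto split: if_splits)

lemma inner_matrix_unit_op: "inner (matrix_unit_op i j h x) y = inner x (matrix_unit_op j i (- h) y)"
proof -
  have "- h + g = g' \<longleftrightarrow> h + g' = g" for g g'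
    by (metis add.assoc add.left_inverse add.right_inverse add_0)
  then show ?thesis
    unfolding inner_l2_def matrix_unit_op_def
    by (intro arg_cong[of _ _ Re] reindex_adjoint) (auto split: if_splits)
qed

text \<open>As a finite combination of partial isometries the matrix is visibly bounded on all of
  \<open>l2\<close>; \<open>family_matrix_l2\<close> identifies it with
  \<open>matrix_op\<close>.\<close>

definition matrix_l2 :: "('g::group_add) group_ring mat \<Rightarrow> (nat \<times> 'g) l2 \<Rightarrow> (nat \<times> 'g) l2" where
  "matrix_l2 A x = (\<Sum>i<dim_row A. \<Sum>j<dim_col A. \<Sum>h\<in>Poly_Mapping.keys (A $$ (i, j)).
     of_int (Poly_Mapping.lookup (A $$ (i, j)) h) *\<^sub>R matrix_unit_op i j h x)"

lemma bounded_linear_matrix_l2: "bounded_linear (matrix_l2 A)"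
  unfolding matrix_l2_def
  by (intro bounded_linear_sum bounded_linear_const_scaleR bounded_linear_matrix_unit_op)

lemma family_matrix_l2: "family (matrix_l2 A x) = matrix_op A (family x)"
proof (intro ext)
  fix k g
  have "coord (matrix_l2 A x) (k, g) = (\<Sum>i<dim_row A. if k = i then \<Sum>j<dim_col A. group_ring_action (A $$ (i, j)) (family x j) g else 0)"
    unfolding matrix_l2_def coord_sum coord_scaleR coord_matrix_unit_op
    by (rule sum.cong) (auto simp: group_ring_action_def family_def scaleR_conv_of_real)
  then show "family (matrix_l2 A x) k g = matrix_op A (family x) k g"
    by (auto simp: family_def matrix_op_def)
qed

lemma matrix_l2_supported: "dim_row A \<le> d \<Longrightarrow> matrix_l2 A x \<in> supported d"
  using family_matrix_l2[of A x] by (auto simp: supported_def family_def matrix_op_def fun_eq_iff)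

lemma matrix_l2_imaginary: "matrix_l2 A (imaginary x) = imaginary (matrix_l2 A x)"
proof (rule l2_eqI)
  fix p
  have "coord (matrix_unit_op i j h (imaginary x)) p = \<i> * coord (matrix_unit_op i j h x) p" for i j h
    by (cases p) (simp add: coord_matrix_unit_op)
  then show "coord (matrix_l2 A (imaginary x)) p = coord (imaginary (matrix_l2 A x)) p"
    by (simp add: matrix_l2_def coord_sum sum_distrib_left)
qed

lemma matrix_op_ell2_pow:
  assumes "dim_row A \<le> d" "u \<in> ell2_pow d"
  shows "matrix_op A u \<in> ell2_pow d" "embed (matrix_op A u) = matrix_l2 A (embed u)"
proof -
  have "matrix_op A u = family (matrix_l2 A (embed u))"
    by (simp add: family_matrix_l2 family_embed[OF assms(2)])
  then show "matrix_op A u \<in> ell2_pow d" "embed (matrix_op A u) = matrix_l2 A (embed u)"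
    using family_ell2_pow[OF matrix_l2_supported[OF assms(1)]] by (simp_all add: embed_family)
qed

section \<open>The involution of the group ring and adjoint matrices\<close>

lemma lookup_group_ring_star: "Poly_Mapping.lookup (group_ring_star a) g = Poly_Mapping.lookup a (- g)"
proof -
  have "Poly_Mapping.lookup (group_ring_star a) g =
      (\<Sum>h\<in>Poly_Mapping.keys a. if h = - g then Poly_Mapping.lookup a h else 0)"
    unfolding group_ring_star_def lookup_sum
    by (rule sum.cong) (auto simp: lookup_single when_def)
  then show ?thesis
    by (simp add: sum.delta in_keys_iff)
qed

lemma keys_group_ring_star: "Poly_Mapping.keys (group_ring_star a) = uminus ` Poly_Mapping.keys a"
proof (intro Set.set_eqI iffI)
  fix g assume "g \<in> Poly_Mapping.keys (group_ring_star a)"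
  then show "g \<in> uminus ` Poly_Mapping.keys a"
    by (intro image_eqI[of g uminus "- g"]) (auto simp: in_keys_iff lookup_group_ring_star)
qed (auto simp: in_keys_iff lookup_group_ring_star)

text \<open>The adjoint of the unit at \<open>(i, j)\<close> with \<open>h\<close> is the unit at
  \<open>(j, i)\<close> with \<open>- h\<close>; substituting inverses in the supports turns the sum
  into the one for \<open>matrix_star A\<close>.\<close>

lemma inner_matrix_l2: "inner (matrix_l2 A x) y = inner x (matrix_l2 (matrix_star A) y)"
proof -
  have star: "(\<Sum>h\<in>Poly_Mapping.keys (group_ring_star a). of_int (Poly_Mapping.lookup (group_ring_star a) h) * f h)
      = (\<Sum>h\<in>Poly_Mapping.keys a. of_int (Poly_Mapping.lookup a h) * f (- h))" for a :: "'a group_ring" and f :: "'a \<Rightarrow> real"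
    unfolding keys_group_ring_star
    by (subst sum.reindex) (auto simp: inj_on_def lookup_group_ring_star)
  have "inner (matrix_l2 A x) y = (\<Sum>i<dim_row A. \<Sum>j<dim_col A. \<Sum>h\<in>Poly_Mapping.keys (A $$ (i, j)).
      of_int (Poly_Mapping.lookup (A $$ (i, j)) h) * inner x (matrix_unit_op j i (- h) y))"
    by (simp add: matrix_l2_def inner_sum_left inner_matrix_unit_op)
  also have "\<dots> = (\<Sum>i<dim_row A. \<Sum>j<dim_col A. \<Sum>h\<in>Poly_Mapping.keys (group_ring_star (A $$ (i, j))).
      of_int (Poly_Mapping.lookup (group_ring_star (A $$ (i, j))) h) * inner x (matrix_unit_op j i h y))"
    by (simp only: star)
  also have "\<dots> = inner x (matrix_l2 (matrix_star A) y)"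
    by (subst sum.swap) (simp add: matrix_l2_def matrix_star_def inner_sum_right)
  finally show ?thesis .
qed

section \<open>Products of group ring matrices and composition of operators\<close>

lemma sum_monomials: "(\<Sum>h\<in>Poly_Mapping.keys a. Poly_Mapping.single h (Poly_Mapping.lookup a h)) = a"
  by (rule poly_mapping_eqI) (simp add: lookup_sum lookup_single when_def sum.delta in_keys_iff)

lemma group_ring_action_superset:
  assumes "finite S" "Poly_Mapping.keys a \<subseteq> S"
  shows "group_ring_action a x g = (\<Sum>h\<in>S. of_int (Poly_Mapping.lookup a h) * x (- h + g))"
  unfolding group_ring_action_def
  by (rule sum.mono_neutral_left) (use assms in \<open>auto simp: in_keys_iff\<close>)

lemma group_ring_action_add:
  "group_ring_action (a + b) x g = group_ring_action a x g + group_ring_action b x g"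
proof -
  let ?S = "Poly_Mapping.keys a \<union> Poly_Mapping.keys b"
  have "Poly_Mapping.keys (a + b) \<subseteq> ?S"
    by (rule Poly_Mapping.keys_add)
  then show ?thesis
    by (subst (1 2 3) group_ring_action_superset[of ?S]) (auto simp: lookup_add distrib_right sum.distrib)
qed

lemma group_ring_action_sum:
  "group_ring_action (\<Sum>i\<in>I. a i) x g = (\<Sum>i\<in>I. group_ring_action (a i) x g)"
proof (induction I rule: infinite_finite_induct)
  case (insert i I)
  then show ?case by (simp add: group_ring_action_add)
qed (simp_all add: group_ring_action_def)

lemma group_ring_action_single:
  "group_ring_action (Poly_Mapping.single h c) x g = of_int c * x (- h + g)"
  by (subst group_ring_action_superset[of "{h}"]) auto

text \<open>Expansion into monomials reduces the action and the involution on products to the group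
  law; the order in \<open>h + k\<close> is kept, since the group need not be commutative.\<close>

lemma mult_eq_sum_single:
  "a * b = (\<Sum>h\<in>Poly_Mapping.keys a. \<Sum>k\<in>Poly_Mapping.keys b.
     Poly_Mapping.single (h + k) (Poly_Mapping.lookup a h * Poly_Mapping.lookup b k :: int))"
  by (subst (1 2) sum_monomials[symmetric]) (simp add: sum_product mult_single)

lemma group_ring_action_mult:
  "group_ring_action (a * b) x g = group_ring_action a (group_ring_action b x) g"
proof -
  have minus: "- (h + k) + g = - k + (- h + g)" for h k
    by (simp only: minus_add add.assoc)
  have "group_ring_action (a * b) x g = (\<Sum>h\<in>Poly_Mapping.keys a. \<Sum>k\<in>Poly_Mapping.keys b.
      of_int (Poly_Mapping.lookup a h) * (of_int (Poly_Mapping.lookup b k) * x (- k + (- h + g))))"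
    by (subst mult_eq_sum_single)
      (simp add: group_ring_action_sum group_ring_action_single minus mult.assoc)
  then show ?thesis
    by (simp add: group_ring_action_def sum_distrib_left)
qed

lemma group_ring_action_1: "group_ring_action 1 x = x"
  using group_ring_action_single[of 0 1 x] by (simp add: fun_eq_iff)

lemma group_ring_action_sum_right:
  "group_ring_action a (\<lambda>g. \<Sum>i\<in>I. x i g) g = (\<Sum>i\<in>I. group_ring_action a (x i) g)"
  unfolding group_ring_action_def sum_distrib_left by (rule sum.swap)

lemma matrix_op_mult:
  assumes A: "A \<in> carrier_mat n m" and B: "B \<in> carrier_mat m k"
  shows "matrix_op (A * B) u = matrix_op A (matrix_op B u)"
proof (intro ext)
  fix i g
  show "matrix_op (A * B) u i g = matrix_op A (matrix_op B u) i g"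
  proof (cases "i < n")
    case True
    have "matrix_op (A * B) u i g = (\<Sum>j<k. \<Sum>l<m. group_ring_action (A $$ (i, l)) (group_ring_action (B $$ (l, j)) (u j)) g)"
      using A B True
      by (simp add: matrix_op_def scalar_prod_def group_ring_action_sum group_ring_action_mult atLeast0LessThan)
    also have "\<dots> = (\<Sum>l<m. group_ring_action (A $$ (i, l)) (\<lambda>g. \<Sum>j<k. group_ring_action (B $$ (l, j)) (u j) g) g)"
      by (subst sum.swap) (simp add: group_ring_action_sum_right)
    also have "\<dots> = matrix_op A (matrix_op B u) i g"
      using A B True by (auto simp: matrix_op_def intro!: sum.cong arg_cong2[of _ _ _ _ "\<lambda>a x. group_ring_action a x g"])
    finally show ?thesis .
  qed (use A B in \<open>simp add: matrix_op_def\<close>)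
qed

lemma matrix_op_one:
  assumes "u \<in> ell2_pow d"
  shows "matrix_op (1\<^sub>m d) u = u"
proof (intro ext)
  fix i g
  have zero: "group_ring_action 0 x g = 0" for x :: "'a \<Rightarrow> complex"
    by (simp add: group_ring_action_def)
  show "matrix_op (1\<^sub>m d) u i g = u i g"
  proof (cases "i < d")
    case True
    have "group_ring_action (if i = j then 1 else 0) (u j) g = (if i = j then u j g else 0)" for j
      by (simp add: group_ring_action_1 zero)
    then show ?thesis
      using True by (simp add: matrix_op_def)
  qed (use assms in \<open>auto simp: matrix_op_def ell2_pow_def\<close>)
qed

lemma matrix_l2_mult:
  assumes "A \<in> carrier_mat n m" "B \<in> carrier_mat m k"
  shows "matrix_l2 (A * B) x = matrix_l2 A (matrix_l2 B x)"
  using arg_cong[OF matrix_op_mult[OF assms, of "family x"], of embed]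
  by (simp add: family_matrix_l2[symmetric] embed_family)

lemma matrix_l2_one:
  assumes "x \<in> supported d"
  shows "matrix_l2 (1\<^sub>m d) x = x"
  using arg_cong[OF matrix_op_one[OF family_ell2_pow[OF assms]], of embed]
  by (simp add: family_matrix_l2[symmetric] embed_family)

lemma group_ring_star_sum: "group_ring_star (\<Sum>i\<in>I. a i) = (\<Sum>i\<in>I. group_ring_star (a i))"
  by (rule poly_mapping_eqI) (simp add: lookup_group_ring_star lookup_sum)

lemma group_ring_star_single: "group_ring_star (Poly_Mapping.single h c) = Poly_Mapping.single (- h) c"
  by (rule poly_mapping_eqI) (auto simp: lookup_group_ring_star lookup_single when_def)

lemma group_ring_star_mult: "group_ring_star (a * b) = group_ring_star b * group_ring_star a"
proof -
  have "group_ring_star (a * b) = (\<Sum>k\<in>Poly_Mapping.keys b. \<Sum>h\<in>Poly_Mapping.keys a.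
      Poly_Mapping.single (- k) (Poly_Mapping.lookup b k) * Poly_Mapping.single (- h) (Poly_Mapping.lookup a h))"
    by (subst mult_eq_sum_single, subst sum.swap)
      (simp add: group_ring_star_sum group_ring_star_single mult_single minus_add mult.commute)
  then show ?thesis
    by (simp add: group_ring_star_def sum_product)
qed

lemma group_ring_star_0_1: "group_ring_star 0 = 0" "group_ring_star 1 = 1"
  by (rule poly_mapping_eqI, auto simp: lookup_group_ring_star lookup_one when_def)+

lemma group_ring_star_star: "group_ring_star (group_ring_star a) = a"
  by (rule poly_mapping_eqI) (simp add: lookup_group_ring_star)

lemma matrix_star_carrier: "A \<in> carrier_mat n m \<Longrightarrow> matrix_star A \<in> carrier_mat m n"
  by (simp add: matrix_star_def)

lemma matrix_star_star: "matrix_star (matrix_star A) = A"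
  by (rule eq_matI) (auto simp: matrix_star_def group_ring_star_star)

lemma matrix_star_mult:
  assumes A: "A \<in> carrier_mat n m" and B: "B \<in> carrier_mat m k"
  shows "matrix_star (A * B) = matrix_star B * matrix_star A"
  by (rule eq_matI)
    (use A B in \<open>auto simp: matrix_star_def scalar_prod_def group_ring_star_sum group_ring_star_mult\<close>)

lemma matrix_star_one: "matrix_star (1\<^sub>m d) = 1\<^sub>m d"
  by (rule eq_matI) (auto simp: matrix_star_def group_ring_star_0_1)


section \<open>Spectral measures of matrices and determinants\<close>

text \<open>The sum of the scalar measures of the vectors \<open>e k\<close>; on the standard
  vectors it is the trace of the spectral measure.\<close>

definition trace_measure :: "(real set \<Rightarrow> 'a::real_inner \<Rightarrow> 'a) \<Rightarrow> ('k \<Rightarrow> 'a) \<Rightarrow> 'k set \<Rightarrow> real measure" where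
  "trace_measure E e K = measure_of UNIV (sets borel) (\<lambda>B. ennreal (\<Sum>k\<in>K. inner (E B (e k)) (e k)))"

lemma sets_trace_measure [simp, measurable_cong]: "sets (trace_measure E e K) = sets borel"
  unfolding trace_measure_def using sets.sigma_sets_eq[of "borel :: real measure"] by simp

lemma space_trace_measure [simp]: "space (trace_measure E e K) = UNIV"
  unfolding trace_measure_def by (simp add: space_measure_of_conv)

context spectral_resolution
begin

lemma emeasure_trace_measure:
  assumes e: "\<And>k. k \<in> K \<Longrightarrow> e k \<in> V" and B: "B \<in> sets borel"
  shows "emeasure (trace_measure E e K) B = ennreal (\<Sum>k\<in>K. inner (E B (e k)) (e k))"
proof (rule emeasure_measure_of[OF trace_measure_def])
  show "countably_additive (sets (trace_measure E e K)) (\<lambda>B. ennreal (\<Sum>k\<in>K. inner (E B (e k)) (e k)))"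
  proof (rule countably_additiveI)
    fix D :: "nat \<Rightarrow> real set"
    assume D: "range D \<subseteq> sets (trace_measure E e K)" "disjoint_family D"
    then have "D n \<in> sets borel" for n by auto
    then have "0 \<le> (\<Sum>k\<in>K. inner (E (D n) (e k)) (e k))" for n
      by (intro sum_nonneg) (simp add: E_norm e)
    then show "suminf (\<lambda>i. ennreal (\<Sum>k\<in>K. inner (E (D i) (e k)) (e k))) = ennreal (\<Sum>k\<in>K. inner (E (\<Union>i. D i) (e k)) (e k))"
      using D e by (intro suminf_ennreal_eq sums_sum E_sums) auto
  qed
  show "positive (sets (trace_measure E e K)) (\<lambda>B. ennreal (\<Sum>k\<in>K. inner (E B (e k)) (e k)))"
    by (simp add: positive_def E_empty e)
qed (use B in auto)

lemma measure_trace_measure: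
  assumes "\<And>k. k \<in> K \<Longrightarrow> e k \<in> V" "B \<in> sets borel"
  shows "measure (trace_measure E e K) B = (\<Sum>k\<in>K. inner (E B (e k)) (e k))"
proof -
  have "0 \<le> (\<Sum>k\<in>K. inner (E B (e k)) (e k))"
    using assms by (intro sum_nonneg) (simp add: E_norm)
  then show ?thesis
    using assms by (simp add: Sigma_Algebra.measure_def emeasure_trace_measure)
qed

lemma finite_trace_measure:
  assumes "\<And>k. k \<in> K \<Longrightarrow> e k \<in> V"
  shows "finite_measure (trace_measure E e K)"
  by (rule finite_measureI) (use assms in \<open>simp add: emeasure_trace_measure\<close>)

end

context inverse_resolutions
begin

text \<open>Positivity of the inverse is positivity of \<open>T\<close> at \<open>S u\<close>,
  because \<open><T (S u), S u> = <u, S u>\<close>.\<close>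

lemma inverse_resolutions_swap: "inverse_resolutions V S T F E"
proof -
  have "0 \<le> inner (S u) u" if u: "u \<in> V" for u
    using T_nonneg[OF R'.T_closed[OF u]] TS[OF u] by (simp add: inner_commute)
  then show ?thesis
    by unfold_locales (simp_all add: commute TS ST)
qed

lemma AE_trace_measure_pos:
  assumes e: "\<And>k. k \<in> K \<Longrightarrow> e k \<in> V"
  shows "AE t in trace_measure E e K. 0 < t"
proof (rule AE_I[of _ _ "{..0}"])
  show "emeasure (trace_measure E e K) {..0} = 0"
    using e by (simp add: R.emeasure_trace_measure E_nonpos)
qed auto

text \<open>Both measures live on the positive reals. For \<open>x > 0\<close> the preimage of
  \<open>{x<..}\<close> is then \<open>{..<1 / x}\<close> up to a null set, and
  \<open>E_greaterThan\<close> with \<open>E\<close> and \<open>F\<close> exchanged applies; for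
  \<open>x \<le> 0\<close> both sides are the total mass.\<close>

lemma trace_measure_inverse:
  assumes e: "\<And>k. k \<in> K \<Longrightarrow> e k \<in> V"
  shows "trace_measure F e K = distr (trace_measure E e K) borel inverse"
proof (rule measure_eqI_lessThan)
  interpret swap: inverse_resolutions V S T F E
    by (rule inverse_resolutions_swap)
  have pos_E: "AE t in trace_measure E e K. 0 < t"
    by (rule AE_trace_measure_pos) (rule e)
  have pos_F: "AE t in trace_measure F e K. 0 < t"
    by (rule swap.AE_trace_measure_pos) (rule e)
  show "emeasure (trace_measure F e K) {x<..} < \<infinity>" for x
    using e by (simp add: R'.emeasure_trace_measure)
  show "emeasure (trace_measure F e K) {x<..} = emeasure (distr (trace_measure E e K) borel inverse) {x<..}" for x
  proof -
    have distr: "emeasure (distr (trace_measure E e K) borel inverse) {x<..} =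
        emeasure (trace_measure E e K) (inverse -` {x<..})"
      by (subst emeasure_distr) auto
    have sets: "inverse -` {x<..} \<in> sets borel"
      using measurable_sets[of inverse borel borel "{x<..}"] by simp
    show ?thesis
    proof (cases "0 < x")
      case True
      have "emeasure (trace_measure E e K) (inverse -` {x<..}) = emeasure (trace_measure E e K) {..<1 / x}"
      proof (rule emeasure_eq_AE)
        show "AE t in trace_measure E e K. t \<in> inverse -` {x<..} \<longleftrightarrow> t \<in> {..<1 / x}"
          using pos_E by eventually_elim (use True in \<open>simp add: field_simps\<close>)
      qed (use sets in simp_all)
      also have "\<dots> = emeasure (trace_measure F e K) {x<..}"
        using e True by (simp add: R.emeasure_trace_measure R'.emeasure_trace_measure swap.E_greaterThan)
      finally show ?thesis
        using distr by simp
    next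
      case False
      have "emeasure (trace_measure E e K) (inverse -` {x<..}) = emeasure (trace_measure E e K) UNIV"
      proof (rule emeasure_eq_AE)
        show "AE t in trace_measure E e K. t \<in> inverse -` {x<..} \<longleftrightarrow> t \<in> UNIV"
          using pos_E
        proof eventually_elim
          fix t :: real assume "0 < t"
          then have "0 < inverse t" by simp
          then show "t \<in> inverse -` {x<..} \<longleftrightarrow> t \<in> UNIV"
            using False by (simp del: inverse_positive_iff_positive)
        qed
      qed (use sets in simp_all)
      also have "\<dots> = emeasure (trace_measure F e K) UNIV"
        using e by (simp add: R.emeasure_trace_measure R'.emeasure_trace_measure R.E_UNIV R'.E_UNIV)
      also have "\<dots> = emeasure (trace_measure F e K) {x<..}"
      proof (rule emeasure_eq_AE)
        show "AE t in trace_measure F e K. t \<in> UNIV \<longleftrightarrow> t \<in> {x<..}"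
          using pos_F by eventually_elim (use False in simp)
      qed simp_all
      finally show ?thesis
        using distr by simp
    qed
  qed
qed simp_all

end

lemma interval_measure_cdf:
  assumes "finite_borel_measure M"
  shows "interval_measure (cdf M) = M"
proof -
  interpret finite_borel_measure M by fact
  have "finite_borel_measure (interval_measure (cdf M))"
    by (rule finite_borel_measure_interval_measure[OF cdf_nondecreasing cdf_is_right_cont cdf_lim_at_bot cdf_lim_at_top])
      (simp_all add: measure_nonneg)
  moreover have "cdf (interval_measure (cdf M)) = cdf M"
    by (rule cdf_interval_measure[OF cdf_nondecreasing cdf_is_right_cont cdf_lim_at_bot])
  ultimately show ?thesis
    using cdf_unique' assms by blast
qed

section \<open>Passage between the real formulation and the complex definitions\<close>

lemma measure_of_eq_form_measure:
  assumes "\<And>B. B \<in> sets borel \<Longrightarrow> f B = inner (E B x) x"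
  shows "measure_of UNIV (sets borel) (\<lambda>B. ennreal (f B)) = form_measure E x"
  unfolding form_measure_def
proof (rule measure_of_eq)
  fix B :: "real set" assume "B \<in> sigma_sets UNIV (sets borel)"
  then have "B \<in> sets borel"
    using sets.sigma_sets_eq[of "borel :: real measure"] by simp
  then show "ennreal (f B) = ennreal (inner (E B x) x)"
    by (simp add: assms)
qed simp

lemma pow_inner_embed_Complex:
  assumes "u \<in> ell2_pow d" "v \<in> ell2_pow d"
  shows "pow_inner d u v = Complex (inner (embed u) (embed v)) (inner (embed u) (imaginary (embed v)))"
  by (simp add: pow_inner_embed[OF assms] l2_inner_eq_Complex)

text \<open>Symmetry and positivity are asked on the whole of \<open>l2\<close>, where
  \<open>spectral_resolution_exists\<close> is formulated.\<close>

definition positive_matrix :: "nat \<Rightarrow> ('g::group_add) group_ring mat \<Rightarrow> bool" where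
  "positive_matrix d M \<longleftrightarrow> M \<in> carrier_mat d d \<and>
     (\<forall>x y. inner (matrix_l2 M x) y = inner x (matrix_l2 M y)) \<and> (\<forall>x. 0 \<le> inner (matrix_l2 M x) x)"

lemma positive_matrix_star_mult:
  assumes A: "A \<in> carrier_mat d d"
  shows "positive_matrix d (matrix_star A * A)"
proof -
  have mult: "matrix_l2 (matrix_star A * A) x = matrix_l2 (matrix_star A) (matrix_l2 A x)" for x
    by (rule matrix_l2_mult[OF matrix_star_carrier[OF A] A])
  have form: "inner (matrix_l2 (matrix_star A * A) x) y = inner (matrix_l2 A x) (matrix_l2 A y)" for x y
    unfolding mult inner_matrix_l2[of "matrix_star A"] matrix_star_star ..
  have "inner (matrix_l2 (matrix_star A * A) x) y = inner x (matrix_l2 (matrix_star A * A) y)" for x y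
    using form[of x y] form[of y x] by (simp only: inner_commute)
  moreover have "0 \<le> inner (matrix_l2 (matrix_star A * A) x) x" for x
    unfolding form by simp
  moreover have "matrix_star A * A \<in> carrier_mat d d"
    using A matrix_star_carrier[OF A] by simp
  ultimately show ?thesis
    unfolding positive_matrix_def by blast
qed

lemma positive_self_adjoint_matrix_op:
  assumes M: "positive_matrix d M"
  shows "positive_self_adjoint_op d (matrix_op M)"
proof -
  have dim: "dim_row M \<le> d"
    using M by (auto simp: positive_matrix_def)
  show ?thesis
    using M unfolding positive_self_adjoint_op_def self_adjoint_op_def positive_matrix_def
    by (auto simp: matrix_op_ell2_pow[OF dim] pow_inner_embed_Complex matrix_l2_imaginary[symmetric])
qed

text \<open>The transfer holds for an arbitrary spectral measure, in particular for the one picked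
  by choice. Real parts of inner products are enough, as the spectral density is a real part
  too.\<close>

lemma spectral_measure_imp_resolution:
  assumes M: "positive_matrix d M" and E: "is_spectral_measure d (matrix_op M) E"
  shows "spectral_resolution (supported d) (matrix_l2 M) (\<lambda>B x. embed (E B (family x)))"
proof -
  let ?F = "\<lambda>B x. embed (E B (family x))"
  have pvm: "projection_valued_measure d E"
    using E by (simp add: is_spectral_measure_def)
  have dim: "dim_row M \<le> d"
    using M by (auto simp: positive_matrix_def)
  have pow: "E B u \<in> ell2_pow d" if "B \<in> sets borel" "u \<in> ell2_pow d" for B u
    using pvm that by (simp add: projection_valued_measure_def orthogonal_projection_op_def self_adjoint_op_def)
  have quadratic: "Re (pow_inner d (E B u) v) = inner (?F B (embed u)) (embed v)"
    if "B \<in> sets borel" "u \<in> ell2_pow d" "v \<in> ell2_pow d" for B u v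
    using pow[OF that(1,2)] that by (simp add: pow_inner_embed_Complex family_embed)
  have form: "scalar_spectral_measure d E (family x) = form_measure ?F x" if "x \<in> supported d" for x
    unfolding scalar_spectral_measure_def
    by (rule measure_of_eq_form_measure) (use quadratic family_ell2_pow[OF that] in \<open>simp add: embed_family\<close>)
  show ?thesis
  proof
    show "subspace (supported d)"
      by (rule subspace_supported)
    show "matrix_l2 M u \<in> supported d" for u
      by (rule matrix_l2_supported[OF dim])
    show "inner (matrix_l2 M u) v = inner u (matrix_l2 M v)" for u v
      using M by (simp add: positive_matrix_def)
    show "?F B u \<in> supported d" if "B \<in> sets borel" "u \<in> supported d" for B u
      by (intro embed_supported pow family_ell2_pow that)
    show "inner (?F B u) v = inner u (?F B v)" if B: "B \<in> sets borel" and u: "u \<in> supported d" and v: "v \<in> supported d" for B u v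
    proof -
      have "pow_inner d (E B (family u)) (family v) = pow_inner d (family u) (E B (family v))"
        using pvm B family_ell2_pow[OF u] family_ell2_pow[OF v]
        by (simp add: projection_valued_measure_def orthogonal_projection_op_def self_adjoint_op_def)
      then show ?thesis
        using pow[OF B] family_ell2_pow[OF u] family_ell2_pow[OF v] by (simp add: pow_inner_embed_Complex embed_family)
    qed
    show "?F UNIV u = u" if "u \<in> supported d" for u
      using pvm family_ell2_pow[OF that] by (simp add: projection_valued_measure_def embed_family)
    show "?F (B \<inter> C) u = ?F B (?F C u)" if "B \<in> sets borel" "C \<in> sets borel" "u \<in> supported d" for B C u
      using pvm that pow family_ell2_pow[OF that(3)]
      by (simp add: projection_valued_measure_def family_embed[OF pow])
    show "(\<lambda>n. inner (?F (D n) u) u) sums inner (?F (\<Union>n. D n) u) u"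
      if D: "range D \<subseteq> sets borel" "disjoint_family D" and u: "u \<in> supported d" for D :: "nat \<Rightarrow> real set" and u
    proof -
      have meas: "D n \<in> sets borel" for n using D by auto
      have "(\<lambda>n. pow_inner d (E (D n) (family u)) (family u)) sums pow_inner d (E (\<Union>n. D n) (family u)) (family u)"
        using pvm D family_ell2_pow[OF u] by (simp add: projection_valued_measure_def)
      from sums_Re[OF this] show ?thesis
        using meas family_ell2_pow[OF u] by (simp add: quadratic embed_family)
    qed
    show "integrable (form_measure ?F u) (\<lambda>t. t)" if "u \<in> supported d" for u
      using E family_ell2_pow[OF that] by (simp add: is_spectral_measure_def form[OF that, symmetric])
    show "inner (matrix_l2 M u) u = (LINT t|form_measure ?F u. t)" if u: "u \<in> supported d" for u
    proof -
      have "Re (pow_inner d (matrix_op M (family u)) (family u)) = (LINT t|form_measure ?F u. t)"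
        using E family_ell2_pow[OF u] by (simp add: is_spectral_measure_def form[OF u])
      then show ?thesis
        using matrix_op_ell2_pow[OF dim family_ell2_pow[OF u]] family_ell2_pow[OF u]
        by (simp add: pow_inner_embed_Complex embed_family)
    qed
  qed
qed

text \<open>The resolution on all of \<open>l2\<close> preserves \<open>supported d\<close>. It
  commutes with \<open>imaginary\<close> because the matrix does, and this makes its projections
  self-adjoint for the complex inner product.\<close>

lemma spectral_measure_exists:
  fixes M :: "('g::group_add) group_ring mat"
  assumes M: "positive_matrix d M"
  shows "\<exists>E. is_spectral_measure d (matrix_op M) E"
proof -
  have dim: "dim_row M \<le> d"
    using M by (auto simp: positive_matrix_def)
  from spectral_resolution_exists[OF bounded_linear_matrix_l2, of M] M
  obtain E R where ER: "spectral_resolution UNIV (matrix_l2 M) E \<and> (\<forall>u. E {-R..R} u = u) \<and>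
    (\<forall>V. \<forall>B\<in>sets borel. \<forall>u\<in>V. invariant_subspace (matrix_l2 M) V \<longrightarrow>
       E B u \<in> V \<and> (\<forall>X\<in>bounded_commutant (matrix_l2 M) V. X (E B u) = E B (X u)))"
    unfolding positive_matrix_def by blast
  interpret E: spectral_resolution UNIV "matrix_l2 M" E
    by (rule ER[THEN conjunct1])
  have supp: "E B x \<in> supported d" if "B \<in> sets borel" "x \<in> supported d" for B x
    using ER that matrix_l2_supported[OF dim]
    by (simp add: invariant_subspace_def subspace_supported closed_supported)
  have imag: "imaginary (E B x) = E B (imaginary x)" if "B \<in> sets borel" for B x
  proof -
    have "invariant_subspace (matrix_l2 M) UNIV"
      by (simp add: invariant_subspace_def)
    moreover have "imaginary \<in> bounded_commutant (matrix_l2 M) UNIV"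
      by (auto simp: bounded_commutant_def imaginary_linear matrix_l2_imaginary intro!: exI[of _ 1])
    ultimately show ?thesis
      using ER that by blast
  qed
  define F where "F B u = family (E B (embed u))" for B u
  have pow: "F B u \<in> ell2_pow d" if "B \<in> sets borel" "u \<in> ell2_pow d" for B u
    unfolding F_def by (intro family_ell2_pow supp embed_supported that)
  have embed_F: "embed (F B u) = E B (embed u)" for B u
    by (simp add: F_def embed_family)
  have inner_F: "pow_inner d (F B u) v = Complex (inner (E B (embed u)) (embed v)) (inner (E B (embed u)) (imaginary (embed v)))"
    if "B \<in> sets borel" "u \<in> ell2_pow d" "v \<in> ell2_pow d" for B u v
    using pow[OF that(1,2)] that by (simp add: pow_inner_embed_Complex embed_F)
  have form: "scalar_spectral_measure d F u = form_measure E (embed u)" if "u \<in> ell2_pow d" for u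
    unfolding scalar_spectral_measure_def by (rule measure_of_eq_form_measure) (simp add: inner_F that)
  have sums: "(\<lambda>n. inner (E (D n) x) y) sums inner (E (\<Union>n. D n) x) y"
    if D: "range D \<subseteq> sets borel" "disjoint_family D" for D :: "nat \<Rightarrow> real set" and x y
  proof -
    \<comment> \<open>The resolution is countably additive on diagonal terms, a projection valued
      measure on all pairs of vectors; polarization bridges the two.\<close>
    have polar: "inner (E B x) y = (inner (E B (x + y)) (x + y) - inner (E B (x - y)) (x - y)) / 4"
      if "B \<in> sets borel" for B
    proof -
      have "inner (E B y) x = inner (E B x) y"
        using E.E_symmetric[of B y x] that by (simp add: inner_commute)
      moreover have "E B (x - y) = E B x - E B y"
        using E.E_add[of B x "(-1) *\<^sub>R y"] E.E_scaleR[of B y "-1"] that by simp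
      ultimately show ?thesis
        using that by (simp add: E.E_add inner_add_left inner_add_right inner_diff_left inner_diff_right)
    qed
    have meas: "D n \<in> sets borel" for n using D by auto
    have "(\<lambda>n. (inner (E (D n) (x + y)) (x + y) - inner (E (D n) (x - y)) (x - y)) / 4) sums
      ((inner (E (\<Union>n. D n) (x + y)) (x + y) - inner (E (\<Union>n. D n) (x - y)) (x - y)) / 4)"
      by (intro sums_divide sums_diff E.E_sums D UNIV_I)
    then show ?thesis
      by (simp only: polar[OF meas] polar[OF sets.countable_nat_UN[OF D(1)]])
  qed
  have "is_spectral_measure d (matrix_op M) F"
    unfolding is_spectral_measure_def
  proof (intro conjI ballI exI)
    show "projection_valued_measure d F"
      unfolding projection_valued_measure_def orthogonal_projection_op_def self_adjoint_op_def
    proof (intro conjI ballI allI impI)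
      fix B :: "real set" and u :: "'g ell2_family"
      assume B: "B \<in> sets borel" and u: "u \<in> ell2_pow d"
      show "F B u \<in> ell2_pow d"
        by (rule pow[OF B u])
      show "F B (F B u) = F B u"
        using B E.E_idem[OF B] by (simp add: F_def embed_family)
      show "pow_inner d (F B u) v = pow_inner d u (F B v)" if v: "v \<in> ell2_pow d" for v
        using pow[OF B v] u v B
        by (simp add: inner_F pow_inner_embed_Complex embed_F imag E.E_symmetric)
    next
      fix u :: "'g ell2_family" assume "u \<in> ell2_pow d"
      then show "F UNIV u = u"
        by (simp add: F_def E.E_UNIV family_embed)
    next
      fix B C :: "real set" and u :: "'g ell2_family" assume "B \<in> sets borel" "C \<in> sets borel" "u \<in> ell2_pow d"
      then show "F (B \<inter> C) u = F B (F C u)"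
        by (simp add: F_def E.E_Int embed_family)
    next
      fix D :: "nat \<Rightarrow> real set" and u v :: "'g ell2_family"
      assume D: "range D \<subseteq> sets borel" "disjoint_family D" and u: "u \<in> ell2_pow d" and v: "v \<in> ell2_pow d"
      have meas: "D n \<in> sets borel" for n using D by auto
      then have "(\<Union>n. D n) \<in> sets borel" by auto
      then show "(\<lambda>n. pow_inner d (F (D n) u) v) sums pow_inner d (F (\<Union>n. D n) u) v"
        using meas u v sums[OF D] by (simp add: inner_F sums_complex_iff)
    qed
    show "F {-R..R} u = u" if "u \<in> ell2_pow d" for u
      using ER that by (simp add: F_def family_embed)
  next
    fix u :: "'g ell2_family" assume u: "u \<in> ell2_pow d"
    show "integrable (scalar_spectral_measure d F u) (\<lambda>t. t)"
      using E.T_integrable by (simp add: form[OF u])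
    \<comment> \<open>The imaginary part of \<open><M u, u>\<close> equals its own negative, so the
      complex form is real.\<close>
    have "inner (matrix_l2 M (embed u)) (imaginary (embed u)) = - inner (matrix_l2 M (embed u)) (imaginary (embed u))"
    proof -
      have "inner (matrix_l2 M (embed u)) (imaginary (embed u)) = inner (embed u) (imaginary (matrix_l2 M (embed u)))"
        using M by (simp add: positive_matrix_def matrix_l2_imaginary)
      also have "\<dots> = - inner (imaginary (embed u)) (matrix_l2 M (embed u))"
        by (rule inner_imaginary)
      finally show ?thesis by (simp add: inner_commute)
    qed
    then show "pow_inner d (matrix_op M u) u = complex_of_real (LINT t|scalar_spectral_measure d F u. t)"
      using u E.T_integral[of "embed u"] matrix_op_ell2_pow[OF dim u]
      by (simp add: form[OF u] pow_inner_embed_Complex complex_eq_iff)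
  qed
  then show ?thesis by blast
qed

section \<open>The trace, the spectral density and the determinant\<close>

definition standard_vector :: "nat \<Rightarrow> (nat \<times> 'g::group_add) l2" where
  "standard_vector i = embed (\<lambda>k. if k = i then ell2_unit else (\<lambda>_. 0))"

lemma standard_vector_ell2_pow:
  "i < d \<Longrightarrow> (\<lambda>k. if k = i then ell2_unit else (\<lambda>_. 0)) \<in> ell2_pow d"
proof -
  have "(\<lambda>g. (cmod (ell2_unit g))\<^sup>2) summable_on {0 :: 'a}"
    by simp
  also have "?this \<longleftrightarrow> (\<lambda>g. (cmod (ell2_unit g))\<^sup>2) summable_on (UNIV :: 'a set)"
    by (rule summable_on_cong_neutral) (auto simp: ell2_unit_def)
  finally show "i < d \<Longrightarrow> (\<lambda>k. if k = i then (ell2_unit :: 'a \<Rightarrow> complex) else (\<lambda>_. 0)) \<in> ell2_pow d"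
    by (auto simp: ell2_pow_def ell2_def)
qed

lemma vn_matrix_trace_eq:
  "vn_matrix_trace d P = (\<Sum>i<d. pow_inner d (P (\<lambda>k. if k = i then ell2_unit else (\<lambda>_. 0))) (\<lambda>k. if k = i then ell2_unit else (\<lambda>_. 0)))"
  unfolding vn_matrix_trace_def
proof (rule sum.cong)
  fix i assume "i \<in> {..<d}"
  define v :: "'a ell2_family" where "v = P (\<lambda>k. if k = i then ell2_unit else (\<lambda>_. 0))"
  have "pow_inner d v (\<lambda>k. if k = i then ell2_unit else (\<lambda>_. 0)) = (\<Sum>k<d. if k = i then ell2_inner (v k) ell2_unit else 0)"
    unfolding pow_inner_def by (rule sum.cong) (auto simp: ell2_inner_def)
  also have "\<dots> = ell2_inner (v i) ell2_unit"
    using \<open>i \<in> {..<d}\<close> by simp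
  finally show "vn_trace (op_entry P i i) = pow_inner d (P (\<lambda>k. if k = i then ell2_unit else (\<lambda>_. 0))) (\<lambda>k. if k = i then ell2_unit else (\<lambda>_. 0))"
    by (simp add: vn_trace_def op_entry_def v_def)
qed simp

text \<open>The spectral density uses \<open>{0..s}\<close>, a distribution function
  \<open>{..s}\<close>; by \<open>pos\<close> the negative reals carry no mass, so the two agree,
  and the Stieltjes measure of a distribution function is the measure it came from.\<close>

lemma interval_measure_spectral_density:
  assumes M: "positive_matrix d M" and E: "is_spectral_measure d (matrix_op M) (spectral_projection d (matrix_op M))"
    and pos: "AE t in trace_measure (\<lambda>B x. embed (spectral_projection d (matrix_op M) B (family x))) standard_vector {..<d}. 0 < t"
  shows "interval_measure (spectral_density d (matrix_op M)) =
    trace_measure (\<lambda>B x. embed (spectral_projection d (matrix_op M) B (family x))) standard_vector {..<d}"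
proof -
  let ?P = "spectral_projection d (matrix_op M)"
  let ?M = "trace_measure (\<lambda>B x. embed (?P B (family x))) standard_vector {..<d}"
  interpret spectral_resolution "supported d" "matrix_l2 M" "\<lambda>B x. embed (?P B (family x))"
    by (rule spectral_measure_imp_resolution[OF M E])
  have e: "standard_vector i \<in> supported d" if "i \<in> {..<d}" for i
    unfolding standard_vector_def using that by (intro embed_supported standard_vector_ell2_pow) simp
  have pow: "?P B u \<in> ell2_pow d" if "B \<in> sets borel" "u \<in> ell2_pow d" for B u
    using E that by (simp add: is_spectral_measure_def projection_valued_measure_def orthogonal_projection_op_def self_adjoint_op_def)
  have "spectral_density d (matrix_op M) = cdf ?M"
  proof (rule ext)
    fix s
    have "spectral_density d (matrix_op M) s = (\<Sum>i<d. inner (embed (?P {0..s} (family (standard_vector i)))) (standard_vector i))"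
      unfolding spectral_density_def vn_matrix_trace_eq Re_sum
      by (rule sum.cong) (auto simp: standard_vector_def pow_inner_embed_Complex pow standard_vector_ell2_pow family_embed[OF standard_vector_ell2_pow])
    also have "\<dots> = measure ?M {0..s}"
    proof -
      have "measure ?M {0..s} = (\<Sum>i<d. inner (embed (?P {0..s} (family (standard_vector i)))) (standard_vector i))"
        by (rule measure_trace_measure) (auto intro: e)
      then show ?thesis ..
    qed
    also have "\<dots> = measure ?M {..s}"
    proof (rule measure_eq_AE)
      show "AE t in ?M. t \<in> {0..s} \<longleftrightarrow> t \<in> {..s}"
        using pos by eventually_elim auto
    qed auto
    finally show "spectral_density d (matrix_op M) s = cdf ?M s" by (simp add: cdf_def)
  qed
  moreover have "finite_borel_measure ?M"
  proof -
    have "finite_measure ?M"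
      by (rule finite_trace_measure) (rule e)
    then show ?thesis
      by (simp add: finite_borel_measure_def finite_borel_measure_axioms_def)
  qed
  ultimately show ?thesis
    by (simp only: interval_measure_cdf)
qed

lemma spectral_projection_spectral_measure:
  assumes "positive_matrix d M"
  shows "is_spectral_measure d (matrix_op M) (spectral_projection d (matrix_op M))"
proof -
  have "spectral_projection d (matrix_op M) = (SOME E. is_spectral_measure d (matrix_op M) E)"
    by (simp add: spectral_projection_def fun_eq_iff)
  then show ?thesis
    using someI_ex[OF spectral_measure_exists[OF assms]] by simp
qed

text \<open>The chosen projections of \<open>M\<close> commute with \<open>M\<close>, hence with its
  inverse \<open>N\<close>, hence by \<open>spectral_resolution_commute\<close> with the chosen
  projections of \<open>N\<close>. This brings the two independent choices into
  \<open>inverse_resolutions\<close>.\<close>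

lemma interval_measure_inverse:
  assumes M: "positive_matrix d M" and N: "positive_matrix d N"
    and MN: "M * N = 1\<^sub>m d" and NM: "N * M = 1\<^sub>m d"
  shows "interval_measure (spectral_density d (matrix_op N)) =
    distr (interval_measure (spectral_density d (matrix_op M))) borel inverse"
proof -
  define E where "E B x = embed (spectral_projection d (matrix_op M) B (family x))" for B x
  define F where "F B x = embed (spectral_projection d (matrix_op N) B (family x))" for B x
  have carrier: "M \<in> carrier_mat d d" "N \<in> carrier_mat d d"
    using M N by (auto simp: positive_matrix_def)
  interpret E: spectral_resolution "supported d" "matrix_l2 M" E
    unfolding E_def by (rule spectral_measure_imp_resolution[OF M spectral_projection_spectral_measure[OF M]])
  interpret F: spectral_resolution "supported d" "matrix_l2 N" F
    unfolding F_def by (rule spectral_measure_imp_resolution[OF N spectral_projection_spectral_measure[OF N]])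
  have TS: "matrix_l2 M (matrix_l2 N x) = x" and ST: "matrix_l2 N (matrix_l2 M x) = x" if "x \<in> supported d" for x
    using matrix_l2_mult[OF carrier] matrix_l2_mult[OF carrier(2,1)] matrix_l2_one[OF that]
    by (simp_all add: MN NM)
  have commute_E: "matrix_l2 N (E B x) = E B (matrix_l2 N x)" if B: "B \<in> sets borel" and x: "x \<in> supported d" for B x
  proof -
    \<comment> \<open>Commutation passes to the inverse: \<open>N M = 1\<close> is inserted on the
      left and \<open>M\<close> is moved through \<open>E B\<close>.\<close>
    have "E B (matrix_l2 N x) = matrix_l2 N (matrix_l2 M (E B (matrix_l2 N x)))"
      using B x by (simp add: ST E.E_closed F.T_closed)
    also have "\<dots> = matrix_l2 N (E B x)"
      using B x by (simp add: E.T_E_commute TS F.T_closed)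
    finally show ?thesis by simp
  qed
  have N_sym: "inner (matrix_l2 N x) y = inner x (matrix_l2 N y)" and N_pos: "0 \<le> inner (matrix_l2 N x) x" for x y
    using N unfolding positive_matrix_def by blast+
  interpret inverse_resolutions "supported d" "matrix_l2 M" "matrix_l2 N" E F
  proof
    show "E B (F C x) = F C (E B x)" if B: "B \<in> sets borel" and C: "C \<in> sets borel" and x: "x \<in> supported d" for B C x
    proof (rule spectral_resolution_commute[OF bounded_linear_matrix_l2 N_sym N_pos F.spectral_resolution_axioms closed_supported _ x C])
      show "E B \<in> bounded_commutant (matrix_l2 N) (supported d)"
        unfolding bounded_commutant_def using B
        by (auto simp: E.E_closed E.E_add E.E_scaleR commute_E intro!: exI[of _ 1] E.E_norm_le)
    qed
    show "0 \<le> inner (matrix_l2 M x) x" for x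
      using M unfolding positive_matrix_def by blast
  qed (simp_all add: TS ST)
  interpret swap: inverse_resolutions "supported d" "matrix_l2 N" "matrix_l2 M" F E
    by (rule inverse_resolutions_swap)
  have e: "standard_vector i \<in> supported d" if "i \<in> {..<d}" for i
    unfolding standard_vector_def using that by (intro embed_supported standard_vector_ell2_pow) simp
  have "AE t in trace_measure E standard_vector {..<d}. 0 < t"
    by (rule AE_trace_measure_pos) (rule e)
  then have "interval_measure (spectral_density d (matrix_op M)) = trace_measure E standard_vector {..<d}"
    unfolding E_def[abs_def] by (rule interval_measure_spectral_density[OF M spectral_projection_spectral_measure[OF M]])
  moreover have "AE t in trace_measure F standard_vector {..<d}. 0 < t"
    by (rule swap.AE_trace_measure_pos) (rule e)
  then have "interval_measure (spectral_density d (matrix_op N)) = trace_measure F standard_vector {..<d}"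
    unfolding F_def[abs_def] by (rule interval_measure_spectral_density[OF N spectral_projection_spectral_measure[OF N]])
  moreover have "trace_measure F standard_vector {..<d} = distr (trace_measure E standard_vector {..<d}) borel inverse"
    by (rule trace_measure_inverse) (rule e)
  ultimately show ?thesis by simp
qed

text \<open>Substituting 1/t for t changes the sign of the logarithmic integral, so two nonnegative
  numbers add up to 0.\<close>

lemma ln_det_inverse:
  assumes M: "positive_matrix d M" and N: "positive_matrix d N"
    and MN: "M * N = 1\<^sub>m d" and NM: "N * M = 1\<^sub>m d"
    and "0 \<le> ln_det d (matrix_op M)" "0 \<le> ln_det d (matrix_op N)"
  shows "ln_det d (matrix_op M) = 0"
proof -
  let ?\<mu> = "interval_measure (spectral_density d (matrix_op M))"
  let ?\<nu> = "interval_measure (spectral_density d (matrix_op N))"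
  have \<nu>: "?\<nu> = distr ?\<mu> borel inverse"
    by (rule interval_measure_inverse[OF M N MN NM])
  \<comment> \<open>The value for a divergent integral is \<open>- \<infinity>\<close>, which
    nonnegativity excludes; so both integrals converge.\<close>
  have "set_integrable ?\<mu> {0<..} ln" "set_integrable ?\<nu> {0<..} ln"
    using assms(5,6) by (auto simp: ln_det_def split: if_splits)
  then have "ln_det d (matrix_op M) = ereal (LINT t:{0<..}|?\<mu>. ln t)" "ln_det d (matrix_op N) = ereal (LINT t:{0<..}|?\<nu>. ln t)"
    by (simp_all add: ln_det_def)
  moreover have "(LINT t:{0<..}|?\<nu>. ln t) = - (LINT t:{0<..}|?\<mu>. ln t)"
  proof -
    have "(LINT t:{0<..}|?\<nu>. ln t) = (LINT t|?\<mu>. indicator {0<..} (inverse t) *\<^sub>R ln (inverse t))"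
      unfolding \<nu> set_lebesgue_integral_def by (rule integral_distr) simp_all
    \<comment> \<open>Since \<open>inverse 0 = 0\<close>, the numbers \<open>t\<close> and
      \<open>inverse t\<close> have the same sign for every real \<open>t\<close>, and the indicator
      is unchanged.\<close>
    also have "\<dots> = (LINT t|?\<mu>. - (indicator {0<..} t *\<^sub>R ln t))"
      by (rule Bochner_Integration.integral_cong) (auto simp: indicator_def ln_inverse)
    finally show ?thesis
      by (simp add: set_lebesgue_integral_def)
  qed
  ultimately show ?thesis
    using assms(5,6) by (simp add: zero_ereal_def)
qed

text \<open>\<open>invertible_mat\<close> speaks of an inverse of unspecified shape; comparing
  dimensions in the two identities fixes it.\<close>

lemma general_linear_obtain_inverse:
  assumes "A \<in> general_linear d"
  obtains B where "A \<in> carrier_mat d d" "B \<in> carrier_mat d d" "A * B = 1\<^sub>m d" "B * A = 1\<^sub>m d"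
proof -
  from assms have A: "A \<in> carrier_mat d d" and "invertible_mat A"
    by (auto simp: general_linear_def)
  then obtain B where B: "A * B = 1\<^sub>m d" "B * A = 1\<^sub>m (dim_row B)"
    by (auto simp: invertible_mat_def inverts_mat_def)
  have "dim_col B = d"
    using arg_cong[OF B(1), of dim_col] by simp
  moreover have "dim_row B = d"
    using arg_cong[OF B(2), of dim_col] A by simp
  ultimately have "B \<in> carrier_mat d d" "B * A = 1\<^sub>m d"
    using B by auto
  with A B show ?thesis by (auto intro: that)
qed

theorem theorem1p22:
  "((\<forall>d. \<forall>A\<in>(general_linear d :: ('g::group_add) group_ring mat set).
        0 \<le> ln_det d (matrix_op (matrix_star A * A)))
      \<longrightarrow> (\<forall>d. \<forall>A\<in>(general_linear d :: 'g group_ring mat set).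
        ln_det d (matrix_op (matrix_star A * A)) = 0))
    \<and> (semi_integral_determinant TYPE('g) \<longrightarrow> whitehead_trivial_determinant TYPE('g))"
proof -
  have main: "ln_det d (matrix_op (matrix_star A * A)) = 0"
    if nonneg: "\<And>d A. A \<in> (general_linear d :: 'g group_ring mat set) \<Longrightarrow> 0 \<le> ln_det d (matrix_op (matrix_star A * A))"
      and A_gl: "A \<in> (general_linear d :: 'g group_ring mat set)" for d A
  proof -
    obtain B where A: "A \<in> carrier_mat d d" and B: "B \<in> carrier_mat d d"
      and AB: "A * B = 1\<^sub>m d" and BA: "B * A = 1\<^sub>m d"
      using general_linear_obtain_inverse[OF A_gl] .
    define A' B' where "A' = matrix_star A" and "B' = matrix_star B"
    have A': "A' \<in> carrier_mat d d" and B': "B' \<in> carrier_mat d d"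
      by (simp_all add: A'_def B'_def matrix_star_carrier A B)
    have AB': "A' * B' = 1\<^sub>m d"
      by (simp only: A'_def B'_def matrix_star_mult[OF B A, symmetric] BA matrix_star_one)
    have BA': "B' * A' = 1\<^sub>m d"
      by (simp only: A'_def B'_def matrix_star_mult[OF A B, symmetric] AB matrix_star_one)
    have "invertible_mat B'"
      using A' B' AB' BA' by (auto simp: invertible_mat_def inverts_mat_def)
    then have B'_gl: "B' \<in> general_linear d"
      using B' by (simp add: general_linear_def)
    have star_B': "matrix_star B' = B"
      by (simp add: B'_def matrix_star_star)
    \<comment> \<open>Cancelling from the inside shows that \<open>B * B'\<close>, which is
      \<open>matrix_star B' * B'\<close>, is inverse to \<open>A' * A\<close>.\<close>
    have "(A' * A) * (B * B') = A' * ((A * B) * B')"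
      using A A' B B' by (simp add: assoc_mult_mat[of _ d d _ d _ d])
    then have MN: "(A' * A) * (matrix_star B' * B') = 1\<^sub>m d"
      using B' AB' by (simp add: star_B' AB)
    have "(B * B') * (A' * A) = B * ((B' * A') * A)"
      using A A' B B' by (simp add: assoc_mult_mat[of _ d d _ d _ d])
    then have NM: "(matrix_star B' * B') * (A' * A) = 1\<^sub>m d"
      using A BA by (simp add: star_B' BA')
    show ?thesis
      using ln_det_inverse[OF positive_matrix_star_mult[OF A] positive_matrix_star_mult[OF B'] _ _ nonneg[OF A_gl] nonneg[OF B'_gl]]
        MN NM by (simp add: A'_def)
  qed
  \<comment> \<open>The second claim reduces to the first, as \<open>matrix_star A * A\<close> is a
    positive matrix over the integral group ring.\<close>
  moreover have "0 \<le> ln_det d (matrix_op (matrix_star A * A))"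
    if semi: "semi_integral_determinant TYPE('g)" and A: "A \<in> (general_linear d :: 'g group_ring mat set)" for d A
  proof -
    have "A \<in> carrier_mat d d"
      using A by (simp add: general_linear_def)
    then have M: "positive_matrix d (matrix_star A * A)"
      by (rule positive_matrix_star_mult)
    then have "matrix_star A * A \<in> carrier_mat d d"
      unfolding positive_matrix_def by blast
    then show ?thesis
      using semi positive_self_adjoint_matrix_op[OF M] unfolding semi_integral_determinant_def by blast
  qed
  ultimately show ?thesis
    unfolding whitehead_trivial_determinant_def by (intro conjI impI allI ballI) metis+
qed

end
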